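(* Let $Z_1,Z_2,\dots\stackrel{iid}{\sim}Z$ and let $h(Z_{s_1},\dots,Z_{s_{k_N}})\in\mathbb{R}$ be any generic kernel function of $k_N$ arguments. Let $U_{k_N,m_N}=m_N^{-1}\sum_{s\in\mathcal{S}}h(Z_{s_1},\dots,Z_{s_{k_N}})$ be an incomplete, infinite order $U$-statistic with $0<k_N<N$ and $k_N\to\infty$. Assume $\mathrm{E}h^2<\infty$ given each $k_N$. Then $$\mathrm{Var}(U_{k_N,m_N})\le\frac{k_N}{N}\zeta_{k_N,k_N}\left(1+\frac{k_N}{N}\right)+\frac1{m_N}\zeta_{k_N,k_N}\left\{1-\frac1{\binom{N}{k_N}}\right\}.$$ If we further assume $\zeta_{1,k_N}\ne0$, then $$\mathrm{Var}(U_{k_N,m_N})=\frac{k_N^2}{N}\zeta_{1,k_N}\{1+O(a_N)\}+\frac1{m_N}\zeta_{k_N,k_N}\left\{1-\frac1{\binom{N}{k_N}}\right\},$$ where $a_N=(k_N/N)\{\zeta_{k_N,k_N}/(k_N\zeta_{1,k_N})\}$. In addition, assume $k_N\to\infty$ and $a_N\to0$ as $N\to\infty$. Then: (1) If $a_NN^2/(k_N^2m_N)\to0$, then $\mathrm{Var}(U_{k_N,m_N})=\{1+o(1)\}k_N^2\zeta_{1,k_N}/N$. If we further assume the Lindeberg condition stated in the context, then $$\frac{U_{k_N,m_N}-\mathrm{E}h}{\sqrt{k_N^2\zeta_{1,k_N}/N}}\stackrel{d}{\longrightarrow}\mathcal{N}(0,1).$$ (2) If $a_NN^2/(k_N^2m_N)\to\infty$,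 then $\mathrm{Var}(U_{k_N,m_N})=\{1+o(1)\}\zeta_{k_N,k_N}/m_N$. If we further assume $m_N\to\infty$, $\mathrm{E}h^4<\infty$, and $\mathrm{E}(h-\mathrm{E}h)^4/\{\mathrm{E}(h-\mathrm{E}h)^2\}^2=O(1)$, then $$\frac{U_{k_N,m_N}-\mathrm{E}h}{\sqrt{\zeta_{k_N,k_N}/m_N}}\stackrel{d}{\longrightarrow}\mathcal{N}(0,1).$$ (3) If $a_NN^2/(k_N^2m_N)\to1/\alpha\in(0,\infty)$, then $\mathrm{Var}(U_{k_N,m_N})=\{1+o(1)\}(1+1/\alpha)k_N^2\zeta_{1,k_N}/N$. If we further assume the Lindeberg condition stated in the context, $m_N\to\infty$, $\mathrm{E}h^4<\infty$, and $\mathrm{E}(h-\mathrm{E}h)^4/\{\mathrm{E}(h-\mathrm{E}h)^2\}^2=O(1)$, then $$\frac{U_{k_N,m_N}-\mathrm{E}h}{\sqrt{(1+1/\alpha)k_N^2\zeta_{1,k_N}/N}}\stackrel{d}{\longrightarrow}\mathcal{N}(0,1).$$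
   Context: $S_N^{k_N}$ is the set of all $\binom{N}{k_N}$ subsets $s=\{s_1,\dots,s_{k_N}\}$ of $\{1,\dots,N\}$ of size $k_N$. $\mathcal{S}$ consists of $m_N$ subsets drawn independently and identically from $S_N^{k_N}$ with equal probability $1/\binom{N}{k_N}$, independently of the data (draws may overlap or coincide; sums over $\mathcal{S}$ count multiplicity). $\mathrm{E}h^\kappa=\mathrm{E}\,h^\kappa(Z_1,\dots,Z_{k_N})$ for $\kappa\ge1$, and similarly for centred moments. For $1\le c\le k_N$, $$\zeta_{c,k_N}=\mathrm{Cov}\big(h(Z_1,\dots,Z_c,Z_{c+1},\dots,Z_{k_N}),\,h(Z_1,\dots,Z_c,Z'_{c+1},\dots,Z'_{k_N})\big),$$ where $Z'_{c+1},\dots,Z'_{k_N}\stackrel{iid}{\sim}Z$ are independent of $Z_1,Z_2,\dots$. Lindeberg condition: with $h_{1,k_N}(z_1)=\mathrm{E}\{h(z_1,Z_2,\dots,Z_{k_N})\}-\mathrm{E}h$, for all $\epsilon>0$, $$\mathrm{E}\left[\left\{\frac{h_{1,k_N}(Z_1)}{\sqrt{\zeta_{1,k_N}}}\right\}^2 I\left\{\left|\frac{h_{1,k_N}(Z_1)}{\sqrt{\zeta_{1,k_N}}}\right|>\epsilon\sqrt N\right\}\right]\to0,$$ where $I\{\cdot\}$ is the indicator function.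
   Formalization: The kernel h is assumed symmetric. The second variance formula is false as printed (e.g. m_N=1, h=z_1+...+z_k); it is proved if 1/m_N=O(a_N), and in general with an extra factor {1-d_N}, 0≤d_N=O(a_N), on the 1/m_N term. *)

theory Defs
  imports "HOL-Probability.Probability" "HOL-Combinatorics.Permutations"
begin

text \<open>
  Observations are indexed from 0: the sample of size \<open>N\<close> is \<open>Z 0, \<dots>, Z (N - 1)\<close>, and a kernel of
  \<open>k\<close> arguments is a function of a tuple \<open>z\<close> indexed by \<open>{..<k}\<close>, i.e. of an element of the
  product space \<open>Pi\<^sub>M {..<k} (\<lambda>_. D)\<close>; here \<open>D\<close> is the common law of the observations. The product
  measure is the law of \<open>(Z 0, \<dots>, Z (k - 1))\<close>.
\<close>

definition arg_law :: "'z measure \<Rightarrow> nat \<Rightarrow> (nat \<Rightarrow> 'z) measure" where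
  "arg_law D k = Pi\<^sub>M {..<k} (\<lambda>_. D)"

definition symmetric_kernel :: "'z measure \<Rightarrow> nat \<Rightarrow> ((nat \<Rightarrow> 'z) \<Rightarrow> real) \<Rightarrow> bool" where
  "symmetric_kernel D k h \<longleftrightarrow>
     (\<forall>\<pi> z. \<pi> permutes {..<k} \<longrightarrow> z \<in> space (arg_law D k) \<longrightarrow> h (z \<circ> \<pi>) = h z)"

definition kernel_mean :: "'z measure \<Rightarrow> nat \<Rightarrow> ((nat \<Rightarrow> 'z) \<Rightarrow> real) \<Rightarrow> real" where
  "kernel_mean D k h = (\<integral>z. h z \<partial>arg_law D k)"

definition kernel_cmoment :: "'z measure \<Rightarrow> nat \<Rightarrow> ((nat \<Rightarrow> 'z) \<Rightarrow> real) \<Rightarrow> nat \<Rightarrow> real" where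
  "kernel_cmoment D k h p = (\<integral>z. (h z - kernel_mean D k h) ^ p \<partial>arg_law D k)"

definition covariance :: "'w measure \<Rightarrow> ('w \<Rightarrow> real) \<Rightarrow> ('w \<Rightarrow> real) \<Rightarrow> real" where
  "covariance M X Y =
     (\<integral>\<omega>. (X \<omega> - prob_space.expectation M X) * (Y \<omega> - prob_space.expectation M Y) \<partial>M)"

text \<open>
  Under \<open>arg_law D (2 * k)\<close> the coordinates \<open>z i\<close> and \<open>z (k + i)\<close> with \<open>i < k\<close> play the roles of
  \<open>Z i\<close> and of the independent copy \<open>Z' i\<close>.
\<close>

definition zeta :: "'z measure \<Rightarrow> nat \<Rightarrow> ((nat \<Rightarrow> 'z) \<Rightarrow> real) \<Rightarrow> nat \<Rightarrow> real" where
  "zeta D k h c =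
     covariance (arg_law D (2 * k))
       (\<lambda>z. h (\<lambda>i\<in>{..<k}. z i))
       (\<lambda>z. h (\<lambda>i\<in>{..<k}. if i < c then z i else z (k + i)))"

definition first_proj :: "'z measure \<Rightarrow> nat \<Rightarrow> ((nat \<Rightarrow> 'z) \<Rightarrow> real) \<Rightarrow> 'z \<Rightarrow> real" where
  "first_proj D k h x = (\<integral>z. h (z(0 := x)) \<partial>arg_law D k) - kernel_mean D k h"

definition lindeberg :: "'z measure \<Rightarrow> (nat \<Rightarrow> nat) \<Rightarrow> (nat \<Rightarrow> (nat \<Rightarrow> 'z) \<Rightarrow> real) \<Rightarrow> bool" where
  "lindeberg D k h \<longleftrightarrow>
     (\<forall>\<epsilon>>0. (\<lambda>N. \<integral>x. (first_proj D (k N) (h N) x / sqrt (zeta D (k N) (h N) 1))\<^sup>2 *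
                  indicator {y. \<bar>first_proj D (k N) (h N) y / sqrt (zeta D (k N) (h N) 1)\<bar>
                                  > \<epsilon> * sqrt (real N)} x \<partial>D)
            \<longlonglongrightarrow> 0)"

definition k_subsets :: "nat \<Rightarrow> nat \<Rightarrow> nat set set" where
  "k_subsets N k = {s. s \<subseteq> {..<N} \<and> card s = k}"

text \<open>
  The arguments are filled in increasing order of the indices in \<open>s\<close>; for a symmetric kernel the
  choice of the order is irrelevant.
\<close>

definition subtuple :: "nat \<Rightarrow> nat set \<Rightarrow> (nat \<Rightarrow> 'z) \<Rightarrow> nat \<Rightarrow> 'z" where
  "subtuple k s z = (\<lambda>i\<in>{..<k}. z (sorted_list_of_set s ! i))"

text \<open>The draws \<open>S 0, \<dots>, S (m - 1)\<close> are summed with multiplicity.\<close>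

definition incomplete_U ::
  "nat \<Rightarrow> nat \<Rightarrow> ((nat \<Rightarrow> 'z) \<Rightarrow> real) \<Rightarrow> (nat \<Rightarrow> 'w \<Rightarrow> 'z) \<Rightarrow> (nat \<Rightarrow> 'w \<Rightarrow> nat set) \<Rightarrow> 'w \<Rightarrow> real"
where
  "incomplete_U k m h Z S \<omega> = (1 / real m) * (\<Sum>j<m. h (subtuple k (S j \<omega>) (\<lambda>i. Z i \<omega>)))"

end

theory Submission
  imports Defs
begin

text \<open>
  Write \<open>H s\<close> for the kernel evaluated at the observations indexed by \<open>s\<close>; by symmetry
  \<open>E (H s * H t)\<close> depends on the overlap \<open>card (s \<inter> t)\<close> only. The forward differences of this
  function of the overlap are covariances of mixed differences of \<open>H\<close> with disjoint tails, hence
  nonnegative; they are the component variances of the Hoeffding decomposition. Newton's formula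
  then writes the variance of the complete U-statistic and all \<open>zeta\<close> as nonnegative combinations
  of them, which yields every variance estimate, and the bound \<open>k / N * Var\<close> applies
  equally to the kernel \<open>(h - E h)\<^sup>2\<close>.

  For the limit laws split \<open>U - E h\<close> into the Hajek projection, the remainder of the complete
  U-statistic (negligible in mean square since \<open>a\<close> tends to 0), and the resampling error. Given the
  data, the latter is a mean of \<open>m\<close> i.i.d. draws; its conditional characteristic function is compared
  with \<open>(1 - t\<^sup>2 / (2 * m)) ^ m\<close> in mean, where the fourth moment controls the third-order term
  and the concentration of the conditional variance. The projection is treated by Lindeberg's method,
  and the two Gaussian factors multiply because one of them is asymptotically deterministic given the data.
\<close>

text \<open>With v the variance of the complete U-statistic, conditioning on the data gives the
  exact identity Var U = v + (zeta_k - v) / m, so all variance claims are estimates of v. The factor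
  1 - 1/binom(N,k) stands for 1 - v/zeta_k; the two differ by an amount between 0 and k/N. Hence the
  second term of the expansion carries a factor 1 - d with d = O(a). Moving the difference into the
  first term costs a relative error of order 1/m, which is why the literal expansion is stated under
  1/m = O(a). The regimes do not feel this: zeta_k >= k zeta_1 yields k/N <= a and 1/m <= rho a,
  where rho = a N^2 / (k^2 m) is the ratio of zeta_k/m to the projection variance k^2 zeta_1 / N. So
  1/m vanishes when rho is bounded, and v is negligible when rho tends to infinity.

  One limit theorem serves all regimes: at scale B the projection variance tends to p, the
  resampling variance to q = 1 - p and the remainder to 0. The estimates before it are therefore
  nonasymptotic and leave B free.\<close>

lemma integrable_mult_of_squares:
  fixes f g :: "'a \<Rightarrow> real"
  assumes [measurable]: "f \<in> borel_measurable M" "g \<in> borel_measurable M"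
    and "integrable M (\<lambda>x. (f x)\<^sup>2)" "integrable M (\<lambda>x. (g x)\<^sup>2)"
  shows "integrable M (\<lambda>x. f x * g x)"
proof (rule Bochner_Integration.integrable_bound[where f="\<lambda>x. (f x)\<^sup>2 + (g x)\<^sup>2"])
  have "\<bar>a * b\<bar> \<le> \<bar>a\<^sup>2 + b\<^sup>2\<bar>" for a b :: real
  proof -
    have "0 \<le> (\<bar>a\<bar> - \<bar>b\<bar>)\<^sup>2" by simp
    then have "2 * \<bar>a * b\<bar> \<le> a\<^sup>2 + b\<^sup>2" by (simp add: power2_diff abs_mult)
    then show ?thesis by simp
  qed
  then show "AE x in M. norm (f x * g x) \<le> norm ((f x)\<^sup>2 + (g x)\<^sup>2)" by simp
qed (use assms in auto)

lemma integrable_square_diff: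
  fixes f g :: "'a \<Rightarrow> real"
  assumes "f \<in> borel_measurable M" "g \<in> borel_measurable M"
    and "integrable M (\<lambda>x. (f x)\<^sup>2)" "integrable M (\<lambda>x. (g x)\<^sup>2)"
  shows "integrable M (\<lambda>x. (f x - g x)\<^sup>2)"
  using integrable_mult_of_squares[OF assms] assms(3,4) by (simp add: power2_diff mult.assoc)

lemma integrable_square_add:
  fixes f g :: "'a \<Rightarrow> real"
  assumes "f \<in> borel_measurable M" "g \<in> borel_measurable M"
    and "integrable M (\<lambda>x. (f x)\<^sup>2)" "integrable M (\<lambda>x. (g x)\<^sup>2)"
  shows "integrable M (\<lambda>x. (f x + g x)\<^sup>2)"
  using integrable_mult_of_squares[OF assms] assms(3,4) by (simp add: power2_sum mult.assoc)

lemma integrable_square_sum: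
  fixes f :: "'i \<Rightarrow> 'a \<Rightarrow> real"
  assumes "\<And>i. i \<in> I \<Longrightarrow> f i \<in> borel_measurable M"
    and "\<And>i. i \<in> I \<Longrightarrow> integrable M (\<lambda>x. (f i x)\<^sup>2)"
  shows "integrable M (\<lambda>x. (\<Sum>i\<in>I. f i x)\<^sup>2)"
  using assms
  by (induction I rule: infinite_finite_induct) (auto intro!: integrable_square_add)

subsection \<open>Forward differences\<close>

primrec fdiff :: "(nat \<Rightarrow> real) \<Rightarrow> nat \<Rightarrow> nat \<Rightarrow> real" where
  "fdiff e 0 i = e i"
| "fdiff e (Suc j) i = fdiff e j (Suc i) - fdiff e j i"

text \<open>The hypothesis for c at base point i + 1, with each \<open>fdiff e j (Suc i)\<close>
  split by the recursion, gives two sums whose coefficients Pascal's rule merges.\<close>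

lemma newton_forward: "e (c + i) = (\<Sum>j\<le>c. real (c choose j) * fdiff e j i)"
proof (induction c arbitrary: i)
  case (Suc c)
  have "e (Suc c + i) = (\<Sum>j\<le>c. real (c choose j) * fdiff e j i)
      + (\<Sum>j\<le>c. real (c choose j) * fdiff e (Suc j) i)"
    using Suc.IH[of "Suc i"] by (simp add: sum.distrib[symmetric] algebra_simps)
  \<comment> \<open>The added term j = c + 1 has coefficient \<open>c choose Suc c\<close>, which is
    0.\<close>
  also have "(\<Sum>j\<le>c. real (c choose j) * fdiff e j i)
      = (\<Sum>j\<le>Suc c. real (c choose j) * fdiff e j i)" by simp
  also have "\<dots> = fdiff e 0 i + (\<Sum>j\<le>c. real (c choose Suc j) * fdiff e (Suc j) i)"
    by (subst sum.atMost_Suc_shift) simp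
  finally have "e (Suc c + i) = fdiff e 0 i
      + (\<Sum>j\<le>c. real (Suc c choose Suc j) * fdiff e (Suc j) i)"
    by (simp add: sum.distrib algebra_simps del: fdiff.simps)
  then show ?case by (subst sum.atMost_Suc_shift) simp
qed simp

text \<open>A common upper limit for all overlaps lets sums over pairs of subsets be exchanged with
  the sum over j.\<close>

lemma newton_forward_0:
  assumes "c \<le> n"
  shows "e c = (\<Sum>j\<le>n. real (c choose j) * fdiff e j 0)"
proof -
  have "e c = (\<Sum>j\<le>c. real (c choose j) * fdiff e j 0)"
    using newton_forward[of e c 0] by simp
  also have "\<dots> = (\<Sum>j\<le>n. real (c choose j) * fdiff e j 0)"
    using assms by (intro sum.mono_neutral_left) auto
  finally show ?thesis .
qed

subsection \<open>Overlap functions are absolutely monotone\<close>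

text \<open>Expanded, this is the signed sum of \<open>X\<close> at T \<union> R over the 2^c sets R
  containing exactly one of 2 i and 2 i + 1 for each i < c, with a minus for each odd choice. It
  plays the role of a Hoeffding component without any conditional expectation.\<close>

primrec mixed_diff :: "(nat set \<Rightarrow> 'a \<Rightarrow> real) \<Rightarrow> nat \<Rightarrow> nat set \<Rightarrow> 'a \<Rightarrow> real" where
  "mixed_diff X 0 T x = X T x"
| "mixed_diff X (Suc c) T x = mixed_diff X c (insert (2 * c) T) x - mixed_diff X c (insert (2 * c + 1) T) x"

locale overlap_family =
  fixes M :: "'a measure" and X :: "nat set \<Rightarrow> 'a \<Rightarrow> real" and k :: nat and e :: "nat \<Rightarrow> real"
  assumes X_meas: "finite s \<Longrightarrow> card s = k \<Longrightarrow> X s \<in> borel_measurable M"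
    and X_sq: "finite s \<Longrightarrow> card s = k \<Longrightarrow> integrable M (\<lambda>x. (X s x)\<^sup>2)"
    and X_prod: "finite s \<Longrightarrow> card s = k \<Longrightarrow> finite t \<Longrightarrow> card t = k \<Longrightarrow>
      (\<integral>x. X s x * X t x \<partial>M) = e (card (s \<inter> t))"
begin

lemma mixed_diff_L2:
  assumes "c \<le> k" "finite T" "T \<inter> {..<2 * c} = {}" "card T = k - c"
  shows "mixed_diff X c T \<in> borel_measurable M \<and> integrable M (\<lambda>x. (mixed_diff X c T x)\<^sup>2)"
  using assms
proof (induction c arbitrary: T)
  case 0
  then show ?case using X_meas X_sq by auto
next
  case (Suc c)
  have "2 * c \<notin> T" "2 * c + 1 \<notin> T" using Suc.prems by auto
  then have "mixed_diff X c (insert a T) \<in> borel_measurable M \<and>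
      integrable M (\<lambda>x. (mixed_diff X c (insert a T) x)\<^sup>2)" if "a = 2 * c \<or> a = 2 * c + 1" for a
    using that Suc.prems by (intro Suc.IH) auto
  from this[of "2 * c"] this[of "2 * c + 1"] show ?case
    by (auto intro!: integrable_square_diff)
qed

text \<open>Two choices from the pair 2 c, 2 c + 1 agree in two of four cases, which raises the
  overlap by one and carries the sign plus; in the other two the overlap stays and the sign is
  minus. Each pair thus contributes one forward difference and a factor 2.\<close>

lemma mixed_diff_prod:
  assumes "c \<le> k" "finite T" "T \<inter> {..<2 * c} = {}" "card T = k - c"
    and "finite T'" "T' \<inter> {..<2 * c} = {}" "card T' = k - c"
  shows "(\<integral>x. mixed_diff X c T x * mixed_diff X c T' x \<partial>M) = 2 ^ c * fdiff e c (card (T \<inter> T'))"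
  using assms
proof (induction c arbitrary: T T')
  case 0
  then show ?case using X_prod by simp
next
  case (Suc c)
  let ?a = "2 * c" and ?b = "2 * c + 1"
  let ?G = "mixed_diff X c"
  have nin: "?a \<notin> T" "?b \<notin> T" "?a \<notin> T'" "?b \<notin> T'" using Suc.prems by auto
  have L2: "?G (insert i R) \<in> borel_measurable M" "integrable M (\<lambda>x. (?G (insert i R) x)\<^sup>2)"
    if "i = ?a \<or> i = ?b" "R = T \<or> R = T'" for i R
  proof -
    have "?G (insert i R) \<in> borel_measurable M \<and> integrable M (\<lambda>x. (?G (insert i R) x)\<^sup>2)"
      using that Suc.prems nin by (intro mixed_diff_L2) auto
    then show "?G (insert i R) \<in> borel_measurable M" "integrable M (\<lambda>x. (?G (insert i R) x)\<^sup>2)"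
      by auto
  qed
  have int: "integrable M (\<lambda>x. ?G (insert i T) x * ?G (insert j T') x)"
    if "i = ?a \<or> i = ?b" "j = ?a \<or> j = ?b" for i j
    using that by (intro integrable_mult_of_squares L2) auto
  have val: "(\<integral>x. ?G (insert i T) x * ?G (insert j T') x \<partial>M) =
     2 ^ c * fdiff e c (if i = j then Suc (card (T \<inter> T')) else card (T \<inter> T'))"
    if "i = ?a \<or> i = ?b" "j = ?a \<or> j = ?b" for i j
  proof -
    have "card (insert i T \<inter> insert j T') =
        (if i = j then Suc (card (T \<inter> T')) else card (T \<inter> T'))"
      using that nin Suc.prems by (auto simp: Int_insert_left Int_insert_right)
    moreover have "(\<integral>x. ?G (insert i T) x * ?G (insert j T') x \<partial>M) =
        2 ^ c * fdiff e c (card (insert i T \<inter> insert j T'))"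
      using that Suc.prems nin by (intro Suc.IH) auto
    ultimately show ?thesis by simp
  qed
  have "(\<integral>x. mixed_diff X (Suc c) T x * mixed_diff X (Suc c) T' x \<partial>M) =
    (\<integral>x. (?G (insert ?a T) x * ?G (insert ?a T') x - ?G (insert ?a T) x * ?G (insert ?b T') x)
       - (?G (insert ?b T) x * ?G (insert ?a T') x - ?G (insert ?b T) x * ?G (insert ?b T') x) \<partial>M)"
    by (intro Bochner_Integration.integral_cong) (auto simp: algebra_simps)
  also have "\<dots> = ((\<integral>x. ?G (insert ?a T) x * ?G (insert ?a T') x \<partial>M)
        - (\<integral>x. ?G (insert ?a T) x * ?G (insert ?b T') x \<partial>M))
      - ((\<integral>x. ?G (insert ?b T) x * ?G (insert ?a T') x \<partial>M)
        - (\<integral>x. ?G (insert ?b T) x * ?G (insert ?b T') x \<partial>M))"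
    by (simp only: Bochner_Integration.integral_diff Bochner_Integration.integrable_diff int
        disj_commute refl simp_thms)
  also have "\<dots> = 2 ^ Suc c * fdiff e (Suc c) (card (T \<inter> T'))"
    by (subst (1 2 3 4) val) (auto simp: algebra_simps)
  finally show ?case .
qed

text \<open>
  Mixed differences with pairwise disjoint tails are exchangeable, so their common covariance
  cannot be negative: otherwise the second moment of a long sum would be.
\<close>

lemma fdiff_nonneg:
  assumes c: "c \<le> k"
  shows "0 \<le> fdiff e c 0"
proof (rule ccontr)
  assume neg: "\<not> 0 \<le> fdiff e c 0"
  \<comment> \<open>Consecutive blocks of length k - c, beyond the indices below 2 c that the pairs
    occupy. For c = k all blocks are empty, and the two values distinguished below coincide.\<close>
  define T where "T l = {2 * c + l * (k - c)..<2 * c + Suc l * (k - c)}" for l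
  have T: "finite (T l)" "T l \<inter> {..<2 * c} = {}" "card (T l) = k - c" for l
    by (auto simp: T_def)
  have T_disj: "T l \<inter> T l' = {}" if "l \<noteq> l'" for l l'
  proof -
    have "T l \<inter> T l' = {}" if "l < l'" for l l'
    proof -
      have "Suc l * (k - c) \<le> l' * (k - c)" using that by (intro mult_le_mono1) simp
      then show ?thesis by (auto simp: T_def)
    qed
    then show ?thesis using that by (metis Int_commute linorder_neqE_nat)
  qed
  let ?G = "\<lambda>l. mixed_diff X c (T l)"
  have L2: "?G l \<in> borel_measurable M" "integrable M (\<lambda>x. (?G l x)\<^sup>2)" for l
    using mixed_diff_L2[OF c T] by auto
  let ?d = "fdiff e c (k - c)"
  \<comment> \<open>A sum of n + 1 mixed differences has n + 1 diagonal terms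
    \<open>2 ^ c * ?d\<close> and n (n + 1) off-diagonal terms \<open>2 ^ c * fdiff e c 0\<close>.
    Dividing its second moment by 2^c (n + 1) leaves an expression linear in n.\<close>
  have bound: "0 \<le> ?d + real n * fdiff e c 0" for n
  proof -
    have "0 \<le> (\<integral>x. (\<Sum>l<Suc n. ?G l x)\<^sup>2 \<partial>M)" by simp
    also have "\<dots> = (\<integral>x. (\<Sum>l<Suc n. \<Sum>l'<Suc n. ?G l x * ?G l' x) \<partial>M)"
      by (simp only: power2_eq_square sum_product)
    also have "\<dots> = (\<Sum>l<Suc n. \<Sum>l'<Suc n. (\<integral>x. ?G l x * ?G l' x \<partial>M))"
      by (subst Bochner_Integration.integral_sum, fastforce intro: integrable_mult_of_squares L2)+ simp
    also have "\<dots> = (\<Sum>l<Suc n. \<Sum>l'<Suc n. 2 ^ c * (if l = l' then ?d else fdiff e c 0))"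
    proof (intro sum.cong refl)
      fix l l'
      show "(\<integral>x. ?G l x * ?G l' x \<partial>M) = 2 ^ c * (if l = l' then ?d else fdiff e c 0)"
        using mixed_diff_prod[OF c T[of l] T[of l']] T_disj[of l l'] T(3) by auto
    qed
    also have "\<dots> = (\<Sum>l<Suc n. \<Sum>l'<Suc n. 2 ^ c * fdiff e c 0 +
        (if l = l' then 2 ^ c * (?d - fdiff e c 0) else 0))"
      by (intro sum.cong refl) (auto simp: algebra_simps)
    also have "\<dots> = 2 ^ c * (real (Suc n) * (?d + real n * fdiff e c 0))"
      by (simp add: sum.distrib algebra_simps del: sum.lessThan_Suc)
    finally have "0 \<le> 2 ^ c * (real (Suc n) * (?d + real n * fdiff e c 0))" .
    then show ?thesis by (metis mult_le_cancel_left_pos mult_zero_right of_nat_0_less_iff zero_less_Suc zero_less_numeral zero_less_power)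
  qed
  obtain n where "?d / (- fdiff e c 0) < real n" using reals_Archimedean2 by blast
  then have "?d < real n * (- fdiff e c 0)" using neg by (simp add: field_simps)
  then show False using bound[of n] by simp
qed

end

subsection \<open>Averages of overlap functions\<close>

lemma finite_k_subsets [simp]: "finite (k_subsets N k)"
  unfolding k_subsets_def by (rule finite_subset[of _ "Pow {..<N}"]) auto

lemma card_k_subsets: "card (k_subsets N k) = N choose k"
  unfolding k_subsets_def using n_subsets[of "{..<N}" k] by simp

lemma k_subsetsD:
  assumes "s \<in> k_subsets N k"
  shows "finite s" "card s = k" "s \<subseteq> {..<N}"
  using assms by (auto simp: k_subsets_def intro: finite_subset)

lemma k_subsets_ne: "k \<le> N \<Longrightarrow> k_subsets N k \<noteq> {}"
  by (auto simp: k_subsets_def intro!: exI[of _ "{..<k}"])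

lemma card_k_supersets:
  assumes A: "A \<in> k_subsets N j" and "j \<le> k"
  shows "card {s \<in> k_subsets N k. A \<subseteq> s} = (N - j) choose (k - j)"
proof -
  note A' = k_subsetsD[OF A]
  have "bij_betw (\<lambda>s. s - A) {s \<in> k_subsets N k. A \<subseteq> s} {B. B \<subseteq> {..<N} - A \<and> card B = k - j}"
  proof (rule bij_betwI[where g = "\<lambda>B. B \<union> A"])
    show "(\<lambda>s. s - A) \<in> {s \<in> k_subsets N k. A \<subseteq> s} \<rightarrow> {B. B \<subseteq> {..<N} - A \<and> card B = k - j}"
      using A' by (auto simp: k_subsets_def card_Diff_subset)
    show "(\<lambda>B. B \<union> A) \<in> {B. B \<subseteq> {..<N} - A \<and> card B = k - j} \<rightarrow> {s \<in> k_subsets N k. A \<subseteq> s}"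
    proof
      fix B assume "B \<in> {B. B \<subseteq> {..<N} - A \<and> card B = k - j}"
      then have B: "B \<subseteq> {..<N} - A" "card B = k - j" by auto
      then have "finite B" by (auto intro: finite_subset)
      then have "card (B \<union> A) = card B + card A" using B A' by (intro card_Un_disjoint) auto
      then show "B \<union> A \<in> {s \<in> k_subsets N k. A \<subseteq> s}"
        using B A' assms by (auto simp: k_subsets_def)
    qed
  qed auto
  then have "card {s \<in> k_subsets N k. A \<subseteq> s} = card {B. B \<subseteq> {..<N} - A \<and> card B = k - j}"
    by (rule bij_betw_same_card)
  also have "\<dots> = (N - j) choose (k - j)"
    using A' by (subst n_subsets) (auto simp: card_Diff_subset)
  finally show ?thesis .
qed

text \<open>Counting the j-subsets of s \<inter> t by indicators makes the summand a product of a
  factor in s and a factor in t, so that double sums over s and t become squares.\<close>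

lemma choose_inter_eq_sum:
  assumes "s \<subseteq> {..<N}"
  shows "real (card (s \<inter> t) choose j) = (\<Sum>A\<in>k_subsets N j. of_bool (A \<subseteq> s) * of_bool (A \<subseteq> t))"
proof -
  have "finite (s \<inter> t)" using assms finite_subset by blast
  then have "card (s \<inter> t) choose j = card {A. A \<subseteq> s \<inter> t \<and> card A = j}"
    using n_subsets[of "s \<inter> t" j] by simp
  also have "{A. A \<subseteq> s \<inter> t \<and> card A = j} = {A \<in> k_subsets N j. A \<subseteq> s \<and> A \<subseteq> t}"
    using assms by (auto simp: k_subsets_def)
  finally have "real (card (s \<inter> t) choose j) = (\<Sum>A\<in>k_subsets N j. of_bool (A \<subseteq> s \<and> A \<subseteq> t))"
    by (simp add: sum.If_cases of_bool_def Int_def)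
  then show ?thesis by (simp only: of_bool_conj)
qed

text \<open>If \<open>e\<close> gives the mixed second moments of kernel evaluations, this is the
  second moment of the complete U-statistic.\<close>

definition overlap_avg :: "nat \<Rightarrow> nat \<Rightarrow> (nat \<Rightarrow> real) \<Rightarrow> real" where
  "overlap_avg N k e =
     (\<Sum>s\<in>k_subsets N k. \<Sum>t\<in>k_subsets N k. e (card (s \<inter> t))) / (real (N choose k))\<^sup>2"

text \<open>The term \<open>fdiff e j 0 * real (k choose j)\<close> is what order j contributes to
  \<open>e k\<close>, the second moment of a single evaluation; averaging over all subsets damps it
  by \<open>(k choose j) / (N choose j)\<close>. After Newton's formula the double sum is counted
  through the j-sets A, each contained in \<open>(N - j) choose (k - j)\<close> of the
  subsets.\<close>

lemma overlap_avg_eq: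
  assumes "k \<le> N"
  shows "overlap_avg N k e =
    (\<Sum>j\<le>k. fdiff e j 0 * real (k choose j) * (real (k choose j) / real (N choose j)))"
proof -
  let ?K = "k_subsets N k"
  have "(\<Sum>s\<in>?K. \<Sum>t\<in>?K. e (card (s \<inter> t))) =
      (\<Sum>s\<in>?K. \<Sum>t\<in>?K. \<Sum>j\<le>k. real (card (s \<inter> t) choose j) * fdiff e j 0)"
  proof (intro sum.cong refl newton_forward_0)
    fix s t assume "s \<in> ?K"
    then show "card (s \<inter> t) \<le> k" using k_subsetsD[of s N k] by (metis card_mono inf_le1)
  qed
  also have "\<dots> = (\<Sum>j\<le>k. \<Sum>s\<in>?K. \<Sum>t\<in>?K. real (card (s \<inter> t) choose j) * fdiff e j 0)"
    by (subst (2) sum.swap, subst sum.swap, rule refl)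
  also have "\<dots> = (\<Sum>j\<le>k. fdiff e j 0 * (\<Sum>s\<in>?K. \<Sum>t\<in>?K. real (card (s \<inter> t) choose j)))"
    by (simp add: sum_distrib_left mult_ac)
  also have "\<dots> = (\<Sum>j\<le>k. fdiff e j 0 * (real (N choose j) * (real ((N - j) choose (k - j)))\<^sup>2))"
  proof (intro sum.cong refl arg_cong2[where f="(*)"])
    fix j assume j: "j \<in> {..k}"
    have "(\<Sum>s\<in>?K. \<Sum>t\<in>?K. real (card (s \<inter> t) choose j)) =
       (\<Sum>s\<in>?K. \<Sum>t\<in>?K. \<Sum>A\<in>k_subsets N j. of_bool (A \<subseteq> s) * of_bool (A \<subseteq> t))"
      by (intro sum.cong refl choose_inter_eq_sum k_subsetsD)
    also have "\<dots> = (\<Sum>A\<in>k_subsets N j. \<Sum>s\<in>?K. \<Sum>t\<in>?K. of_bool (A \<subseteq> s) * of_bool (A \<subseteq> t))"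
      by (subst (2) sum.swap, subst sum.swap, rule refl)
    also have "\<dots> = (\<Sum>A\<in>k_subsets N j. (\<Sum>s\<in>?K. of_bool (A \<subseteq> s))\<^sup>2)"
      by (simp only: power2_eq_square sum_product)
    also have "\<dots> = (\<Sum>A\<in>k_subsets N j. (real ((N - j) choose (k - j)))\<^sup>2)"
    proof (intro sum.cong refl arg_cong[where f="\<lambda>x. x\<^sup>2"])
      fix A assume "A \<in> k_subsets N j"
      then show "(\<Sum>s\<in>?K. of_bool (A \<subseteq> s)) = real ((N - j) choose (k - j))"
        using card_k_supersets[of A N j k] j by (simp add: of_bool_def sum.If_cases Int_def)
    qed
    also have "\<dots> = real (N choose j) * (real ((N - j) choose (k - j)))\<^sup>2"
      by (simp add: card_k_subsets)
    finally show "(\<Sum>s\<in>?K. \<Sum>t\<in>?K. real (card (s \<inter> t) choose j)) =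
      real (N choose j) * (real ((N - j) choose (k - j)))\<^sup>2" .
  qed
  finally have "overlap_avg N k e = (\<Sum>j\<le>k. fdiff e j 0 *
     (real (N choose j) * (real ((N - j) choose (k - j)))\<^sup>2 / (real (N choose k))\<^sup>2))"
    unfolding overlap_avg_def by (simp add: sum_divide_distrib)
  also have "\<dots> = (\<Sum>j\<le>k. fdiff e j 0 * real (k choose j) * (real (k choose j) / real (N choose j)))"
  proof (intro sum.cong refl)
    fix j assume j: "j \<in> {..k}"
    have "(N choose k) * (k choose j) = (N choose j) * ((N - j) choose (k - j))"
      using j assms by (intro choose_mult) auto
    then have "real (N choose k) * real (k choose j) = real (N choose j) * real ((N - j) choose (k - j))"
      by (metis of_nat_mult)
    moreover have "real (N choose k) > 0" "real (N choose j) > 0" using j assms by auto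
    ultimately have *: "real ((N - j) choose (k - j)) = real (N choose k) * real (k choose j) / real (N choose j)"
      by (simp add: field_simps)
    have "x * (y * z / x)\<^sup>2 / y\<^sup>2 = z * (z / x)" if "x > 0" "y > 0" for x y z :: real
      using that by (simp add: field_simps power2_eq_square)
    then show "fdiff e j 0 * (real (N choose j) * (real ((N - j) choose (k - j)))\<^sup>2 / (real (N choose k))\<^sup>2)
      = fdiff e j 0 * real (k choose j) * (real (k choose j) / real (N choose j))"
      using \<open>real (N choose k) > 0\<close> \<open>real (N choose j) > 0\<close> unfolding * by (simp only: mult.assoc)
  qed
  finally show ?thesis .
qed

text \<open>The ratio is the product of (k - i) / (N - i) over i < j, and each factor is at most k /
  N because k <= N.\<close>

lemma choose_ratio_le_power:
  assumes "k \<le> N" "0 < N" "j \<le> k"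
  shows "real (k choose j) / real (N choose j) \<le> (real k / real N) ^ j"
  using assms(3)
proof (induction j)
  case (Suc j)
  have step: "real (n choose Suc j) = real (n choose j) * (real (n - j) / real (Suc j))" for n
  proof -
    have "Suc j * (n choose Suc j) = (n - j) * (n choose j)"
      by (metis binomial_absorb_comp binomial_absorption diff_Suc_1 mult.commute)
    then have "real (Suc j) * real (n choose Suc j) = real (n - j) * real (n choose j)"
      by (metis of_nat_mult)
    then show ?thesis by (simp add: field_simps del: of_nat_Suc)
  qed
  have jN: "j < N" "j < k" using Suc.prems assms by auto
  have "real (k - j) / real (N - j) \<le> real k / real N"
  proof -
    have "real (k - j) * real N \<le> real k * real (N - j)"
    proof -
      have "real j * real k \<le> real j * real N" using assms by (intro mult_left_mono) auto
      then show ?thesis using jN by (simp add: of_nat_diff algebra_simps)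
    qed
    then show ?thesis using jN by (simp add: field_simps)
  qed
  then have "real (k choose j) / real (N choose j) * (real (k - j) / real (N - j)) \<le>
     (real k / real N) ^ j * (real k / real N)"
    using Suc by (intro mult_mono) auto
  moreover have "real (k choose Suc j) / real (N choose Suc j) =
      real (k choose j) / real (N choose j) * (real (k - j) / real (N - j))"
    by (simp add: step del: binomial_Suc_Suc)
  ultimately show ?case by (simp add: mult.commute)
qed simp

text \<open>Let b j be the share of order j in \<open>e k\<close> and w j its damping. Then
  \<open>zk\<close> is the sum of b j over j >= 1, k times \<open>z1\<close> is b 1, and
  \<open>v\<close> is the sum of b j w j. Everything follows from w 1 = k / N, w j <= (k / N)^j and
  w j >= 1 / (N choose k).\<close>

lemma overlap_avg_bounds:
  assumes nn: "\<And>j. j \<le> k \<Longrightarrow> 0 \<le> fdiff e j 0" and k: "0 < k" "k \<le> N"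
  defines "v \<equiv> overlap_avg N k e - e 0" and "z1 \<equiv> e 1 - e 0" and "zk \<equiv> e k - e 0"
  shows "0 \<le> z1" "real k * z1 \<le> zk" "(real k)\<^sup>2 / real N * z1 \<le> v" "v \<le> real k / real N * zk"
    "v \<le> (real k)\<^sup>2 / real N * z1 + (real k / real N)\<^sup>2 * zk" "zk / real (N choose k) \<le> v"
proof -
  define w where "w j = real (k choose j) / real (N choose j)" for j
  define b where "b j = fdiff e j 0 * real (k choose j)" for j
  have b: "0 \<le> b j" if "j \<le> k" for j using nn[OF that] by (simp add: b_def)
  have w: "0 \<le> w j" for j by (simp add: w_def)
  have split: "(\<Sum>j\<le>k. g j) = g 0 + (\<Sum>j\<in>{1..k}. g j)" for g :: "nat \<Rightarrow> real"
    by (simp add: atMost_atLeast0 sum.atLeast_Suc_atMost)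
  have v: "v = (\<Sum>j\<in>{1..k}. b j * w j)"
    using overlap_avg_eq[OF k(2), of e] unfolding split by (simp add: v_def b_def w_def)
  have zk: "zk = (\<Sum>j\<in>{1..k}. b j)"
    using newton_forward_0[of k k e] unfolding split by (simp add: zk_def b_def mult.commute)
  have split1: "(\<Sum>j\<in>{1..k}. g j) = g 1 + (\<Sum>j\<in>{2..k}. g j)" for g :: "nat \<Rightarrow> real"
    using k by (simp add: sum.atLeast_Suc_atMost numeral_2_eq_2)
  have b1: "b 1 = real k * z1" and w1: "w 1 = real k / real N"
    by (simp_all add: b_def w_def z1_def)
  have bw1: "b 1 * w 1 = (real k)\<^sup>2 / real N * z1"
    unfolding b1 w1 by (simp add: power2_eq_square)
  show "0 \<le> z1" using nn[of 1] k by (simp add: z1_def)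
  have kN: "real k / real N \<le> 1" "0 \<le> real k / real N" using k by auto
  have wj: "w j \<le> (real k / real N) ^ j" if "j \<le> k" for j
    using choose_ratio_le_power[OF k(2) _ that] k by (auto simp: w_def)
  show "real k * z1 \<le> zk" unfolding zk split1 b1 by (auto intro!: sum_nonneg b)
  show "(real k)\<^sup>2 / real N * z1 \<le> v" unfolding v split1 bw1
    by (auto intro!: sum_nonneg mult_nonneg_nonneg b w)
  show "v \<le> real k / real N * zk" unfolding v zk sum_distrib_left
  proof (intro sum_mono)
    fix j assume j: "j \<in> {1..k}"
    have "w j \<le> (real k / real N) ^ j" using wj j by auto
    also have "\<dots> \<le> (real k / real N) ^ 1" using j kN by (intro power_decreasing) auto
    finally show "b j * w j \<le> real k / real N * b j"
      using mult_right_mono[of "w j" "real k / real N" "b j"] b[of j] j by (simp add: mult.commute)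
  qed
  have "(\<Sum>j\<in>{2..k}. b j * w j) \<le> (\<Sum>j\<in>{2..k}. (real k / real N)\<^sup>2 * b j)"
  proof (intro sum_mono)
    fix j assume j: "j \<in> {2..k}"
    have "w j \<le> (real k / real N) ^ j" using wj j by auto
    also have "\<dots> \<le> (real k / real N) ^ 2" using j kN by (intro power_decreasing) auto
    finally show "b j * w j \<le> (real k / real N)\<^sup>2 * b j"
      using b[of j] j by (simp add: mult.commute mult_left_mono)
  qed
  also have "\<dots> = (real k / real N)\<^sup>2 * (\<Sum>j\<in>{2..k}. b j)" by (simp add: sum_distrib_left)
  also have "\<dots> \<le> (real k / real N)\<^sup>2 * zk"
    unfolding zk split1 using b[of 1] k by (intro mult_left_mono) auto
  finally show "v \<le> (real k)\<^sup>2 / real N * z1 + (real k / real N)\<^sup>2 * zk"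
    unfolding v split1 bw1 by simp
  show "zk / real (N choose k) \<le> v" unfolding v zk sum_divide_distrib
  proof (intro sum_mono)
    fix j assume j: "j \<in> {1..k}"
    \<comment> \<open>Both sides count pairs of a k-set and a j-subset of it. Every j-set occurs in
      such a pair, which gives the lower bound for w j.\<close>
    have "(N choose k) * (k choose j) = (N choose j) * ((N - j) choose (k - j))"
      using j k by (intro choose_mult) auto
    moreover have "1 \<le> (N - j) choose (k - j)" using j k by (simp add: Suc_leI)
    ultimately have "N choose j \<le> (N choose k) * (k choose j)" by simp
    then have "real (N choose j) \<le> real (N choose k) * real (k choose j)"
      by (metis of_nat_le_iff of_nat_mult)
    moreover have "real (N choose k) > 0" "real (N choose j) > 0" using j k by auto
    ultimately have "1 / real (N choose k) \<le> w j" by (simp add: w_def field_simps)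
    then have "b j * (1 / real (N choose k)) \<le> b j * w j" using b[of j] j by (intro mult_left_mono) auto
    then show "b j / real (N choose k) \<le> b j * w j" by simp
  qed
qed

section \<open>Relabelling of index sets and moments of kernel evaluations\<close>

text \<open>An injection of all indices, not only of s \<union> t, is what
  \<open>distr_reindex\<close> asks for. It matches s \<inter> t, s - t and t - s with their
  counterparts and shifts every other index beyond them.\<close>

lemma exists_inj_extending:
  fixes s t s' t' :: "nat set"
  assumes fin: "finite s" "finite t" "finite s'" "finite t'"
    and card: "card s = card s'" "card t = card t'" "card (s \<inter> t) = card (s' \<inter> t')"
  shows "\<exists>f. inj f \<and> f ` s = s' \<and> f ` t = t'"
proof -
  have "card (s - t) = card (s' - t')" "card (t - s) = card (t' - s')"
    using fin card by (simp_all add: card_Diff_subset_Int Int_commute)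
  then obtain g1 g2 g3 where g: "bij_betw g1 (s \<inter> t) (s' \<inter> t')" "bij_betw g2 (s - t) (s' - t')"
      "bij_betw g3 (t - s) (t' - s')"
    using fin card by (meson finite_Diff finite_Int finite_same_card_bij)
  \<comment> \<open>Larger than every element of s' \<union> t'; \<open>insert 0\<close> keeps
    \<open>Max\<close> meaningful when both sets are empty.\<close>
  define n where "n = Suc (Max (insert 0 (s' \<union> t')))"
  have n: "x < n" if "x \<in> s' \<union> t'" for x
    using that fin by (auto simp: n_def less_Suc_eq_le intro!: Max_ge)
  define f where "f x = (if x \<in> s \<inter> t then g1 x else if x \<in> s - t then g2 x
    else if x \<in> t - s then g3 x else x + n)" for x
  have img: "f ` (s \<inter> t) = s' \<inter> t'" "f ` (s - t) = s' - t'" "f ` (t - s) = t' - s'"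
    using g by (auto simp: bij_betw_def f_def)
  have out: "f x \<ge> n" if "x \<notin> s \<union> t" for x using that by (auto simp: f_def)
  have inj_pieces: "inj_on f (s \<inter> t)" "inj_on f (s - t)" "inj_on f (t - s)" "inj_on f (- (s \<union> t))"
    using g by (auto simp: bij_betw_def f_def inj_on_def)
  have s: "f ` s = s'" using img(1,2) by (metis Int_Diff_Un image_Un)
  have ts: "t = (s \<inter> t) \<union> (t - s)" "t' = (s' \<inter> t') \<union> (t' - s')" by auto
  have t: "f ` t = t'" by (subst ts(1), subst ts(2)) (simp only: image_Un img)
  have "inj_on f ((s \<inter> t) \<union> (s - t))"
  proof -
    have "s \<inter> t - (s - t) = s \<inter> t" "s - t - (s \<inter> t) = s - t" by auto
    then show ?thesis using inj_pieces(1,2) img(1,2) unfolding inj_on_Un by auto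
  qed
  then have inj_s: "inj_on f s" by (simp add: Int_Diff_Un)
  have "inj_on f (s \<union> (t - s))"
  proof -
    have "s - (t - s) = s" "t - s - s = t - s" by auto
    then show ?thesis using inj_s inj_pieces(3) s img(3) unfolding inj_on_Un by auto
  qed
  then have inj_st: "inj_on f (s \<union> t)" by simp
  have "f x \<noteq> f y" if "x \<in> s \<union> t" "y \<notin> s \<union> t" for x y
  proof -
    have "f x \<in> s' \<union> t'" using that(1) s t by blast
    then show ?thesis using n[of "f x"] out[OF that(2)] by auto
  qed
  then have "inj_on f ((s \<union> t) \<union> - (s \<union> t))"
    using inj_st inj_pieces(4) unfolding inj_on_Un by auto
  then have "inj f" by (simp only: Compl_partition)
  with s t show ?thesis by blast
qed

lemma bij_betw_sorted_nth:
  assumes "finite s" "card s = k"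
  shows "bij_betw ((!) (sorted_list_of_set s)) {..<k} s"
  using assms by (intro bij_betw_nth) auto

locale kernel =
  fixes D :: "'z measure" and k :: nat and h :: "(nat \<Rightarrow> 'z) \<Rightarrow> real"
  assumes D: "prob_space D" and k_pos: "0 < k"
    and h_meas [measurable]: "h \<in> borel_measurable (arg_law D k)"
    and h_sym: "symmetric_kernel D k h"
    and h_sq: "integrable (arg_law D k) (\<lambda>z. (h z)\<^sup>2)"
begin

text \<open>Infinitely many coordinates although a sample uses only N: \<open>fdiff_nonneg\<close>
  needs arbitrarily many disjoint tails, and relabelling moves indices outside the sample.\<close>

definition MZ :: "(nat \<Rightarrow> 'z) measure" where "MZ = Pi\<^sub>M UNIV (\<lambda>_. D)"
definition H :: "nat set \<Rightarrow> (nat \<Rightarrow> 'z) \<Rightarrow> real" where "H s z = h (subtuple k s z)"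
definition mu :: real where "mu = kernel_mean D k h"

sublocale D: prob_space D by (rule D)
sublocale MZ: prob_space MZ unfolding MZ_def by (intro prob_space_PiM D)
sublocale AL: prob_space "arg_law D k" unfolding arg_law_def by (intro prob_space_PiM D)

lemma space_MZ: "space MZ = {z. \<forall>i. z i \<in> space D}"
  by (auto simp: MZ_def space_PiM PiE_def Pi_def)

lemma measurable_coord [measurable]: "(\<lambda>z. z i) \<in> measurable MZ D"
  unfolding MZ_def by simp

lemma measurable_tuple:
  "(\<lambda>z. \<lambda>i\<in>I. z (u i)) \<in> measurable MZ (Pi\<^sub>M I (\<lambda>_. D))"
  by (intro measurable_restrict measurable_coord)

lemma measurable_tuple':
  "(\<lambda>z. \<lambda>i\<in>{..<n}. z (u i)) \<in> measurable MZ (arg_law D n)"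
  unfolding arg_law_def by (rule measurable_tuple)

lemma distr_tuple:
  assumes "inj_on u I"
  shows "distr MZ (Pi\<^sub>M I (\<lambda>_. D)) (\<lambda>z. \<lambda>i\<in>I. z (u i)) = Pi\<^sub>M I (\<lambda>_. D)"
  unfolding MZ_def using distr_PiM_reindex[of UNIV "\<lambda>_. D" u I] assms D by simp

lemma distr_tuple':
  assumes "inj_on u {..<n}"
  shows "distr MZ (arg_law D n) (\<lambda>z. \<lambda>i\<in>{..<n}. z (u i)) = arg_law D n"
  unfolding arg_law_def by (rule distr_tuple[OF assms])

lemma distr_reindex:
  assumes "inj f"
  shows "distr MZ MZ (\<lambda>z i. z (f i)) = MZ"
  using distr_tuple[of f UNIV] assms by (simp add: MZ_def restrict_UNIV)

lemma measurable_reindex: "(\<lambda>z i. z (f i)) \<in> measurable MZ MZ"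
  using measurable_tuple[of f UNIV] by (simp add: MZ_def restrict_UNIV)

lemma H_measurable [measurable]: "H s \<in> borel_measurable MZ"
  unfolding H_def subtuple_def by (intro measurable_compose[OF measurable_tuple' h_meas])

text \<open>Two enumerations of \<open>s\<close> differ by a permutation of the k positions, so
  symmetry applies. This removes the dependence on the increasing order fixed in
  \<open>subtuple\<close>.\<close>

lemma h_tuple:
  assumes u: "bij_betw u {..<k} s" and z: "z \<in> space MZ"
  shows "h (\<lambda>i\<in>{..<k}. z (u i)) = H s z"
proof -
  have s: "finite s" "card s = k"
    using u bij_betw_finite[OF u] bij_betw_same_card[OF u] by auto
  let ?v = "(!) (sorted_list_of_set s)"
  have v: "bij_betw ?v {..<k} s" by (rule bij_betw_sorted_nth[OF s])
  \<comment> \<open>The permutation that turns the increasing enumeration \<open>?v\<close> into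
    \<open>u\<close>; outside the positions it is the identity, as \<open>permutes\<close>
    demands.\<close>
  define p where "p i = (if i < k then inv_into {..<k} ?v (u i) else i)" for i
  have p: "p permutes {..<k}"
  proof (rule bij_imp_permutes)
    have "bij_betw (inv_into {..<k} ?v \<circ> u) {..<k} {..<k}"
      using bij_betw_inv_into[OF v] u by (rule bij_betw_trans[rotated])
    then show "bij_betw p {..<k} {..<k}"
      by (rule bij_betw_cong[THEN iffD1, rotated]) (simp add: p_def)
  qed (simp add: p_def)
  have vp: "?v (p i) = u i" "p i < k" if "i < k" for i
  proof -
    have "u i \<in> s" using u that by (auto simp: bij_betw_def)
    then show "?v (p i) = u i" using v that by (simp add: p_def bij_betw_inv_into_right)
    show "p i < k" using p that by (metis lessThan_iff permutes_in_image)
  qed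
  have "subtuple k s z \<in> space (arg_law D k)"
    using z by (auto simp: subtuple_def arg_law_def space_PiM space_MZ)
  then have "h (subtuple k s z \<circ> p) = h (subtuple k s z)"
    using h_sym p unfolding symmetric_kernel_def by blast
  moreover have "subtuple k s z \<circ> p = (\<lambda>i\<in>{..<k}. z (u i))"
    using vp by (auto simp: subtuple_def fun_eq_iff p_def)
  ultimately show ?thesis by (simp add: H_def)
qed

text \<open>An injection need not preserve the order of the indices, so \<open>h_tuple\<close> is
  what identifies the relabelled tuple with the sorted one.\<close>

lemma H_reindex:
  assumes f: "inj f" and s: "finite s" "card s = k" and z: "z \<in> space MZ"
  shows "H s (\<lambda>i. z (f i)) = H (f ` s) z"
proof -
  have "bij_betw (f \<circ> (!) (sorted_list_of_set s)) {..<k} (f ` s)"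
    using bij_betw_sorted_nth[OF s] f
    by (intro bij_betw_trans) (auto simp: bij_betw_def intro: inj_on_subset)
  from h_tuple[OF this z] show ?thesis
    by (simp add: H_def subtuple_def)
qed

lemma distr_subtuple:
  assumes "finite s" "card s = k"
  shows "distr MZ (arg_law D k) (subtuple k s) = arg_law D k"
  using distr_tuple'[of "(!) (sorted_list_of_set s)" k] bij_betw_sorted_nth[OF assms]
  by (simp add: subtuple_def[abs_def] bij_betw_def)

lemma subtuple_measurable [measurable]: "subtuple k s \<in> measurable MZ (arg_law D k)"
  unfolding subtuple_def[abs_def] by (rule measurable_tuple')

lemma integral_subtuple:
  fixes g :: "_ \<Rightarrow> real"
  assumes [measurable]: "g \<in> borel_measurable (arg_law D k)" and "finite s" "card s = k"
  shows "(\<integral>z. g (subtuple k s z) \<partial>MZ) = (\<integral>z. g z \<partial>arg_law D k)"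
    and "integrable MZ (\<lambda>z. g (subtuple k s z)) \<longleftrightarrow> integrable (arg_law D k) g"
proof -
  show "(\<integral>z. g (subtuple k s z) \<partial>MZ) = (\<integral>z. g z \<partial>arg_law D k)"
    by (subst distr_subtuple[OF assms(2,3), symmetric], subst integral_distr) auto
  show "integrable MZ (\<lambda>z. g (subtuple k s z)) \<longleftrightarrow> integrable (arg_law D k) g"
    using integrable_distr_eq[of "subtuple k s" MZ "arg_law D k" g] distr_subtuple[OF assms(2,3)] by simp
qed

lemma H_sq:
  assumes "finite s" "card s = k"
  shows "integrable MZ (\<lambda>z. (H s z)\<^sup>2)"
  using integral_subtuple(2)[of "\<lambda>z. (h z)\<^sup>2", OF _ assms] h_sq by (simp add: H_def)

lemma H_int:
  assumes "finite s" "card s = k"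
  shows "integrable MZ (H s)"
  by (rule MZ.square_integrable_imp_integrable[OF H_measurable H_sq[OF assms]])

lemma H_mean:
  assumes "finite s" "card s = k"
  shows "(\<integral>z. H s z \<partial>MZ) = mu"
  unfolding H_def mu_def kernel_mean_def by (rule integral_subtuple(1)[OF h_meas assms])

text \<open>Relabelling by an injection preserves the i.i.d. law, and some injection carries one
  pair of index sets to the other as soon as sizes and overlap agree.\<close>

lemma H_prod_eq:
  assumes "finite s" "card s = k" "finite t" "card t = k"
    and "finite s'" "card s' = k" "finite t'" "card t' = k"
    and "card (s \<inter> t) = card (s' \<inter> t')"
  shows "(\<integral>z. H s z * H t z \<partial>MZ) = (\<integral>z. H s' z * H t' z \<partial>MZ)"
proof -
  obtain f where f: "inj f" "f ` s = s'" "f ` t = t'"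
    using exists_inj_extending[of s t s' t'] assms by auto
  have "(\<integral>z. H s' z * H t' z \<partial>MZ) = (\<integral>z. H s (\<lambda>i. z (f i)) * H t (\<lambda>i. z (f i)) \<partial>MZ)"
    using f assms by (intro Bochner_Integration.integral_cong) (auto simp: H_reindex)
  also have "\<dots> = (\<integral>z. H s z * H t z \<partial>distr MZ MZ (\<lambda>z i. z (f i)))"
    by (subst integral_distr) (auto intro: measurable_reindex)
  finally show ?thesis by (simp add: distr_reindex[OF f(1)])
qed

text \<open>The index set of the second kernel evaluation in \<open>zeta\<close>: it meets \<open>{..<k}\<close> in \<open>{..<c}\<close>.\<close>

definition shifted_idx :: "nat \<Rightarrow> nat \<Rightarrow> nat" where "shifted_idx c i = (if i < c then i else k + i)"

text \<open>The overlap function, read off from one canonical pair, namely the two tuples that occur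
  in \<open>zeta\<close>; \<open>H_prod\<close> extends the value to all pairs.\<close>

definition ov :: "nat \<Rightarrow> real" where
  "ov c = (\<integral>z. H {..<k} z * H (shifted_idx c ` {..<k}) z \<partial>MZ)"

lemma inj_shifted_idx: "c \<le> k \<Longrightarrow> inj_on (shifted_idx c) {..<k}"
  by (auto simp: inj_on_def shifted_idx_def split: if_splits)

lemma card_shifted_idx: "c \<le> k \<Longrightarrow> card (shifted_idx c ` {..<k}) = k"
  by (simp add: card_image inj_shifted_idx)

lemma inter_shifted_idx: "c \<le> k \<Longrightarrow> {..<k} \<inter> shifted_idx c ` {..<k} = {..<c}"
  by (force simp: shifted_idx_def image_iff split: if_splits)

lemma H_prod:
  assumes "finite s" "card s = k" "finite t" "card t = k"
  shows "(\<integral>z. H s z * H t z \<partial>MZ) = ov (card (s \<inter> t))"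
proof -
  have "card (s \<inter> t) \<le> k" using assms by (metis card_mono inf_le1)
  then show ?thesis unfolding ov_def using assms
    by (intro H_prod_eq) (simp_all add: card_shifted_idx inter_shifted_idx)
qed

sublocale overlap_family MZ H k ov
  by unfold_locales (simp_all add: H_sq H_prod)

text \<open>The law used in \<open>zeta\<close> is the image of \<open>MZ\<close> under restriction
  to the first 2 k coordinates, so the covariance becomes a centred mixed moment of \<open>H\<close>
  at two sets with overlap c.\<close>

lemma zeta_eq:
  assumes c: "c \<le> k"
  shows "zeta D k h c = ov c - mu\<^sup>2"
proof -
  \<comment> \<open>Writing \<open>id i\<close> gives the restriction and the first tuple the
    general shape \<open>z (u i)\<close>, so the same facts on tuples cover both kernel
    evaluations.\<close>
  let ?r = "\<lambda>z. \<lambda>i\<in>{..<2 * k}. z (id i)"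
  let ?A = "{..<k}" and ?B = "shifted_idx c ` {..<k}"
  have [measurable]: "(\<lambda>z. \<lambda>i\<in>{..<k}. z (u i)) \<in> measurable (arg_law D (2 * k)) (arg_law D k)"
    if "u ` {..<k} \<subseteq> {..<2 * k}" for u
    unfolding arg_law_def
    using that by (intro measurable_restrict measurable_component_singleton) auto
  have tuple: "h (\<lambda>i\<in>{..<k}. ?r z (u i)) = H (u ` {..<k}) z"
    if "u ` {..<k} \<subseteq> {..<2 * k}" "inj_on u {..<k}" "z \<in> space MZ" for u z
  proof -
    have "(\<lambda>i\<in>{..<k}. ?r z (u i)) = (\<lambda>i\<in>{..<k}. z (u i))"
      using that by (auto simp: fun_eq_iff restrict_def)
    then show ?thesis using h_tuple[of u "u ` {..<k}" z] that by (simp add: bij_betw_def)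
  qed
  have law: "distr MZ (arg_law D (2 * k)) ?r = arg_law D (2 * k)"
    by (rule distr_tuple') simp
  have sub: "id ` {..<k} \<subseteq> {..<2 * k}" "shifted_idx c ` {..<k} \<subseteq> {..<2 * k}"
    by (auto simp: shifted_idx_def)
  have Y: "(\<lambda>z. h (\<lambda>i\<in>{..<k}. if i < c then z i else z (k + i))) = (\<lambda>z. h (\<lambda>i\<in>{..<k}. z (shifted_idx c i)))"
    by (intro ext arg_cong[where f=h]) (auto simp: shifted_idx_def)
  have m: "(\<lambda>z. h (\<lambda>i\<in>{..<k}. z (id i))) \<in> borel_measurable (arg_law D (2 * k))"
      "(\<lambda>z. h (\<lambda>i\<in>{..<k}. z (shifted_idx c i))) \<in> borel_measurable (arg_law D (2 * k))"
    using sub by (auto intro!: measurable_compose[OF _ h_meas] simp: image_subset_iff)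
  have mean: "(\<integral>z. h (\<lambda>i\<in>{..<k}. z (u i)) \<partial>arg_law D (2 * k)) = mu"
    if "u ` {..<k} \<subseteq> {..<2 * k}" "inj_on u {..<k}" for u
  proof -
    have m: "(\<lambda>z. h (\<lambda>i\<in>{..<k}. z (u i))) \<in> borel_measurable (arg_law D (2 * k))"
      using that by (auto intro!: measurable_compose[OF _ h_meas])
    have "(\<integral>z. h (\<lambda>i\<in>{..<k}. z (u i)) \<partial>arg_law D (2 * k)) = (\<integral>z. H (u ` {..<k}) z \<partial>MZ)"
      by (subst law[symmetric], subst integral_distr[OF measurable_tuple' m])
         (intro Bochner_Integration.integral_cong refl tuple that)
    also have "\<dots> = mu" using that by (intro H_mean) (auto simp: card_image)
    finally show ?thesis .
  qed
  have inj: "inj_on id ?A" "inj_on (shifted_idx c) ?A" using inj_shifted_idx[OF c] by auto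
  have "zeta D k h c = (\<integral>z. (h (\<lambda>i\<in>{..<k}. z (id i)) - mu) * (h (\<lambda>i\<in>{..<k}. z (shifted_idx c i)) - mu) \<partial>arg_law D (2 * k))"
    using mean[OF sub(1) inj(1)] mean[OF sub(2) inj(2)] by (simp add: zeta_def covariance_def Y)
  also have "\<dots> = (\<integral>z. (H ?A z - mu) * (H ?B z - mu) \<partial>MZ)"
  proof -
    have mm: "(\<lambda>z. (h (\<lambda>i\<in>{..<k}. z (id i)) - mu) * (h (\<lambda>i\<in>{..<k}. z (shifted_idx c i)) - mu))
        \<in> borel_measurable (arg_law D (2 * k))"
      by (intro borel_measurable_times borel_measurable_diff m borel_measurable_const)
    show ?thesis
      by (subst law[symmetric], subst integral_distr[OF measurable_tuple' mm],
          rule Bochner_Integration.integral_cong[OF refl])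
         (simp only: tuple[OF sub(1) inj(1)] tuple[OF sub(2) inj(2)], simp)
  qed
  also have "\<dots> = (\<integral>z. H ?A z * H ?B z - mu * H ?A z - mu * H ?B z + mu\<^sup>2 \<partial>MZ)"
    by (intro Bochner_Integration.integral_cong) (auto simp: algebra_simps power2_eq_square)
  also have "\<dots> = ov c - mu\<^sup>2"
  proof -
    have s: "finite ?A" "card ?A = k" "finite ?B" "card ?B = k"
      using c by (auto simp: card_shifted_idx)
    have "integrable MZ (\<lambda>z. H ?A z * H ?B z)"
      by (intro integrable_mult_of_squares H_sq s) auto
    moreover have "(\<integral>z. H ?A z * H ?B z \<partial>MZ) = ov c" by (simp add: ov_def)
    ultimately show ?thesis
      using H_int[OF s(1,2)] H_int[OF s(3,4)] H_mean[OF s(1,2)] H_mean[OF s(3,4)]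
      by (simp add: MZ.prob_space power2_eq_square)
  qed
  finally show ?thesis .
qed

end

section \<open>The first-order projection and the variance of the complete U-statistic\<close>

context kernel begin

definition phi :: "'z \<Rightarrow> real" where "phi x = first_proj D k h x"

lemma indep_coords: "MZ.indep_vars (\<lambda>_. D) (\<lambda>i z. z i) UNIV"
proof -
  have "distr MZ D (\<lambda>z. z i) = D" for i :: nat
    unfolding MZ_def using D by (intro distr_PiM_component) auto
  moreover have "distr MZ (Pi\<^sub>M UNIV (\<lambda>_. D)) (\<lambda>z. \<lambda>i\<in>UNIV. z i) = MZ"
    using distr_reindex[of "\<lambda>i. i"] by (simp add: MZ_def restrict_UNIV)
  ultimately show ?thesis
    by (subst MZ.indep_vars_iff_distr_eq_PiM) (simp_all add: MZ_def)
qed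

lemma distr_coord: "distr MZ D (\<lambda>z. z i) = D"
  unfolding MZ_def using D by (intro distr_PiM_component) auto

lemma integral_disjoint_coords:
  fixes F G :: "(nat \<Rightarrow> 'z) \<Rightarrow> real"
  assumes "A \<inter> B = {}"
    and "F \<in> borel_measurable (Pi\<^sub>M A (\<lambda>_. D))" "G \<in> borel_measurable (Pi\<^sub>M B (\<lambda>_. D))"
    and "integrable MZ (\<lambda>z. F (restrict z A))" "integrable MZ (\<lambda>z. G (restrict z B))"
  shows "(\<integral>z. F (restrict z A) * G (restrict z B) \<partial>MZ) =
    (\<integral>z. F (restrict z A) \<partial>MZ) * (\<integral>z. G (restrict z B) \<partial>MZ)"
proof -
  have "MZ.indep_var (Pi\<^sub>M A (\<lambda>_. D)) (\<lambda>z. restrict z A) (Pi\<^sub>M B (\<lambda>_. D)) (\<lambda>z. restrict z B)"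
    using MZ.indep_var_restrict[OF indep_coords assms(1)] by simp
  from MZ.indep_var_compose[OF this assms(2,3)] assms(4,5) show ?thesis
    by (intro MZ.indep_var_lebesgue_integral) (simp_all add: comp_def)
qed

text \<open>Disjoint index sets give independent evaluations. Thus \<open>fdiff ov 0 0\<close> is
  the squared mean, and centring just removes the term j = 0 from Newton's formula.\<close>

lemma ov_0: "ov 0 = mu\<^sup>2"
proof -
  let ?s = "{..<k}" and ?t = "{k..<2 * k}"
  \<comment> \<open>Independence of disjoint blocks applies to functions of the restricted sequence,
    so \<open>H\<close> is rewritten to read only the coordinates in s.\<close>
  define F where "F s w = h (\<lambda>i\<in>{..<k}. w (sorted_list_of_set s ! i))" for s and w :: "nat \<Rightarrow> 'z"
  have F: "F s (restrict z s) = H s z" if "finite s" "card s = k" for s z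
  proof -
    have "sorted_list_of_set s ! i \<in> s" if "i < k" for i
      using bij_betw_sorted_nth[OF \<open>finite s\<close> \<open>card s = k\<close>] that by (auto simp: bij_betw_def)
    then show ?thesis by (auto simp: F_def H_def subtuple_def intro!: arg_cong[where f=h] restrict_ext)
  qed
  have Fm: "F s \<in> borel_measurable (Pi\<^sub>M s (\<lambda>_. D))" if "finite s" "card s = k" for s
    unfolding F_def arg_law_def using bij_betw_sorted_nth[OF that]
    by (intro measurable_compose[OF _ h_meas], unfold arg_law_def,
        intro measurable_restrict measurable_component_singleton) (auto simp: bij_betw_def)
  have "ov 0 = (\<integral>z. H ?s z * H ?t z \<partial>MZ)" 
    by (subst H_prod) (auto intro!: arg_cong[where f=ov])
  also have "\<dots> = (\<integral>z. F ?s (restrict z ?s) * F ?t (restrict z ?t) \<partial>MZ)"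
    by (simp add: F)
  also have "\<dots> = (\<integral>z. H ?s z \<partial>MZ) * (\<integral>z. H ?t z \<partial>MZ)"
    by (subst integral_disjoint_coords) (auto simp: Fm F H_int)
  finally show ?thesis by (simp add: H_mean power2_eq_square)
qed

lemma distr_update: "distr (D \<Otimes>\<^sub>M MZ) MZ (\<lambda>(x, z). z(i := x)) = MZ"
  using distr_pair_PiM_eq_PiM[of UNIV "\<lambda>_. D" i] D by (simp add: MZ_def)

lemma measurable_update: "(\<lambda>(x, z). z(i := x)) \<in> measurable (D \<Otimes>\<^sub>M MZ) MZ"
  using measurable_fun_upd[of UNIV UNIV i snd "D \<Otimes>\<^sub>M MZ" "\<lambda>_. D" fst]
  by (simp add: MZ_def case_prod_beta')

sublocale DMZ: pair_sigma_finite D MZ ..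

text \<open>Fubini for one coordinate: overwriting coordinate i by x and integrating over the
  sequence acts as the conditional expectation given that coordinate.\<close>

lemma integral_update:
  fixes g :: "(nat \<Rightarrow> 'z) \<Rightarrow> real"
  assumes g: "integrable MZ g"
  shows "integrable D (\<lambda>x. \<integral>z. g (z(i := x)) \<partial>MZ)"
    and "(\<integral>x. (\<integral>z. g (z(i := x)) \<partial>MZ) \<partial>D) = (\<integral>z. g z \<partial>MZ)"
    and "AE x in D. integrable MZ (\<lambda>z. g (z(i := x)))"
proof -
  have "integrable (distr (D \<Otimes>\<^sub>M MZ) MZ (\<lambda>(x, z). z(i := x))) g"
    using g by (simp add: distr_update)
  from integrable_distr[OF measurable_update this]
  have 1: "integrable (D \<Otimes>\<^sub>M MZ) (\<lambda>(x, z). g (z(i := x)))" by (simp add: case_prod_beta')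
  show "integrable D (\<lambda>x. \<integral>z. g (z(i := x)) \<partial>MZ)" using DMZ.integrable_fst'[OF 1] by simp
  show "AE x in D. integrable MZ (\<lambda>z. g (z(i := x)))" using DMZ.AE_integrable_fst'[OF 1] by simp
  have "(\<integral>z. g z \<partial>MZ) = (\<integral>z. g z \<partial>distr (D \<Otimes>\<^sub>M MZ) MZ (\<lambda>(x, z). z(i := x)))"
    by (simp add: distr_update)
  also have "\<dots> = (\<integral>(x, z). g (z(i := x)) \<partial>(D \<Otimes>\<^sub>M MZ))"
    using g integral_distr[OF measurable_update, of g] by (simp add: case_prod_beta')
  also have "\<dots> = (\<integral>x. (\<integral>z. g (z(i := x)) \<partial>MZ) \<partial>D)"
    using DMZ.integral_fst'[OF 1] by simp
  finally show "(\<integral>x. (\<integral>z. g (z(i := x)) \<partial>MZ) \<partial>D) = (\<integral>z. g z \<partial>MZ)" by simp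
qed

text \<open>The fixed value sits in position 0 because \<open>first_proj\<close> fixes that
  position; \<open>u\<close> lists the index set with the distinguished index first.\<close>

definition H_slice :: "(nat \<Rightarrow> nat) \<Rightarrow> 'z \<Rightarrow> (nat \<Rightarrow> 'z) \<Rightarrow> real" where
  "H_slice u x w = h (\<lambda>j\<in>{..<k}. if j = 0 then x else w (u j))"

lemma obtain_tuple_at:
  fixes s :: "nat set"
  assumes s: "finite s" "card s = k" "i \<in> s"
  obtains u where "bij_betw u {..<k} s" "u 0 = i"
proof -
  let ?v = "(!) (sorted_list_of_set s)"
  have v: "bij_betw ?v {..<k} s" by (rule bij_betw_sorted_nth[OF s(1,2)])
  then have "i \<in> ?v ` {..<k}" using s(3) by (simp add: bij_betw_def)
  then obtain j where j: "j < k" "?v j = i" by blast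
  have "bij_betw (Transposition.transpose 0 j) {..<k} {..<k}"
    using j k_pos by (intro permutes_imp_bij permutes_swap_id) auto
  then have "bij_betw (?v \<circ> Transposition.transpose 0 j) {..<k} s"
    using v by (rule bij_betw_trans)
  then show ?thesis using j by (intro that[of "?v \<circ> Transposition.transpose 0 j"]) auto
qed

lemma tuple_at_neq:
  fixes s :: "nat set"
  assumes "bij_betw u {..<k} s" "u 0 = i" "j < k" "j \<noteq> 0"
  shows "u j \<in> s - {i}"
proof -
  have "u j \<noteq> u 0"
    using assms(1,3,4) k_pos inj_onD[of u "{..<k}" j 0] by (auto simp: bij_betw_def)
  then show ?thesis using assms by (auto simp: bij_betw_def)
qed

lemma H_slice_measurable:
  assumes u: "bij_betw u {..<k} s" "u 0 = i" and x: "x \<in> space D"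
  shows "H_slice u x \<in> borel_measurable (Pi\<^sub>M (s - {i}) (\<lambda>_. D))"
proof -
  have "(\<lambda>w. if j = 0 then x else w (u j)) \<in> measurable (Pi\<^sub>M (s - {i}) (\<lambda>_. D)) D"
    if "j < k" for j
  proof (cases "j = 0")
    case False
    have "u j \<in> s - {i}"
      by (rule tuple_at_neq[OF u that False])
    then show ?thesis using False by simp
  qed (use x in simp)
  then show ?thesis
    unfolding H_slice_def[abs_def]
    by (intro measurable_compose[OF _ h_meas], unfold arg_law_def, intro measurable_restrict) auto
qed

lemma H_update:
  assumes u: "bij_betw u {..<k} s" "u 0 = i" and x: "x \<in> space D" and z: "z \<in> space MZ"
  shows "H s (z(i := x)) = H_slice u x (restrict z (s - {i}))"
proof -
  have "z(i := x) \<in> space MZ" using x z by (auto simp: space_MZ)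
  then have "H s (z(i := x)) = h (\<lambda>j\<in>{..<k}. (z(i := x)) (u j))"
    by (rule h_tuple[OF u(1), symmetric])
  also have "(\<lambda>j\<in>{..<k}. (z(i := x)) (u j)) =
      (\<lambda>j\<in>{..<k}. if j = 0 then x else restrict z (s - {i}) (u j))"
  proof (rule restrict_ext)
    fix j assume j: "j \<in> {..<k}"
    have "j \<noteq> 0 \<Longrightarrow> u j \<in> s - {i}"
      using j by (intro tuple_at_neq[OF u]) auto
    then show "(z(i := x)) (u j) = (if j = 0 then x else restrict z (s - {i}) (u j))"
      using u by auto
  qed
  finally show ?thesis unfolding H_slice_def .
qed

text \<open>An evaluation that uses coordinate i has conditional mean \<open>phi x + mu\<close>
  given it; by symmetry i may be moved to position 0. The overwritten coordinate is still
  integrated, over a probability space and with constant integrand.\<close>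

lemma integral_H_update:
  assumes s: "finite s" "card s = k" "i \<in> s" and x: "x \<in> space D"
  shows "(\<integral>z. H s (z(i := x)) \<partial>MZ) = phi x + mu"
proof -
  obtain u where u: "bij_betw u {..<k} s" "u 0 = i" using obtain_tuple_at[OF s] .
  have m: "(\<lambda>w. h (w(0 := x))) \<in> borel_measurable (arg_law D k)"
    unfolding arg_law_def
    by (rule measurable_compose[OF _ h_meas], unfold arg_law_def,
        rule measurable_fun_upd[where J="{..<k}"]) (use k_pos x in auto)
  have "(\<integral>z. H s (z(i := x)) \<partial>MZ) = (\<integral>z. h ((\<lambda>j\<in>{..<k}. z (u j))(0 := x)) \<partial>MZ)"
  proof (rule Bochner_Integration.integral_cong[OF refl])
    fix z assume z: "z \<in> space MZ"
    then have "z(i := x) \<in> space MZ" using x by (auto simp: space_MZ)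
    then have "H s (z(i := x)) = h (\<lambda>j\<in>{..<k}. (z(i := x)) (u j))"
      by (rule h_tuple[OF u(1), symmetric])
    also have "(\<lambda>j\<in>{..<k}. (z(i := x)) (u j)) = (\<lambda>j\<in>{..<k}. z (u j))(0 := x)"
    proof
      fix j
      have "j < k \<Longrightarrow> j \<noteq> 0 \<Longrightarrow> u j \<noteq> i"
        using tuple_at_neq[OF u, of j] by auto
      then show "(\<lambda>j\<in>{..<k}. (z(i := x)) (u j)) j = ((\<lambda>j\<in>{..<k}. z (u j))(0 := x)) j"
        using u k_pos by auto
    qed
    finally show "H s (z(i := x)) = h ((\<lambda>j\<in>{..<k}. z (u j))(0 := x))" .
  qed
  also have "\<dots> = (\<integral>w. h (w(0 := x)) \<partial>distr MZ (arg_law D k) (\<lambda>z. \<lambda>j\<in>{..<k}. z (u j)))"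
    by (rule integral_distr[OF measurable_tuple' m, symmetric])
  also have "distr MZ (arg_law D k) (\<lambda>z. \<lambda>j\<in>{..<k}. z (u j)) = arg_law D k"
    using u by (intro distr_tuple') (auto simp: bij_betw_def)
  finally have "(\<integral>z. H s (z(i := x)) \<partial>MZ) = (\<integral>w. h (w(0 := x)) \<partial>arg_law D k)" .
  then show ?thesis unfolding phi_def first_proj_def mu_def by (simp only: diff_add_cancel)
qed

lemma phi_integrable: "integrable D phi"
  and phi_mean: "(\<integral>x. phi x \<partial>D) = 0"
proof -
  have s: "finite {..<k}" "card {..<k} = k" "0 \<in> {..<k}" using k_pos by auto
  note 1 = integral_update[OF H_int[OF s(1,2)], of 0]
  have "integrable D (\<lambda>x. phi x + mu)"
    using 1(1) by (rule Bochner_Integration.integrable_cong[THEN iffD1, rotated -1])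
      (simp_all add: integral_H_update[OF s])
  then have "integrable D (\<lambda>x. phi x + mu - mu)" by (intro Bochner_Integration.integrable_diff) auto
  then show int: "integrable D phi" by simp
  have "(\<integral>x. phi x + mu \<partial>D) = (\<integral>x. (\<integral>z. H {..<k} (z(0 := x)) \<partial>MZ) \<partial>D)"
    by (intro Bochner_Integration.integral_cong) (simp_all add: integral_H_update[OF s])
  also have "\<dots> = mu" using 1(2) s by (simp add: H_mean)
  finally show "(\<integral>x. phi x \<partial>D) = 0" using int by (simp add: D.prob_space)
qed

lemma phi_measurable [measurable]: "phi \<in> borel_measurable D"
  using phi_integrable by simp

text \<open>Two evaluations sharing a single coordinate are conditionally independent given it, with
  common conditional mean \<open>phi x + mu\<close>; integrating the square of this mean gives
  \<open>ov 1\<close>. Integrability comes from that of the product of the two evaluations.\<close>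

lemma phi_sq_integrable: "integrable D (\<lambda>x. (phi x)\<^sup>2)"
  and phi_sq: "(\<integral>x. (phi x)\<^sup>2 \<partial>D) = ov 1 - mu\<^sup>2"
proof -
  \<comment> \<open>The tail of \<open>?t\<close> starts at \<open>Suc k\<close>, leaving k - 1
    indices that make k together with the shared index 0.\<close>
  let ?s = "{..<k}" and ?t = "insert 0 {Suc k..<2 * k}"
  have s: "finite ?s" "card ?s = k" "0 \<in> ?s" using k_pos by auto
  have t: "finite ?t" "card ?t = k" "0 \<in> ?t" using k_pos by auto
  have st: "?s \<inter> ?t = {0}" using k_pos by auto
  obtain u where u: "bij_betw u {..<k} ?s" "u 0 = 0" using obtain_tuple_at[OF s] .
  obtain v where v: "bij_betw v {..<k} ?t" "v 0 = 0" using obtain_tuple_at[OF t] .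
  have int: "integrable MZ (\<lambda>z. H ?s z * H ?t z)"
    by (intro integrable_mult_of_squares H_sq s t) auto
  note 1 = integral_update[OF int, of 0]
  \<comment> \<open>Slices are integrable only for almost every x, so the factorisation is an almost
    sure statement.\<close>
  have "AE x in D. (\<integral>z. H ?s (z(0 := x)) * H ?t (z(0 := x)) \<partial>MZ) = (phi x + mu)\<^sup>2"
    using integral_update(3)[OF H_int[OF s(1,2)], of 0] integral_update(3)[OF H_int[OF t(1,2)], of 0]
      AE_space[of D]
  proof eventually_elim
    case (elim x)
    have eq: "H ?s (z(0 := x)) = H_slice u x (restrict z (?s - {0}))"
        "H ?t (z(0 := x)) = H_slice v x (restrict z (?t - {0}))" if "z \<in> space MZ" for z
      using H_update[OF u elim(3) that] H_update[OF v elim(3) that] by auto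
    have int: "integrable MZ (\<lambda>z. H_slice u x (restrict z (?s - {0})))"
       "integrable MZ (\<lambda>z. H_slice v x (restrict z (?t - {0})))"
      using Bochner_Integration.integrable_cong[OF refl eq(1), of MZ] elim(1)
        Bochner_Integration.integrable_cong[OF refl eq(2), of MZ] elim(2) by simp_all
    have "(\<integral>z. H ?s (z(0 := x)) * H ?t (z(0 := x)) \<partial>MZ) =
      (\<integral>z. H_slice u x (restrict z (?s - {0})) * H_slice v x (restrict z (?t - {0})) \<partial>MZ)"
      by (intro Bochner_Integration.integral_cong) (simp_all add: eq)
    also have "\<dots> = (\<integral>z. H_slice u x (restrict z (?s - {0})) \<partial>MZ) * (\<integral>z. H_slice v x (restrict z (?t - {0})) \<partial>MZ)"
      using st by (intro integral_disjoint_coords int H_slice_measurable u v elim(3)) auto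
    also have "(\<integral>z. H_slice u x (restrict z (?s - {0})) \<partial>MZ) = (\<integral>z. H ?s (z(0 := x)) \<partial>MZ)"
      by (intro Bochner_Integration.integral_cong) (simp_all add: eq)
    also have "(\<integral>z. H_slice v x (restrict z (?t - {0})) \<partial>MZ) = (\<integral>z. H ?t (z(0 := x)) \<partial>MZ)"
      by (intro Bochner_Integration.integral_cong) (simp_all add: eq)
    finally show ?case
      unfolding integral_H_update[OF s elim(3)] integral_H_update[OF t elim(3)] power2_eq_square .
  qed
  note AE = this
  have m: "(\<lambda>x. (phi x + mu)\<^sup>2) \<in> borel_measurable D" by measurable
  have sq: "integrable D (\<lambda>x. (phi x + mu)\<^sup>2)"
    using integrable_cong_AE_imp[OF 1(1) m] AE by (simp add: eq_commute)
  have "integrable D (\<lambda>x. (phi x + mu)\<^sup>2 - 2 * mu * phi x - mu\<^sup>2)"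
    using sq phi_integrable by (intro Bochner_Integration.integrable_diff) auto
  also have "(\<lambda>x. (phi x + mu)\<^sup>2 - 2 * mu * phi x - mu\<^sup>2) = (\<lambda>x. (phi x)\<^sup>2)"
    by (simp add: power2_sum fun_eq_iff)
  finally show int2: "integrable D (\<lambda>x. (phi x)\<^sup>2)" .
  have "ov 1 = (\<integral>z. H ?s z * H ?t z \<partial>MZ)" using H_prod[OF s(1,2) t(1,2)] unfolding st by simp
  also have "\<dots> = (\<integral>x. (\<integral>z. H ?s (z(0 := x)) * H ?t (z(0 := x)) \<partial>MZ) \<partial>D)"
    using 1(2) by simp
  also have "\<dots> = (\<integral>x. (phi x + mu)\<^sup>2 \<partial>D)"
    using 1(1) AE m by (intro integral_cong_AE) auto
  also have "\<dots> = (\<integral>x. (phi x)\<^sup>2 + 2 * mu * phi x + mu\<^sup>2 \<partial>D)"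
    by (simp add: power2_sum algebra_simps)
  also have "\<dots> = (\<integral>x. (phi x)\<^sup>2 \<partial>D) + mu\<^sup>2"
    using int2 phi_integrable by (simp add: phi_mean D.prob_space)
  finally show "(\<integral>x. (phi x)\<^sup>2 \<partial>D) = ov 1 - mu\<^sup>2" by simp
qed

lemma integrable_coord:
  fixes g :: "'z \<Rightarrow> real"
  assumes "integrable D g"
  shows "integrable MZ (\<lambda>z. g (z i))" and "(\<integral>z. g (z i) \<partial>MZ) = (\<integral>x. g x \<partial>D)"
proof -
  have "integrable (distr MZ D (\<lambda>z. z i)) g" using assms by (simp add: distr_coord)
  then show "integrable MZ (\<lambda>z. g (z i))" by (rule integrable_distr[OF measurable_coord])
  show "(\<integral>z. g (z i) \<partial>MZ) = (\<integral>x. g x \<partial>D)"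
    using assms integral_distr[of "\<lambda>z. z i" MZ D g] by (simp add: distr_coord)
qed

lemma phi_coord_measurable [measurable]: "(\<lambda>z. phi (z i)) \<in> borel_measurable MZ"
  by (rule measurable_compose[OF measurable_coord phi_measurable])

lemma phi_coord_prod: "(\<integral>z. phi (z i) * phi (z j) \<partial>MZ) = (if i = j then ov 1 - mu\<^sup>2 else 0)"
proof (cases "i = j")
  case True
  then show ?thesis using integrable_coord(2)[OF phi_sq_integrable, of j] phi_sq
    by (simp add: power2_eq_square)
next
  case False
  have "integrable MZ (\<lambda>z. phi (z i) * phi (z j))"
    by (intro integrable_mult_of_squares integrable_coord phi_sq_integrable) auto
  from integral_update(2)[OF this, of j] False show ?thesis
    by (simp add: integrable_coord(2)[OF phi_integrable] phi_mean)
qed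

lemma phi_coord_mean: "(\<integral>z. phi (z i) \<partial>MZ) = 0"
  by (simp add: integrable_coord(2)[OF phi_integrable] phi_mean)

text \<open>Condition on coordinate i: an evaluation that uses it contributes
  \<open>phi x + mu\<close>, one that does not is constant in x, and \<open>phi\<close> has mean
  zero.\<close>

lemma H_phi_prod:
  assumes s: "finite s" "card s = k"
  shows "(\<integral>z. H s z * phi (z i) \<partial>MZ) = (if i \<in> s then ov 1 - mu\<^sup>2 else 0)"
proof -
  have "integrable MZ (\<lambda>z. H s z * phi (z i))"
    by (intro integrable_mult_of_squares integrable_coord phi_sq_integrable H_sq s) auto
  note upd = integral_update(2)[OF this, of i, symmetric]
  show ?thesis
  proof (cases "i \<in> s")
    case True
    have "(\<integral>z. H s z * phi (z i) \<partial>MZ) = (\<integral>x. (phi x + mu) * phi x \<partial>D)"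
      unfolding upd by (intro Bochner_Integration.integral_cong) (simp_all add: integral_H_update[OF s True])
    also have "\<dots> = (\<integral>x. (phi x)\<^sup>2 + mu * phi x \<partial>D)" by (simp add: power2_eq_square algebra_simps)
    also have "\<dots> = ov 1 - mu\<^sup>2"
      by (simp add: phi_sq_integrable phi_integrable phi_sq phi_mean)
    finally show ?thesis using True by simp
  next
    case False
    have "H s (z(i := x)) = H s z" for z x
    proof -
      have "sorted_list_of_set s ! j \<noteq> i" if "j < k" for j
        using bij_betw_sorted_nth[OF s] that False by (auto simp: bij_betw_def)
      then show ?thesis by (auto simp: H_def subtuple_def intro!: arg_cong[where f=h] restrict_ext)
    qed
    then show ?thesis using False unfolding upd by (simp add: phi_mean)
  qed
qed

definition Ufull :: "nat \<Rightarrow> (nat \<Rightarrow> 'z) \<Rightarrow> real" where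
  "Ufull N z = (\<Sum>s\<in>k_subsets N k. H s z) / real (N choose k)"

definition hajek :: "nat \<Rightarrow> (nat \<Rightarrow> 'z) \<Rightarrow> real" where
  "hajek N z = (real k / real N) * (\<Sum>i<N. phi (z i))"

lemma Ufull_measurable [measurable]: "Ufull N \<in> borel_measurable MZ"
  unfolding Ufull_def[abs_def] by measurable

lemma hajek_measurable [measurable]: "hajek N \<in> borel_measurable MZ"
  unfolding hajek_def[abs_def] by measurable

lemma Ufull_sq: "integrable MZ (\<lambda>z. (Ufull N z)\<^sup>2)"
  unfolding Ufull_def power_divide
  by (intro Bochner_Integration.integrable_divide_zero integrable_square_sum H_sq)
     (auto dest: k_subsetsD)

lemma Ufull_integrable: "integrable MZ (Ufull N)"
  by (rule MZ.square_integrable_imp_integrable[OF Ufull_measurable Ufull_sq])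

lemma hajek_sq: "integrable MZ (\<lambda>z. (hajek N z)\<^sup>2)"
  unfolding hajek_def power_mult_distrib
  by (intro Bochner_Integration.integrable_mult_right integrable_square_sum integrable_coord(1)[OF phi_sq_integrable])
     auto

lemma hajek_integrable: "integrable MZ (hajek N)"
  by (rule MZ.square_integrable_imp_integrable[OF hajek_measurable hajek_sq])

lemma hajek_mean: "(\<integral>z. hajek N z \<partial>MZ) = 0"
  unfolding hajek_def
  by (simp add: integrable_coord(1)[OF phi_integrable] phi_coord_mean)

lemma Ufull_mean:
  assumes "k \<le> N"
  shows "(\<integral>z. Ufull N z \<partial>MZ) = mu"
proof -
  have "(\<integral>z. Ufull N z \<partial>MZ) = (\<Sum>s\<in>k_subsets N k. \<integral>z. H s z \<partial>MZ) / real (N choose k)"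
  proof -
    have "integrable MZ (\<lambda>z. H s z)" if "s \<in> k_subsets N k" for s
      using that by (intro H_int) (auto dest: k_subsetsD)
    then show ?thesis unfolding Ufull_def by simp
  qed
  also have "(\<Sum>s\<in>k_subsets N k. \<integral>z. H s z \<partial>MZ) = (\<Sum>s\<in>k_subsets N k. mu)"
    by (intro sum.cong refl H_mean) (auto dest: k_subsetsD)
  finally show ?thesis using assms by (simp add: card_k_subsets)
qed

lemma Ufull_sq_mean: "(\<integral>z. (Ufull N z)\<^sup>2 \<partial>MZ) = overlap_avg N k ov"
proof -
  let ?K = "k_subsets N k"
  have "(\<integral>z. (Ufull N z)\<^sup>2 \<partial>MZ) =
      (\<integral>z. (\<Sum>s\<in>?K. \<Sum>t\<in>?K. H s z * H t z) / (real (N choose k))\<^sup>2 \<partial>MZ)"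
    unfolding Ufull_def power_divide by (simp only: power2_eq_square sum_product)
  also have "\<dots> = (\<Sum>s\<in>?K. \<Sum>t\<in>?K. \<integral>z. H s z * H t z \<partial>MZ) / (real (N choose k))\<^sup>2"
  proof -
    have int: "integrable MZ (\<lambda>z. H s z * H t z)" if "s \<in> ?K" "t \<in> ?K" for s t
      using that by (intro integrable_mult_of_squares H_sq) (auto dest: k_subsetsD)
    then show ?thesis
      by (subst integral_divide_zero, subst Bochner_Integration.integral_sum)
         (auto intro!: Bochner_Integration.integral_sum arg_cong2[where f="(/)"] sum.cong)
  qed
  also have "(\<Sum>s\<in>?K. \<Sum>t\<in>?K. \<integral>z. H s z * H t z \<partial>MZ) = (\<Sum>s\<in>?K. \<Sum>t\<in>?K. ov (card (s \<inter> t)))"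
    by (intro sum.cong refl H_prod) (auto dest: k_subsetsD)
  finally show ?thesis by (simp add: overlap_avg_def)
qed

lemma hajek_sq_mean:
  assumes "0 < N"
  shows "(\<integral>z. (hajek N z)\<^sup>2 \<partial>MZ) = (real k)\<^sup>2 / real N * (ov 1 - mu\<^sup>2)"
proof -
  have "(\<integral>z. (hajek N z)\<^sup>2 \<partial>MZ) =
      (\<integral>z. (real k / real N)\<^sup>2 * (\<Sum>i<N. \<Sum>j<N. phi (z i) * phi (z j)) \<partial>MZ)"
    unfolding hajek_def power_mult_distrib by (simp only: power2_eq_square sum_product)
  also have "\<dots> = (real k / real N)\<^sup>2 * (\<Sum>i<N. \<Sum>j<N. \<integral>z. phi (z i) * phi (z j) \<partial>MZ)"
  proof -
    have "integrable MZ (\<lambda>z. phi (z i) * phi (z j))" for i j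
      by (intro integrable_mult_of_squares integrable_coord(1)[OF phi_sq_integrable]) auto
    then show ?thesis by simp
  qed
  also have "\<dots> = (real k / real N)\<^sup>2 * (real N * (ov 1 - mu\<^sup>2))"
    by (simp add: phi_coord_prod)
  also have "\<dots> = (real k)\<^sup>2 / real N * (ov 1 - mu\<^sup>2)"
    using assms by (simp add: power2_eq_square)
  finally show ?thesis .
qed

text \<open>The value is that of \<open>hajek_sq_mean\<close>. So the remainder is orthogonal to the
  projection, and its second moment in \<open>hajek_error\<close> is a difference of two
  variances.\<close>

lemma Ufull_hajek_mean:
  assumes "k \<le> N"
  shows "(\<integral>z. Ufull N z * hajek N z \<partial>MZ) = (real k)\<^sup>2 / real N * (ov 1 - mu\<^sup>2)"
proof -
  let ?K = "k_subsets N k" and ?c = "real k / real N / real (N choose k)"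
  have "(\<integral>z. Ufull N z * hajek N z \<partial>MZ) =
      (\<integral>z. ?c * (\<Sum>s\<in>?K. \<Sum>i<N. H s z * phi (z i)) \<partial>MZ)"
    unfolding Ufull_def hajek_def sum_product[symmetric] by (simp add: field_simps)
  also have "\<dots> = ?c * (\<Sum>s\<in>?K. \<Sum>i<N. \<integral>z. H s z * phi (z i) \<partial>MZ)"
  proof -
    have int: "integrable MZ (\<lambda>z. H s z * phi (z i))" if "s \<in> ?K" for s i
      using that by (intro integrable_mult_of_squares integrable_coord(1)[OF phi_sq_integrable] H_sq)
        (auto dest: k_subsetsD)
    then show ?thesis by simp
  qed
  also have "\<dots> = ?c * (\<Sum>s\<in>?K. real k * (ov 1 - mu\<^sup>2))"
  proof (intro arg_cong2[where f="(*)"] sum.cong refl)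
    fix s assume s: "s \<in> ?K"
    have "(\<Sum>i<N. \<integral>z. H s z * phi (z i) \<partial>MZ) = (\<Sum>i<N. if i \<in> s then ov 1 - mu\<^sup>2 else 0)"
      using k_subsetsD[OF s] by (simp add: H_phi_prod)
    also have "\<dots> = (\<Sum>i\<in>{..<N} \<inter> s. ov 1 - mu\<^sup>2)" by (rule sum.inter_restrict[symmetric]) simp
    also have "{..<N} \<inter> s = s" using k_subsetsD[OF s] by blast
    finally show "(\<Sum>i<N. \<integral>z. H s z * phi (z i) \<partial>MZ) = real k * (ov 1 - mu\<^sup>2)"
      using k_subsetsD[OF s] by simp
  qed
  finally show ?thesis using assms by (simp add: card_k_subsets power2_eq_square)
qed

text \<open>As \<open>ov 0\<close> is the squared mean, this is the variance of the complete
  U-statistic.\<close>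

abbreviation "vfull N \<equiv> overlap_avg N k ov - ov 0"

lemma hajek_error:
  assumes "k \<le> N"
  shows "(\<integral>z. (Ufull N z - mu - hajek N z)\<^sup>2 \<partial>MZ) = vfull N - (real k)\<^sup>2 / real N * (ov 1 - mu\<^sup>2)"
    and "integrable MZ (\<lambda>z. (Ufull N z - mu - hajek N z)\<^sup>2)"
proof -
  have UL: "integrable MZ (\<lambda>z. Ufull N z * hajek N z)"
    by (intro integrable_mult_of_squares Ufull_sq hajek_sq) auto
  show "integrable MZ (\<lambda>z. (Ufull N z - mu - hajek N z)\<^sup>2)"
    by (intro integrable_square_diff Ufull_sq hajek_sq) auto
  have "(\<integral>z. (Ufull N z - mu - hajek N z)\<^sup>2 \<partial>MZ) =
    (\<integral>z. (Ufull N z)\<^sup>2 + (hajek N z)\<^sup>2 + mu\<^sup>2 - 2 * mu * Ufull N z - 2 * (Ufull N z * hajek N z) + 2 * mu * hajek N z \<partial>MZ)"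
    by (intro Bochner_Integration.integral_cong) (simp_all add: power2_eq_square algebra_simps)
  also have "\<dots> = overlap_avg N k ov + (real k)\<^sup>2 / real N * (ov 1 - mu\<^sup>2) + mu\<^sup>2
      - 2 * mu * mu - 2 * ((real k)\<^sup>2 / real N * (ov 1 - mu\<^sup>2))"
    using assms k_pos UL
    by (simp add: Ufull_sq hajek_sq Ufull_integrable hajek_integrable hajek_mean Ufull_mean Ufull_sq_mean
        hajek_sq_mean Ufull_hajek_mean MZ.prob_space)
  finally show "(\<integral>z. (Ufull N z - mu - hajek N z)\<^sup>2 \<partial>MZ) = vfull N - (real k)\<^sup>2 / real N * (ov 1 - mu\<^sup>2)"
    by (simp add: ov_0 power2_eq_square)
qed

lemma zeta_1_eq: "zeta D k h 1 = ov 1 - mu\<^sup>2"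
  using k_pos by (intro zeta_eq) simp

lemma zeta_k_eq: "zeta D k h k = ov k - mu\<^sup>2"
  by (intro zeta_eq) simp

lemma vfull_bounds:
  assumes "k \<le> N"
  shows "0 \<le> zeta D k h 1" "real k * zeta D k h 1 \<le> zeta D k h k"
    "(real k)\<^sup>2 / real N * zeta D k h 1 \<le> vfull N" "vfull N \<le> real k / real N * zeta D k h k"
    "vfull N \<le> (real k)\<^sup>2 / real N * zeta D k h 1 + (real k / real N)\<^sup>2 * zeta D k h k"
    "zeta D k h k / real (N choose k) \<le> vfull N"
  using overlap_avg_bounds[of k ov N, OF fdiff_nonneg k_pos assms]
  unfolding zeta_1_eq zeta_k_eq ov_0 by auto

end

subsection \<open>Independent uniform draws from a finite set\<close>

lemma prod_at_two:
  fixes a :: "'i \<Rightarrow> 'b::comm_monoid_mult"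
  assumes "finite I" "i \<in> I" "j \<in> I" "i \<noteq> j"
  shows "(\<Prod>l\<in>I. if l = i \<or> l = j then a l else 1) = a i * a j"
proof -
  have "(\<Prod>l\<in>I. if l = i \<or> l = j then a l else 1) = (\<Prod>l\<in>{i, j}. a l)"
    using assms by (intro prod.mono_neutral_cong_right) auto
  then show ?thesis using assms by simp
qed

locale uniform_draws =
  fixes K :: "'b set" and m :: nat
  assumes finite_K: "finite K" and K_ne: "K \<noteq> {}" and m_pos: "0 < m"
begin

definition UC :: "'b measure" where "UC = uniform_count_measure K"
definition MS :: "(nat \<Rightarrow> 'b) measure" where "MS = Pi\<^sub>M {..<m} (\<lambda>_. UC)"
definition avg :: "('b \<Rightarrow> real) \<Rightarrow> real" where "avg g = (\<Sum>s\<in>K. g s) / real (card K)"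

sublocale UC: prob_space UC
  unfolding UC_def by (intro prob_space_uniform_count_measure finite_K K_ne)

sublocale MS: prob_space MS
  unfolding MS_def by (intro prob_space_PiM UC.prob_space_axioms)

sublocale PUC: product_sigma_finite "\<lambda>_::nat. UC"
  by unfold_locales

lemma sets_UC [measurable_cong]: "sets UC = sets (count_space K)"
  by (simp add: UC_def sets_uniform_count_measure_count_space)

lemma measurable_UC: "f \<in> measurable UC N \<longleftrightarrow> f \<in> K \<rightarrow> space N"
  using measurable_cong_sets[OF sets_UC refl, of N] by simp

lemma space_UC: "space UC = K"
  by (simp add: UC_def space_uniform_count_measure)

lemma measurable_draw [measurable]: "j < m \<Longrightarrow> (\<lambda>s. s j) \<in> measurable MS (count_space K)"
  unfolding MS_def using measurable_component_singleton[of j "{..<m}" "\<lambda>_. UC"]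
  by (simp add: measurable_cong_sets[OF refl sets_UC])

lemma measurable_on_draw [measurable]:
  fixes g :: "'b \<Rightarrow> 'c::topological_space"
  shows "j < m \<Longrightarrow> (\<lambda>s. g (s j)) \<in> borel_measurable MS"
  by (rule measurable_compose[OF measurable_draw]) auto

lemma UC_integrable:
  fixes g :: "'b \<Rightarrow> 'c::{banach,second_countable_topology}"
  shows "integrable UC g"
  unfolding UC_def uniform_count_measure_def by (rule integrable_point_measure_finite[OF finite_K])

lemma UC_integral: "(\<integral>s. g s \<partial>UC) = avg g"
  unfolding UC_def avg_def using integral_uniform_count_measure[OF finite_K] by simp

lemma avg_const: "avg (\<lambda>s. c) = c"
  using finite_K K_ne by (simp add: avg_def)

lemma MS_in_K: "s \<in> space MS \<Longrightarrow> j < m \<Longrightarrow> s j \<in> K"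
  by (auto simp: MS_def space_PiM space_UC)

lemma MS_integrable2:
  fixes g g' :: "'b \<Rightarrow> real"
  assumes "i < m" "j < m"
  shows "integrable MS (\<lambda>s. g (s i) * g' (s j))"
proof (rule MS.integrable_const_bound)
  let ?B = "(\<Sum>x\<in>K. \<bar>g x\<bar>) * (\<Sum>x\<in>K. \<bar>g' x\<bar>)"
  have "norm (g (s i) * g' (s j)) \<le> ?B" if "s \<in> space MS" for s
    unfolding norm_mult using assms MS_in_K[OF that]
    by (intro mult_mono) (auto intro!: member_le_sum finite_K sum_nonneg)
  then show "AE s in MS. norm (g (s i) * g' (s j)) \<le> ?B" by (auto intro: AE_I2)
  show "(\<lambda>s. g (s i) * g' (s j)) \<in> borel_measurable MS"
    using assms by (intro borel_measurable_times measurable_on_draw)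
qed

text \<open>A function of two coordinates is padded by constant factors 1 to a product over all m
  coordinates, to which the product rule for integrals applies.\<close>

lemma MS_integral2:
  fixes g g' :: "'b \<Rightarrow> real"
  assumes "i < m" "j < m" "i \<noteq> j"
  shows "(\<integral>s. g (s i) * g' (s j) \<partial>MS) = avg g * avg g'"
proof -
  define f where "f l = (if l = i then g else g')" for l
  have "(\<integral>s. g (s i) * g' (s j) \<partial>MS) =
      (\<integral>s. (\<Prod>l<m. (\<lambda>x. if l = i \<or> l = j then f l x else 1) (s l)) \<partial>MS)"
    using assms by (subst prod_at_two) (auto simp: f_def)
  also have "\<dots> = (\<Prod>l<m. \<integral>x. (if l = i \<or> l = j then f l x else 1) \<partial>UC)"
    unfolding MS_def by (rule PUC.product_integral_prod) (auto intro: UC_integrable)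
  also have "\<dots> = (\<Prod>l<m. if l = i \<or> l = j then avg (f l) else 1)"
    by (intro prod.cong refl) (auto simp: UC_integral avg_const)
  also have "\<dots> = avg g * avg g'"
    using assms by (subst prod_at_two) (auto simp: f_def)
  finally show ?thesis .
qed

lemma MS_integral1:
  fixes g :: "'b \<Rightarrow> real"
  assumes "i < m"
  shows "(\<integral>s. g (s i) \<partial>MS) = avg g" "integrable MS (\<lambda>s. g (s i))"
proof -
  have "(\<integral>s. g (s i) \<partial>MS) = (\<integral>s. (\<Prod>l<m. (\<lambda>x. if l = i then g x else 1) (s l)) \<partial>MS)"
    using assms by (simp add: prod.delta)
  also have "\<dots> = (\<Prod>l<m. \<integral>x. (if l = i then g x else 1) \<partial>UC)"
    unfolding MS_def by (rule PUC.product_integral_prod) (auto intro: UC_integrable)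
  also have "\<dots> = (\<Prod>l<m. if l = i then avg g else 1)"
    by (intro prod.cong refl) (auto simp: UC_integral avg_const)
  also have "\<dots> = avg g" using assms by (simp add: prod.delta)
  finally show "(\<integral>s. g (s i) \<partial>MS) = avg g" .
  show "integrable MS (\<lambda>s. g (s i))"
    using MS_integrable2[OF assms assms, of g "\<lambda>_. 1"] by simp
qed

lemma draws_integrable: "integrable MS (\<lambda>s. \<Sum>j<m. g (s j) :: real)"
  by (intro Bochner_Integration.integrable_sum MS_integral1) auto

lemma draws_mean: "(\<integral>s. (\<Sum>j<m. g (s j)) \<partial>MS) = real m * avg g"
  by (subst Bochner_Integration.integral_sum) (auto simp: MS_integral1)

lemma draws_square:
  assumes "avg g = 0"
  shows "(\<integral>s. (\<Sum>j<m. g (s j))\<^sup>2 \<partial>MS) = real m * avg (\<lambda>s. (g s)\<^sup>2)"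
proof -
  have "(\<integral>s. (\<Sum>j<m. g (s j))\<^sup>2 \<partial>MS) = (\<integral>s. (\<Sum>i<m. \<Sum>j<m. g (s i) * g (s j)) \<partial>MS)"
    by (simp only: power2_eq_square sum_product)
  also have "\<dots> = (\<Sum>i<m. \<Sum>j<m. \<integral>s. g (s i) * g (s j) \<partial>MS)"
  proof -
    have 1: "integrable MS (\<lambda>s. g (s i) * g (s j))" if "i \<in> {..<m}" "j \<in> {..<m}" for i j
      using that by (intro MS_integrable2) auto
    have 2: "integrable MS (\<lambda>s. \<Sum>j<m. g (s i) * g (s j))" if "i \<in> {..<m}" for i
      using that by (intro Bochner_Integration.integrable_sum 1)
    show ?thesis
      by (subst Bochner_Integration.integral_sum[OF 2], assumption,
          intro sum.cong refl Bochner_Integration.integral_sum 1)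
  qed
  also have "\<dots> = (\<Sum>i<m. \<Sum>j<m. if i = j then avg (\<lambda>s. (g s)\<^sup>2) else 0)"
    using assms MS_integral1(1)[of _ "\<lambda>s. (g s)\<^sup>2"]
    by (intro sum.cong refl) (auto simp: MS_integral2 power2_eq_square)
  finally show ?thesis by simp
qed

lemma draws_iexp:
  fixes g :: "'b \<Rightarrow> real"
  shows "(\<integral>s. iexp (\<Sum>j<m. g (s j)) \<partial>MS) = (\<integral>x. iexp (g x) \<partial>UC) ^ m"
proof -
  have "(\<integral>s. iexp (\<Sum>j<m. g (s j)) \<partial>MS) = (\<integral>s. (\<Prod>j<m. (\<lambda>x. iexp (g x)) (s j)) \<partial>MS)"
    by (simp add: exp_sum sum_distrib_left)
  also have "\<dots> = (\<Prod>j<m. \<integral>x. iexp (g x) \<partial>UC)"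
    unfolding MS_def by (rule PUC.product_integral_prod) (auto intro: UC_integrable)
  finally show ?thesis by simp
qed

lemma avg_add: "avg (\<lambda>s. f s + g s) = avg f + avg g"
  by (simp add: avg_def sum.distrib add_divide_distrib)

lemma avg_diff: "avg (\<lambda>s. f s - g s) = avg f - avg g"
  by (simp add: avg_def sum_subtractf diff_divide_distrib)

lemma avg_cmult: "avg (\<lambda>s. c * f s) = c * avg f"
  by (simp add: avg_def sum_distrib_left)

lemma avg_mono: "(\<And>s. s \<in> K \<Longrightarrow> f s \<le> g s) \<Longrightarrow> avg f \<le> avg g"
  by (simp add: avg_def divide_right_mono sum_mono)

lemma avg_centred_square: "avg (\<lambda>s. (f s - avg f)\<^sup>2) = avg (\<lambda>s. (f s)\<^sup>2) - (avg f)\<^sup>2"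
proof -
  have "(\<lambda>s. (f s - avg f)\<^sup>2) = (\<lambda>s. ((f s)\<^sup>2 - 2 * avg f * f s) + (avg f)\<^sup>2)"
    by (simp add: power2_diff fun_eq_iff algebra_simps)
  then show ?thesis
    by (simp only: avg_add avg_diff avg_cmult avg_const) (simp add: power2_eq_square)
qed

lemma avg_square_le: "(avg f)\<^sup>2 \<le> avg (\<lambda>s. (f s)\<^sup>2)"
proof -
  have "0 \<le> avg (\<lambda>s. (f s - avg f)\<^sup>2)" by (auto simp: avg_def intro!: sum_nonneg divide_nonneg_nonneg)
  then show ?thesis unfolding avg_centred_square by simp
qed

lemma avg_fourth_le: "(avg f) ^ 4 \<le> avg (\<lambda>s. (f s) ^ 4)"
proof -
  have "(avg f) ^ 4 = ((avg f)\<^sup>2)\<^sup>2" by simp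
  also have "\<dots> \<le> (avg (\<lambda>s. (f s)\<^sup>2))\<^sup>2"
    by (intro power_mono avg_square_le) simp
  also have "\<dots> \<le> avg (\<lambda>s. ((f s)\<^sup>2)\<^sup>2)" by (rule avg_square_le)
  finally show ?thesis by simp
qed

end

subsection \<open>Moment and characteristic function estimates\<close>

lemma (in prob_space) expectation_abs_le_sqrt:
  fixes X :: "'a \<Rightarrow> real"
  assumes [measurable]: "X \<in> borel_measurable M" and "integrable M (\<lambda>x. (X x)\<^sup>2)"
  shows "expectation (\<lambda>x. \<bar>X x\<bar>) \<le> sqrt (expectation (\<lambda>x. (X x)\<^sup>2))"
proof -
  have "integrable M X" by (rule square_integrable_imp_integrable[OF assms])
  then have "variance (\<lambda>x. \<bar>X x\<bar>) = expectation (\<lambda>x. \<bar>X x\<bar>\<^sup>2) - (expectation (\<lambda>x. \<bar>X x\<bar>))\<^sup>2"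
    using assms by (intro variance_eq) auto
  moreover have "0 \<le> variance (\<lambda>x. \<bar>X x\<bar>)" by (rule variance_positive)
  ultimately show ?thesis by (intro real_le_rsqrt) simp
qed

lemma norm_iexp_diff_le: "cmod (iexp a - iexp b) \<le> \<bar>a - b\<bar>"
proof -
  have "iexp a - iexp b = iexp b * (iexp (a - b) - 1)"
    by (simp add: right_diff_distrib exp_add[symmetric] algebra_simps)
  then have "cmod (iexp a - iexp b) = cmod (iexp (a - b) - 1)" by (simp add: norm_mult)
  then show ?thesis using iexp_approx1[of "a - b" 0] by simp
qed

text \<open>With x = |y| / sqrt z the claim is x^3 <= x^2 + x^4, split at x = 1. It trades the third
  moment for the second and the fourth, whose means over subsets and data are under control.\<close>

lemma abs_cube_le: 
  fixes y z :: real
  assumes "0 < z"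
  shows "\<bar>y\<bar> ^ 3 \<le> (sqrt z) ^ 3 * (y\<^sup>2 / z + y ^ 4 / z\<^sup>2)"
proof -
  define x where "x = \<bar>y\<bar> / sqrt z"
  have y: "\<bar>y\<bar> = x * sqrt z" and x: "0 \<le> x" using assms by (auto simp: x_def)
  have "x ^ 3 \<le> x\<^sup>2 + x ^ 4"
  proof (cases "x \<le> 1")
    case True
    then have "x ^ 3 \<le> x\<^sup>2" using x by (intro power_decreasing) auto
    then show ?thesis using zero_le_power[OF x, of 4] by linarith
  next
    case False
    then have "x ^ 3 \<le> x ^ 4" by (intro power_increasing) auto
    then show ?thesis using zero_le_power[OF x, of 2] by linarith
  qed
  moreover have "y\<^sup>2 / z = x\<^sup>2" using assms by (simp add: x_def power_divide)
  moreover have "y ^ 4 / z\<^sup>2 = x ^ 4"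
  proof -
    have "x ^ 4 = (x\<^sup>2)\<^sup>2" by simp
    also have "\<dots> = (y\<^sup>2 / z)\<^sup>2" using \<open>y\<^sup>2 / z = x\<^sup>2\<close> by simp
    finally show ?thesis by (simp add: power_divide)
  qed
  ultimately show ?thesis
    unfolding y power_mult_distrib using assms by (simp add: mult.commute mult_left_mono)
qed

text \<open>\<open>char_approx3'\<close> bounds the error by the mean of a minimum; here only the
  cubic half is kept, while \<open>hajek_lindeberg\<close> uses both halves.\<close>

lemma (in prob_space) iexp_approx_cubic:
  fixes X :: "'a \<Rightarrow> real"
  assumes [measurable]: "X \<in> borel_measurable M"
    and X: "integrable M X" "integrable M (\<lambda>x. (X x)\<^sup>2)" "integrable M (\<lambda>x. \<bar>X x\<bar> ^ 3)" "expectation X = 0"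
  shows "cmod ((\<integral>x. iexp (t * X x) \<partial>M) - (1 - t\<^sup>2 * expectation (\<lambda>x. (X x)\<^sup>2) / 2))
    \<le> \<bar>t\<bar> ^ 3 / 6 * expectation (\<lambda>x. \<bar>X x\<bar> ^ 3)"
proof -
  have "cmod (char (distr M borel X) t - (1 - t\<^sup>2 * expectation (\<lambda>x. (X x)\<^sup>2) / 2)) \<le>
    (t\<^sup>2 / 6) * expectation (\<lambda>x. min (6 * (X x)\<^sup>2) (\<bar>t\<bar> * \<bar>X x\<bar> ^ 3))"
    by (rule char_approx3'[OF assms(1) X(1,2,4) _ refl]) (simp add: X(4))
  also have "\<dots> \<le> (t\<^sup>2 / 6) * expectation (\<lambda>x. \<bar>t\<bar> * \<bar>X x\<bar> ^ 3)"
  proof (rule mult_left_mono)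
    have 6: "integrable M (\<lambda>x. 6 * (X x)\<^sup>2)" "integrable M (\<lambda>x. \<bar>t\<bar> * \<bar>X x\<bar> ^ 3)"
      by (rule integrable_mult_right[OF X(2)], rule integrable_mult_right[OF X(3)])
    show "expectation (\<lambda>x. min (6 * (X x)\<^sup>2) (\<bar>t\<bar> * \<bar>X x\<bar> ^ 3)) \<le> expectation (\<lambda>x. \<bar>t\<bar> * \<bar>X x\<bar> ^ 3)"
      by (rule integral_mono[OF Bochner_Integration.integrable_min[OF 6] 6(2)]) simp
  qed simp
  also have "\<dots> = \<bar>t\<bar> ^ 3 / 6 * expectation (\<lambda>x. \<bar>X x\<bar> ^ 3)"
  proof -
    have "\<bar>t\<bar> ^ 3 = t\<^sup>2 * \<bar>t\<bar>" by (simp add: power3_eq_cube power2_eq_square)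
    then show ?thesis by simp
  qed
  finally show ?thesis by (simp add: char_def integral_distr)
qed

lemma norm_integral_le:
  fixes f :: "'a \<Rightarrow> 'b::{banach,second_countable_topology}"
  assumes "integrable M f" "integrable M g" "\<And>x. norm (f x) \<le> g x"
  shows "norm (\<integral>x. f x \<partial>M) \<le> (\<integral>x. g x \<partial>M)"
  by (rule order_trans[OF integral_norm_bound integral_mono[OF integrable_norm]]) (use assms in auto)

section \<open>The incomplete statistic on the product of data and draws\<close>

locale incomplete = kernel D k h for D :: "'z measure" and k h +
  fixes N m :: nat
  assumes kN: "k \<le> N" and m_gt_0: "0 < m"
begin

sublocale uniform_draws "k_subsets N k" m
  by unfold_locales (auto simp: k_subsets_ne kN m_gt_0)

text \<open>The reference model: data and draws are independent factors, so conditioning on the data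
  is integration over \<open>MS\<close>. Any given sample is transported here by
  \<open>distr_sample\<close>.\<close>

definition Q :: "((nat \<Rightarrow> 'z) \<times> (nat \<Rightarrow> nat set)) measure" where "Q = MZ \<Otimes>\<^sub>M MS"

definition Uinc :: "(nat \<Rightarrow> 'z) \<Rightarrow> (nat \<Rightarrow> nat set) \<Rightarrow> real" where
  "Uinc z s = (1 / real m) * (\<Sum>j<m. H (s j) z)"

definition dev :: "nat set \<Rightarrow> (nat \<Rightarrow> 'z) \<Rightarrow> real" where "dev s z = H s z - Ufull N z"

abbreviation hajek_var :: real where "hajek_var \<equiv> (real k)\<^sup>2 / real N * zeta D k h 1"

sublocale QQ: pair_prob_space MZ MS ..

lemma N_pos: "0 < N" using k_pos kN by simp

lemma prob_space_Q: "prob_space Q"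
  unfolding Q_def by (rule QQ.prob_space_axioms)

sublocale Q: prob_space Q by (rule prob_space_Q)

lemma Ufull_eq_avg: "Ufull N z = avg (\<lambda>s. H s z)"
  by (simp add: Ufull_def avg_def card_k_subsets)

lemma avg_dev: "avg (\<lambda>s. dev s z) = 0"
  by (simp add: dev_def avg_diff avg_const Ufull_eq_avg)

lemma Uinc_eq: "Uinc z s = Ufull N z + (1 / real m) * (\<Sum>j<m. dev (s j) z)"
  using m_gt_0 by (simp add: Uinc_def dev_def sum_subtractf field_simps)

lemma H_draw_measurable [measurable]:
  assumes "j < m"
  shows "(\<lambda>p. H (snd p j) (fst p)) \<in> borel_measurable Q"
  unfolding Q_def
proof (rule measurable_compose_countable'[where f="\<lambda>i p. H i (fst p)" and g="\<lambda>p. snd p j" and I="k_subsets N k"])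
  show "(\<lambda>p. snd p j) \<in> measurable (MZ \<Otimes>\<^sub>M MS) (count_space (k_subsets N k))"
    by (rule measurable_compose[OF measurable_snd measurable_draw[OF assms]])
qed (auto intro: countable_finite)

lemma fst_measurable:
  assumes "f \<in> measurable MZ A"
  shows "(\<lambda>p. f (fst p)) \<in> measurable Q A"
  unfolding Q_def by (rule measurable_compose[OF measurable_fst assms])

lemma Uinc_measurable [measurable]: "(\<lambda>p. Uinc (fst p) (snd p)) \<in> borel_measurable Q"
  unfolding Uinc_def by (intro borel_measurable_times borel_measurable_const borel_measurable_sum H_draw_measurable) auto

lemma integrable_fst_Q:
  fixes F :: "_ \<Rightarrow> real"
  assumes "integrable MZ F"
  shows "integrable Q (\<lambda>p. F (fst p))" "(\<integral>p. F (fst p) \<partial>Q) = (\<integral>z. F z \<partial>MZ)"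
proof -
  have d: "distr Q MZ fst = MZ" unfolding Q_def by (rule MS.distr_pair_fst)
  have m: "fst \<in> measurable Q MZ" unfolding Q_def by simp
  show "integrable Q (\<lambda>p. F (fst p))"
    by (rule integrable_distr[OF m]) (simp add: d assms)
  show "(\<integral>p. F (fst p) \<partial>Q) = (\<integral>z. F z \<partial>MZ)"
    using integral_distr[OF m, of F] assms by (simp add: d)
qed

lemma H_in_K_sq: "s \<in> k_subsets N k \<Longrightarrow> integrable MZ (\<lambda>z. (H s z)\<^sup>2)"
  by (intro H_sq) (auto dest: k_subsetsD)

lemma H_draw_sq:
  assumes "j < m"
  shows "integrable Q (\<lambda>p. (H (snd p j) (fst p))\<^sup>2)"
proof (rule Bochner_Integration.integrable_bound)
  \<comment> \<open>A draw takes finitely many values, so the random evaluation is dominated by the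
    sum over all subsets.\<close>
  have "integrable MZ (\<lambda>z. \<Sum>t\<in>k_subsets N k. (H t z)\<^sup>2)"
    by (intro Bochner_Integration.integrable_sum H_in_K_sq)
  from integrable_fst_Q(1)[OF this]
  show "integrable Q (\<lambda>p. \<Sum>t\<in>k_subsets N k. (H t (fst p))\<^sup>2)" .
  show "AE p in Q. norm ((H (snd p j) (fst p))\<^sup>2) \<le> norm (\<Sum>t\<in>k_subsets N k. (H t (fst p))\<^sup>2)"
  proof (rule AE_I2)
    fix p assume "p \<in> space Q"
    then have "snd p j \<in> k_subsets N k"
      using MS_in_K assms by (auto simp: Q_def space_pair_measure)
    then have "(H (snd p j) (fst p))\<^sup>2 \<le> (\<Sum>t\<in>k_subsets N k. (H t (fst p))\<^sup>2)"
      by (intro member_le_sum) auto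
    then show "norm ((H (snd p j) (fst p))\<^sup>2) \<le> norm (\<Sum>t\<in>k_subsets N k. (H t (fst p))\<^sup>2)" by simp
  qed
qed (use assms in measurable)

lemma Uinc_sq: "integrable Q (\<lambda>p. (Uinc (fst p) (snd p))\<^sup>2)"
  unfolding Uinc_def power_mult_distrib
  by (intro integrable_mult_right integrable_square_sum H_draw_sq H_draw_measurable) auto

lemma Ufull_Q_measurable [measurable]: "(\<lambda>p. Ufull N (fst p)) \<in> borel_measurable Q"
  by (rule fst_measurable) simp

lemma Q_fubini:
  fixes f :: "_ \<Rightarrow> _ \<Rightarrow> 'c::{banach,second_countable_topology}"
  assumes "integrable Q (\<lambda>p. f (fst p) (snd p))"
  shows "(\<integral>p. f (fst p) (snd p) \<partial>Q) = (\<integral>z. (\<integral>s. f z s \<partial>MS) \<partial>MZ)"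
    "integrable MZ (\<lambda>z. (\<integral>s. f z s \<partial>MS))"
  using QQ.integral_fst'[OF assms[unfolded Q_def]] QQ.integrable_fst'[OF assms[unfolded Q_def]]
  by (simp_all add: Q_def)

lemma integral_avg:
  assumes g: "g \<in> borel_measurable borel" and int: "integrable (arg_law D k) (\<lambda>z. g (h z) :: real)"
  shows "(\<integral>z. avg (\<lambda>s. g (H s z)) \<partial>MZ) = (\<integral>z. g (h z) \<partial>arg_law D k)"
    and "integrable MZ (\<lambda>z. avg (\<lambda>s. g (H s z)))"
proof -
  have m: "(\<lambda>z. g (h z)) \<in> borel_measurable (arg_law D k)"
    by (rule measurable_compose[OF h_meas g])
  have 1: "integrable MZ (\<lambda>z. g (H s z))" "(\<integral>z. g (H s z) \<partial>MZ) = (\<integral>z. g (h z) \<partial>arg_law D k)"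
    if "s \<in> k_subsets N k" for s
    using integral_subtuple[OF m k_subsetsD(1,2)[OF that]] int by (simp_all add: H_def)
  show "integrable MZ (\<lambda>z. avg (\<lambda>s. g (H s z)))"
    unfolding avg_def by (intro Bochner_Integration.integrable_divide_zero Bochner_Integration.integrable_sum 1)
  have "(\<integral>z. avg (\<lambda>s. g (H s z)) \<partial>MZ) = (\<Sum>s\<in>k_subsets N k. \<integral>z. g (H s z) \<partial>MZ) / real (card (k_subsets N k))"
    unfolding avg_def by (simp add: 1(1))
  also have "\<dots> = (\<integral>z. g (h z) \<partial>arg_law D k)"
    using k_subsets_ne[OF kN] by (simp add: 1(2))
  finally show "(\<integral>z. avg (\<lambda>s. g (H s z)) \<partial>MZ) = (\<integral>z. g (h z) \<partial>arg_law D k)" .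
qed

lemma h_sq_mean: "(\<integral>z. (h z)\<^sup>2 \<partial>arg_law D k) = ov k"
proof -
  have "(\<integral>z. (h z)\<^sup>2 \<partial>arg_law D k) = (\<integral>z. H {..<k} z * H {..<k} z \<partial>MZ)"
    unfolding H_def by (subst integral_subtuple(1)[of "\<lambda>z. (h z)\<^sup>2" "{..<k}", symmetric]) (auto simp: power2_eq_square)
  then show ?thesis by (simp add: H_prod)
qed

lemma avg_dev_sq: "avg (\<lambda>s. (dev s z)\<^sup>2) = avg (\<lambda>s. (H s z)\<^sup>2) - (Ufull N z)\<^sup>2"
  unfolding dev_def Ufull_eq_avg by (rule avg_centred_square)

lemma avg_dev_sq_mean:
  "(\<integral>z. avg (\<lambda>s. (dev s z)\<^sup>2) \<partial>MZ) = zeta D k h k - vfull N"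
  "integrable MZ (\<lambda>z. avg (\<lambda>s. (dev s z)\<^sup>2))"
proof -
  have i: "integrable MZ (\<lambda>z. avg (\<lambda>s. (H s z)\<^sup>2))"
    using integral_avg(2)[of "\<lambda>x. x\<^sup>2"] h_sq by simp
  show "integrable MZ (\<lambda>z. avg (\<lambda>s. (dev s z)\<^sup>2))"
    unfolding avg_dev_sq by (intro Bochner_Integration.integrable_diff i Ufull_sq)
  have "(\<integral>z. avg (\<lambda>s. (H s z)\<^sup>2) \<partial>MZ) = ov k"
    using integral_avg(1)[of "\<lambda>x. x\<^sup>2"] h_sq h_sq_mean by simp
  then show "(\<integral>z. avg (\<lambda>s. (dev s z)\<^sup>2) \<partial>MZ) = zeta D k h k - vfull N"
    unfolding avg_dev_sq by (simp add: i Ufull_sq Ufull_sq_mean zeta_k_eq ov_0)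
qed

lemma Uinc_dev_inner: "(\<integral>s. (Uinc z s - Ufull N z)\<^sup>2 \<partial>MS) = avg (\<lambda>s. (dev s z)\<^sup>2) / real m"
proof -
  have "(\<integral>s. (Uinc z s - Ufull N z)\<^sup>2 \<partial>MS) = (\<integral>s. (1 / real m)\<^sup>2 * (\<Sum>j<m. dev (s j) z)\<^sup>2 \<partial>MS)"
    by (simp add: Uinc_eq power_mult_distrib power_divide)
  also have "\<dots> = (1 / real m)\<^sup>2 * (real m * avg (\<lambda>s. (dev s z)\<^sup>2))"
    using draws_square[of "\<lambda>s. dev s z"] by (simp add: avg_dev)
  finally show ?thesis using m_gt_0 by (simp add: power2_eq_square)
qed

lemma Uinc_dev_sq: "integrable Q (\<lambda>p. (Uinc (fst p) (snd p) - Ufull N (fst p))\<^sup>2)"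
  by (intro integrable_square_diff Uinc_sq integrable_fst_Q(1)[OF Ufull_sq]) measurable

lemma Uinc_dev_sq_mean:
  "(\<integral>p. (Uinc (fst p) (snd p) - Ufull N (fst p))\<^sup>2 \<partial>Q) = (zeta D k h k - vfull N) / real m"
  by (subst Q_fubini(1)[OF Uinc_dev_sq]) (simp add: Uinc_dev_inner avg_dev_sq_mean)

lemma Uinc_dev_inner_mean: "(\<integral>s. Uinc z s - Ufull N z \<partial>MS) = 0"
proof -
  have "(\<integral>s. Uinc z s - Ufull N z \<partial>MS) = (\<integral>s. (1 / real m) * (\<Sum>j<m. dev (s j) z) \<partial>MS)"
    by (simp add: Uinc_eq)
  also have "\<dots> = 0" using draws_mean[of "\<lambda>s. dev s z"] by (simp add: avg_dev)
  finally show ?thesis .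
qed

lemma Uinc_integrable: "integrable Q (\<lambda>p. Uinc (fst p) (snd p))"
  by (rule Q.square_integrable_imp_integrable[OF Uinc_measurable Uinc_sq])

lemma Uinc_mean: "(\<integral>p. Uinc (fst p) (snd p) \<partial>Q) = mu"
proof -
  have 1: "integrable Q (\<lambda>p. Uinc (fst p) (snd p) - Ufull N (fst p))"
    by (intro Bochner_Integration.integrable_diff Uinc_integrable integrable_fst_Q Ufull_integrable)
  have "(\<integral>p. Uinc (fst p) (snd p) - Ufull N (fst p) \<partial>Q) = 0"
    by (subst Q_fubini(1)[OF 1]) (simp add: Uinc_dev_inner_mean)
  then show ?thesis
    using Uinc_integrable integrable_fst_Q[OF Ufull_integrable[of N]] Ufull_mean[OF kN] by simp
qed

lemma Ufull_centred_sq: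
  "integrable MZ (\<lambda>z. (Ufull N z - mu)\<^sup>2)" "(\<integral>z. (Ufull N z - mu)\<^sup>2 \<partial>MZ) = vfull N"
proof -
  show "integrable MZ (\<lambda>z. (Ufull N z - mu)\<^sup>2)"
    by (intro integrable_square_diff Ufull_sq) auto
  show "(\<integral>z. (Ufull N z - mu)\<^sup>2 \<partial>MZ) = vfull N"
    using Ufull_integrable[of N] Ufull_sq[of N] Ufull_sq_mean[of N] Ufull_mean[OF kN]
    by (simp add: power2_diff MZ.prob_space ov_0) (simp add: power2_eq_square)
qed

text \<open>Given the data the resampling error has mean zero, so it is uncorrelated with the
  complete U-statistic and the two variances add.\<close>

lemma Uinc_variance:
  "(\<integral>p. (Uinc (fst p) (snd p) - mu)\<^sup>2 \<partial>Q) = vfull N + (zeta D k h k - vfull N) / real m"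
proof -
  let ?X = "\<lambda>p. Uinc (fst p) (snd p) - Ufull N (fst p)" and ?Y = "\<lambda>p. Ufull N (fst p) - mu"
  have Y: "integrable Q (\<lambda>p. (?Y p)\<^sup>2)" "(\<integral>p. (?Y p)\<^sup>2 \<partial>Q) = vfull N"
    using integrable_fst_Q[OF Ufull_centred_sq(1)] Ufull_centred_sq(2) by auto
  have XY: "integrable Q (\<lambda>p. ?X p * ?Y p)"
    by (intro integrable_mult_of_squares Uinc_dev_sq Y) measurable
  have "(\<integral>p. ?X p * ?Y p \<partial>Q) = (\<integral>z. (\<integral>s. (Uinc z s - Ufull N z) * (Ufull N z - mu) \<partial>MS) \<partial>MZ)"
    by (rule Q_fubini(1)[OF XY])
  also have "\<dots> = 0" by (simp add: Uinc_dev_inner_mean)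
  finally have XY0: "(\<integral>p. ?X p * ?Y p \<partial>Q) = 0" .
  have "(\<integral>p. (Uinc (fst p) (snd p) - mu)\<^sup>2 \<partial>Q) = (\<integral>p. (?X p)\<^sup>2 + 2 * (?X p * ?Y p) + (?Y p)\<^sup>2 \<partial>Q)"
    by (intro Bochner_Integration.integral_cong) (simp_all add: power2_eq_square algebra_simps)
  also have "\<dots> = (\<integral>p. (?X p)\<^sup>2 \<partial>Q) + 2 * (\<integral>p. ?X p * ?Y p \<partial>Q) + (\<integral>p. (?Y p)\<^sup>2 \<partial>Q)"
    using Uinc_dev_sq XY Y(1)
    by (simp only: Bochner_Integration.integral_add Bochner_Integration.integrable_add
        integral_mult_right_zero integrable_mult_right refl simp_thms)
  finally show ?thesis unfolding XY0 Y(2) Uinc_dev_sq_mean by simp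
qed

text \<open>The conditional characteristic function, given the data, of the resampling error over
  \<open>B\<close>.\<close>

definition chi :: "real \<Rightarrow> real \<Rightarrow> (nat \<Rightarrow> 'z) \<Rightarrow> complex" where
  "chi t B z = (\<integral>s. iexp (t * ((Uinc z s - Ufull N z) / B)) \<partial>MS)"

lemma iexp_Q_integrable:
  assumes [measurable]: "f \<in> borel_measurable Q"
  shows "integrable Q (\<lambda>p. iexp (f p))"
  by (rule Q.integrable_iexp) auto

lemma chi_integrable: "integrable MZ (chi t B)" "chi t B \<in> borel_measurable MZ"
proof -
  have "integrable Q (\<lambda>p. iexp (t * ((Uinc (fst p) (snd p) - Ufull N (fst p)) / B)))"
    by (intro iexp_Q_integrable) measurable
  from Q_fubini(2)[OF this] show "integrable MZ (chi t B)" by (simp add: chi_def[abs_def])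
  then show "chi t B \<in> borel_measurable MZ" by simp
qed

lemma norm_integral_iexp_diff_le:
  fixes f g :: "'c \<Rightarrow> real"
  assumes "prob_space M" and [measurable]: "f \<in> borel_measurable M" "g \<in> borel_measurable M"
    and sq: "integrable M (\<lambda>x. (f x - g x)\<^sup>2)"
  shows "cmod ((\<integral>x. iexp (f x) \<partial>M) - (\<integral>x. iexp (g x) \<partial>M)) \<le> sqrt (\<integral>x. (f x - g x)\<^sup>2 \<partial>M)"
proof -
  interpret M: prob_space M by fact
  have i: "integrable M (\<lambda>x. iexp (f x))" "integrable M (\<lambda>x. iexp (g x))"
    by (auto intro: M.integrable_iexp)
  have d: "integrable M (\<lambda>x. f x - g x)"
    by (rule M.square_integrable_imp_integrable[OF _ sq]) measurable
  have "cmod ((\<integral>x. iexp (f x) \<partial>M) - (\<integral>x. iexp (g x) \<partial>M)) = cmod (\<integral>x. iexp (f x) - iexp (g x) \<partial>M)"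
    by (simp only: Bochner_Integration.integral_diff[OF i])
  also have "\<dots> \<le> (\<integral>x. \<bar>f x - g x\<bar> \<partial>M)"
    by (rule norm_integral_le[OF Bochner_Integration.integrable_diff[OF i] integrable_abs[OF d]])
       (rule norm_iexp_diff_le)
  also have "\<dots> \<le> sqrt (\<integral>x. (f x - g x)\<^sup>2 \<partial>M)"
    by (intro M.expectation_abs_le_sqrt sq) measurable
  finally show ?thesis .
qed

text \<open>The constant \<gamma> is a deterministic stand-in for the random \<open>chi t B\<close>.
  Replacing the complete U-statistic by its projection costs an L2 distance; Fubini then leaves a
  projection factor times \<open>chi\<close>, and replacing \<open>chi\<close> by \<gamma> costs its
  mean distance. The characteristic functions thus multiply in the limit although projection and
  resampling error are dependent.\<close>

lemma char_decomposition:
  assumes B: "0 < B"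
  shows "cmod ((\<integral>p. iexp (t * ((Uinc (fst p) (snd p) - mu) / B)) \<partial>Q)
      - \<gamma> * (\<integral>z. iexp (t * (hajek N z / B)) \<partial>MZ))
    \<le> \<bar>t\<bar> / B * sqrt (vfull N - hajek_var) + (\<integral>z. cmod (chi t B z - \<gamma>) \<partial>MZ)"
proof -
  let ?f = "\<lambda>p. t * ((Uinc (fst p) (snd p) - mu) / B)"
  let ?g = "\<lambda>p. t * ((Uinc (fst p) (snd p) - Ufull N (fst p) + hajek N (fst p)) / B)"
  have [measurable]: "(\<lambda>p. hajek N (fst p)) \<in> borel_measurable Q"
    by (rule fst_measurable) simp
  have fg: "?f p - ?g p = (t / B) * (Ufull N (fst p) - mu - hajek N (fst p))" for p
    using B by (simp add: field_simps)
  have sq: "integrable Q (\<lambda>p. (?f p - ?g p)\<^sup>2)"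
    unfolding fg power_mult_distrib
    by (intro integrable_mult_right integrable_fst_Q hajek_error(2) kN)
  have "(\<integral>p. (?f p - ?g p)\<^sup>2 \<partial>Q) = (t / B)\<^sup>2 * (vfull N - hajek_var)"
    unfolding fg power_mult_distrib zeta_1_eq
    using integrable_fst_Q(2)[OF hajek_error(2)[OF kN]] hajek_error(1)[OF kN] by simp
  then have sqrt_eq: "sqrt (\<integral>p. (?f p - ?g p)\<^sup>2 \<partial>Q) =
      \<bar>t\<bar> / B * sqrt (vfull N - hajek_var)"
    using B by (simp add: real_sqrt_mult abs_divide)
  have 1: "cmod ((\<integral>p. iexp (?f p) \<partial>Q) - (\<integral>p. iexp (?g p) \<partial>Q))
      \<le> \<bar>t\<bar> / B * sqrt (vfull N - hajek_var)"
    unfolding sqrt_eq[symmetric]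
    by (rule norm_integral_iexp_diff_le[OF prob_space_Q _ _ sq]) measurable
  have g_eq: "iexp (?g p) = iexp (t * (hajek N (fst p) / B)) *
      iexp (t * ((Uinc (fst p) (snd p) - Ufull N (fst p)) / B))" for p
    by (simp add: exp_add[symmetric] field_simps add_divide_distrib diff_divide_distrib)
  have gi: "integrable Q (\<lambda>p. iexp (t * (hajek N (fst p) / B)) *
      iexp (t * ((Uinc (fst p) (snd p) - Ufull N (fst p)) / B)))"
    unfolding g_eq[symmetric] by (rule iexp_Q_integrable) measurable
  have hi: "integrable MZ (\<lambda>z. iexp (t * (hajek N z / B)))"
    by (rule MZ.integrable_iexp) auto
  have "(\<integral>p. iexp (?g p) \<partial>Q) = (\<integral>z. iexp (t * (hajek N z / B)) * chi t B z \<partial>MZ)"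
    unfolding g_eq by (subst Q_fubini(1)[OF gi]) (simp add: chi_def)
  moreover have ci: "integrable MZ (\<lambda>z. iexp (t * (hajek N z / B)) * chi t B z)"
    using Q_fubini(2)[OF gi] by (simp add: chi_def)
  ultimately have eq: "(\<integral>p. iexp (?g p) \<partial>Q) - \<gamma> * (\<integral>z. iexp (t * (hajek N z / B)) \<partial>MZ)
      = (\<integral>z. iexp (t * (hajek N z / B)) * chi t B z - \<gamma> * iexp (t * (hajek N z / B)) \<partial>MZ)"
    using hi by (simp only: Bochner_Integration.integral_diff integrable_mult_right integral_mult_right_zero)
  \<comment> \<open>The projection factor has modulus one and drops out of the error.\<close>
  have norm_eq: "cmod (iexp (t * (hajek N z / B)) * chi t B z - \<gamma> * iexp (t * (hajek N z / B))) = cmod (chi t B z - \<gamma>)" for z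
  proof -
    have "iexp (t * (hajek N z / B)) * chi t B z - \<gamma> * iexp (t * (hajek N z / B)) =
        iexp (t * (hajek N z / B)) * (chi t B z - \<gamma>)" by (simp add: algebra_simps)
    then show ?thesis by (simp only: norm_mult norm_exp_i_times mult_1_left)
  qed
  have "cmod ((\<integral>p. iexp (?g p) \<partial>Q) - \<gamma> * (\<integral>z. iexp (t * (hajek N z / B)) \<partial>MZ)) \<le> (\<integral>z. cmod (chi t B z - \<gamma>) \<partial>MZ)"
    unfolding eq norm_eq[symmetric] by (rule integral_norm_bound)
  then show ?thesis using 1 norm_triangle_ineq[of "(\<integral>p. iexp (?f p) \<partial>Q) - (\<integral>p. iexp (?g p) \<partial>Q)"
      "(\<integral>p. iexp (?g p) \<partial>Q) - \<gamma> * (\<integral>z. iexp (t * (hajek N z / B)) \<partial>MZ)"] by simp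
qed

text \<open>Serves the regime in which the resampling error is negligible: |exp (i u) - 1| <= |u|
  reduces the claim to a second moment.\<close>

lemma chi_near_1:
  assumes B: "0 < B"
  shows "(\<integral>z. cmod (chi t B z - 1) \<partial>MZ) \<le> \<bar>t\<bar> / B * sqrt (zeta D k h k / real m)"
proof -
  let ?f = "\<lambda>z s. t * ((Uinc z s - Ufull N z) / B)"
  have sq: "integrable Q (\<lambda>p. (?f (fst p) (snd p))\<^sup>2)"
    unfolding power_mult_distrib power_divide
    by (intro integrable_mult_right Bochner_Integration.integrable_divide_zero Uinc_dev_sq)
  have m: "(\<lambda>p. ?f (fst p) (snd p)) \<in> borel_measurable Q" by measurable
  have int: "integrable Q (\<lambda>p. ?f (fst p) (snd p))"
    by (rule Q.square_integrable_imp_integrable[OF m sq])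
  have abs_int: "integrable Q (\<lambda>p. \<bar>?f (fst p) (snd p)\<bar>)" using int by (rule integrable_abs)
  have "(\<integral>z. cmod (chi t B z - 1) \<partial>MZ) \<le> (\<integral>z. (\<integral>s. \<bar>?f z s\<bar> \<partial>MS) \<partial>MZ)"
  proof (rule integral_mono)
    show "integrable MZ (\<lambda>z. cmod (chi t B z - 1))"
      by (intro integrable_norm Bochner_Integration.integrable_diff chi_integrable) simp
    show "integrable MZ (\<lambda>z. \<integral>s. \<bar>?f z s\<bar> \<partial>MS)" by (rule Q_fubini(2)[OF abs_int])
    fix z
    have um: "(\<lambda>s. ?f z s) \<in> borel_measurable MS"
      unfolding Uinc_eq by (auto intro!: borel_measurable_sum measurable_on_draw)
    have fi: "integrable MS (\<lambda>s. ?f z s)"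
      unfolding Uinc_eq using draws_integrable[of "\<lambda>s. dev s z"] by simp
    have i: "integrable MS (\<lambda>s. iexp (?f z s))" by (rule MS.integrable_iexp[OF measurable_compose[OF um borel_measurable_of_real]]) simp
    have "chi t B z - 1 = (\<integral>s. iexp (?f z s) - 1 \<partial>MS)"
      unfolding chi_def using i by (simp add: MS.prob_space)
    also have "cmod \<dots> \<le> (\<integral>s. \<bar>?f z s\<bar> \<partial>MS)"
    proof (rule norm_integral_le)
      show "integrable MS (\<lambda>s. iexp (?f z s) - 1)" using i by simp
      show "integrable MS (\<lambda>s. \<bar>?f z s\<bar>)" using fi by (rule integrable_abs)
      show "cmod (iexp (?f z s) - 1) \<le> \<bar>?f z s\<bar>" for s
        using norm_iexp_diff_le[of "?f z s" 0] by simp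
    qed
    finally show "cmod (chi t B z - 1) \<le> (\<integral>s. \<bar>?f z s\<bar> \<partial>MS)" .
  qed
  also have "\<dots> = (\<integral>p. \<bar>?f (fst p) (snd p)\<bar> \<partial>Q)" by (rule Q_fubini(1)[OF abs_int, symmetric])
  also have "\<dots> \<le> sqrt (\<integral>p. (?f (fst p) (snd p))\<^sup>2 \<partial>Q)" by (rule Q.expectation_abs_le_sqrt[OF m sq])
  also have "(\<integral>p. (?f (fst p) (snd p))\<^sup>2 \<partial>Q) = (t / B)\<^sup>2 * ((zeta D k h k - vfull N) / real m)"
    unfolding Uinc_dev_sq_mean[symmetric] by (simp add: power_mult_distrib power_divide)
  also have "sqrt \<dots> = \<bar>t\<bar> / B * sqrt ((zeta D k h k - vfull N) / real m)"
    using B by (simp only: real_sqrt_mult real_sqrt_abs) (simp add: abs_divide)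
  also have "\<dots> \<le> \<bar>t\<bar> / B * sqrt (zeta D k h k / real m)"
  proof -
    have "0 \<le> vfull N"
      using vfull_bounds(3)[OF kN] vfull_bounds(1)[OF kN] by (meson mult_nonneg_nonneg order_trans divide_nonneg_nonneg of_nat_0_le_iff zero_le_power2)
    then show ?thesis using B
      by (intro mult_left_mono real_sqrt_le_mono divide_right_mono) auto
  qed
  finally show ?thesis .
qed

end

context kernel begin

text \<open>The centred square is again a symmetric square integrable kernel, so every variance
  bound proved for kernels applies to it.\<close>

lemma kernel_square:
  assumes "integrable (arg_law D k) (\<lambda>z. (h z) ^ 4)"
  shows "kernel D k (\<lambda>z. (h z - mu)\<^sup>2)"
    and "integrable (arg_law D k) (\<lambda>z. (h z - mu) ^ 4)"
proof -
  have sq: "integrable (arg_law D k) (\<lambda>z. ((h z)\<^sup>2)\<^sup>2)" using assms by simp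
  have hi: "integrable (arg_law D k) h"
    by (rule AL.square_integrable_imp_integrable[OF h_meas h_sq])
  have "integrable (arg_law D k) (\<lambda>z. ((h z)\<^sup>2 - (2 * mu * h z - mu\<^sup>2))\<^sup>2)"
  proof (rule integrable_square_diff)
    show "integrable (arg_law D k) (\<lambda>z. (2 * mu * h z - mu\<^sup>2)\<^sup>2)"
      by (rule integrable_square_diff) (auto simp: power_mult_distrib h_sq)
  qed (use sq in auto)
  moreover have eq: "(h z)\<^sup>2 - (2 * mu * h z - mu\<^sup>2) = (h z - mu)\<^sup>2" for z
    by (simp add: power2_eq_square algebra_simps)
  ultimately have 1: "integrable (arg_law D k) (\<lambda>z. ((h z - mu)\<^sup>2)\<^sup>2)" by simp
  then show "integrable (arg_law D k) (\<lambda>z. (h z - mu) ^ 4)" by simp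
  show "kernel D k (\<lambda>z. (h z - mu)\<^sup>2)"
    using D k_pos h_sym 1 by unfold_locales (auto simp: symmetric_kernel_def)
qed

end

context incomplete begin

lemma cmoment_2: "kernel_cmoment D k h 2 = zeta D k h k"
proof -
  have hi: "integrable (arg_law D k) h"
    by (rule AL.square_integrable_imp_integrable[OF h_meas h_sq])
  have m: "(\<integral>z. h z \<partial>arg_law D k) = mu" by (simp add: mu_def kernel_mean_def)
  have "kernel_cmoment D k h 2 = (\<integral>z. (h z)\<^sup>2 - 2 * mu * h z + mu\<^sup>2 \<partial>arg_law D k)"
    unfolding kernel_cmoment_def mu_def[symmetric]
    by (intro Bochner_Integration.integral_cong) (simp_all add: power2_eq_square algebra_simps)
  also have "\<dots> = ov k - mu\<^sup>2"
    using hi h_sq by (simp add: h_sq_mean m AL.prob_space) (simp add: power2_eq_square)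
  finally show ?thesis by (simp add: zeta_k_eq)
qed

text \<open>The average is the complete U-statistic of the kernel \<open>(h z - mu)\<^sup>2\<close>,
  with mean \<open>zeta D k h k\<close>. Its variance is at most k / N times the variance of a
  single evaluation, and the latter is at most the fourth central moment of
  \<open>h\<close>.\<close>

lemma avg_square_concentration:
  assumes h4: "integrable (arg_law D k) (\<lambda>z. (h z) ^ 4)"
  shows "integrable MZ (\<lambda>z. \<bar>avg (\<lambda>s. (H s z - mu)\<^sup>2) - zeta D k h k\<bar>)"
    and "(\<integral>z. \<bar>avg (\<lambda>s. (H s z - mu)\<^sup>2) - zeta D k h k\<bar> \<partial>MZ)
      \<le> sqrt (real k / real N * kernel_cmoment D k h 4)"
proof -
  let ?g = "\<lambda>z. (h z - mu)\<^sup>2"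
  interpret G: incomplete D k ?g N m
    using kernel_square(1)[OF h4] kN m_gt_0 by (simp add: incomplete_def incomplete_axioms_def)
  have U: "G.Ufull N z = avg (\<lambda>s. (H s z - mu)\<^sup>2)" for z
    by (simp add: G.Ufull_eq_avg G.H_def H_def)
  have mu: "G.mu = zeta D k h k"
    unfolding G.mu_def using cmoment_2 by (simp add: kernel_mean_def kernel_cmoment_def mu_def)
  have sq: "integrable MZ (\<lambda>z. (avg (\<lambda>s. (H s z - mu)\<^sup>2) - zeta D k h k)\<^sup>2)"
    using G.Ufull_centred_sq(1) by (simp add: U mu)
  have m: "(\<lambda>z. avg (\<lambda>s. (H s z - mu)\<^sup>2) - zeta D k h k) \<in> borel_measurable MZ"
    unfolding avg_def by measurable
  show "integrable MZ (\<lambda>z. \<bar>avg (\<lambda>s. (H s z - mu)\<^sup>2) - zeta D k h k\<bar>)"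
    by (intro integrable_abs MZ.square_integrable_imp_integrable[OF m sq])
  have "(\<integral>z. \<bar>avg (\<lambda>s. (H s z - mu)\<^sup>2) - zeta D k h k\<bar> \<partial>MZ)
     \<le> sqrt (\<integral>z. (avg (\<lambda>s. (H s z - mu)\<^sup>2) - zeta D k h k)\<^sup>2 \<partial>MZ)"
    by (rule MZ.expectation_abs_le_sqrt[OF m sq])
  also have "(\<integral>z. (avg (\<lambda>s. (H s z - mu)\<^sup>2) - zeta D k h k)\<^sup>2 \<partial>MZ) = G.vfull N"
    using G.Ufull_centred_sq(2) by (simp add: U mu)
  also have "sqrt \<dots> \<le> sqrt (real k / real N * kernel_cmoment D k h 4)"
  proof (rule real_sqrt_le_mono)
    have "G.vfull N \<le> real k / real N * zeta D k ?g k" by (rule G.vfull_bounds(4)[OF kN])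
    also have "zeta D k ?g k \<le> G.ov k" by (simp add: G.zeta_k_eq)
    also have "G.ov k = kernel_cmoment D k h 4"
      unfolding G.h_sq_mean[symmetric] by (simp add: kernel_cmoment_def mu_def)
    finally show "G.vfull N \<le> real k / real N * kernel_cmoment D k h 4"
      by (simp add: mult_left_mono divide_right_mono)
  qed
  finally show "(\<integral>z. \<bar>avg (\<lambda>s. (H s z - mu)\<^sup>2) - zeta D k h k\<bar> \<partial>MZ)
      \<le> sqrt (real k / real N * kernel_cmoment D k h 4)" .
qed

lemma dev_eq: "dev s z = (H s z - mu) - avg (\<lambda>s. H s z - mu)"
  by (simp add: dev_def Ufull_eq_avg avg_diff avg_const)

text \<open>Squaring (a - b)^2 <= 2 a^2 + 2 b^2 gives the factor 8 for each of a and b; the fourth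
  power of an average is at most the average of fourth powers, hence 8 + 8.\<close>

lemma avg_dev_fourth_le: "avg (\<lambda>s. (dev s z) ^ 4) \<le> 16 * avg (\<lambda>s. (H s z - mu) ^ 4)"
proof -
  have four: "(a - b) ^ 4 \<le> 8 * a ^ 4 + 8 * b ^ 4" for a b :: real
  proof -
    have "(a - b)\<^sup>2 \<le> 2 * a\<^sup>2 + 2 * b\<^sup>2"
      using sum_squares_bound[of a "- b"] by (simp add: power2_diff)
    then have "((a - b)\<^sup>2)\<^sup>2 \<le> (2 * a\<^sup>2 + 2 * b\<^sup>2)\<^sup>2" by (intro power_mono) auto
    also have "\<dots> \<le> 8 * (a\<^sup>2)\<^sup>2 + 8 * (b\<^sup>2)\<^sup>2"
      using sum_squares_bound[of "a\<^sup>2" "b\<^sup>2"] by (simp add: power2_sum power_mult_distrib)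
    finally show ?thesis by simp
  qed
  let ?y = "\<lambda>s. H s z - mu"
  have "avg (\<lambda>s. (dev s z) ^ 4) \<le> avg (\<lambda>s. 8 * (?y s) ^ 4 + 8 * (avg ?y) ^ 4)"
    unfolding dev_eq by (intro avg_mono four)
  also have "\<dots> = 8 * avg (\<lambda>s. (?y s) ^ 4) + 8 * (avg ?y) ^ 4"
    by (simp only: avg_add avg_cmult avg_const)
  also have "\<dots> \<le> 16 * avg (\<lambda>s. (?y s) ^ 4)"
    using avg_fourth_le[of ?y] by simp
  finally show ?thesis .
qed

text \<open>Given the data, \<open>chi\<close> is the m-th power of the characteristic function of
  one draw. That function and 1 - t^2 b / (2 m) both lie in the unit disc, so their m-th powers
  differ by at most m times their distance. Two errors enter: the third-order remainder, of order 1
  / sqrt m after multiplication by m, and the distance of the conditional variance from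
  \<open>zeta D k h k\<close>, small in mean when k / N is.\<close>

lemma chi_near_power:
  assumes B: "0 < B" and h4: "integrable (arg_law D k) (\<lambda>z. (h z) ^ 4)"
    and z_pos: "0 < zeta D k h k" and kap: "kernel_cmoment D k h 4 \<le> \<kappa> * (zeta D k h k)\<^sup>2"
  defines "b \<equiv> zeta D k h k / (real m * B\<^sup>2)"
  assumes small: "t\<^sup>2 * b / (2 * real m) \<le> 2"
  shows "(\<integral>z. cmod (chi t B z - of_real ((1 - t\<^sup>2 * b / (2 * real m)) ^ m)) \<partial>MZ)
    \<le> (\<bar>t\<bar> * sqrt b) ^ 3 * (1 + 16 * \<kappa>) / (6 * sqrt (real m))
      + t\<^sup>2 * b / 2 * (sqrt (\<kappa> * (real k / real N)) + real k / real N)"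
proof -
  define Zt where "Zt = zeta D k h k"
  define q4 where "q4 = kernel_cmoment D k h 4"
  \<comment> \<open>The coefficient of a single deviation: t / B together with the 1 / m of the
    average.\<close>
  define th where "th = t / (real m * B)"
  have Zt: "0 < Zt" using z_pos by (simp add: Zt_def)
  have m0: "0 < real m" using m_gt_0 by simp
  have thZ: "th\<^sup>2 * Zt = t\<^sup>2 * b / real m"
    using B m0 by (simp add: th_def b_def Zt_def field_simps power2_eq_square)
  have b0: "0 \<le> b" using z_pos by (simp add: b_def)
  \<comment> \<open>The cubic remainder of one draw with standard deviation \<open>sqrt Zt\<close>,
    times m. As th sqrt Zt is of order 1 / sqrt m, one factor sqrt m survives in the
    denominator.\<close>
  define C3 where "C3 = real m * (\<bar>th\<bar> ^ 3 / 6 * (sqrt Zt) ^ 3)"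
  have C3: "C3 = (\<bar>t\<bar> * sqrt b) ^ 3 / (6 * sqrt (real m))"
  proof -
    have "\<bar>th\<bar> * sqrt Zt = \<bar>t\<bar> * sqrt b / sqrt (real m)"
    proof -
      have "\<bar>th\<bar> * sqrt Zt = sqrt (th\<^sup>2 * Zt)" by (simp add: real_sqrt_mult)
      also have "\<dots> = \<bar>t\<bar> * sqrt b / sqrt (real m)"
        unfolding thZ by (simp add: real_sqrt_mult real_sqrt_divide)
      finally show ?thesis .
    qed
    then have "(\<bar>th\<bar> * sqrt Zt) ^ 3 = (\<bar>t\<bar> * sqrt b) ^ 3 / (sqrt (real m)) ^ 3"
      by (simp add: power_divide)
    moreover have "(sqrt (real m)) ^ 3 = real m * sqrt (real m)"
      using m0 by (simp add: power3_eq_cube)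
    moreover have "C3 = real m * ((\<bar>th\<bar> * sqrt Zt) ^ 3) / 6" by (simp add: C3_def power_mult_distrib)
    ultimately show ?thesis using m0 by simp
  qed
  let ?d2 = "\<lambda>z. avg (\<lambda>s. (dev s z)\<^sup>2)" and ?y4 = "\<lambda>z. avg (\<lambda>s. (H s z - mu) ^ 4)"
    and ?y2 = "\<lambda>z. avg (\<lambda>s. (H s z - mu)\<^sup>2)" and ?R = "\<lambda>z. Ufull N z - mu"
  \<comment> \<open>A linear combination of functions of the data whose integrals are known or
    estimated above.\<close>
  define bound where "bound z = C3 * (?d2 z / Zt + 16 * ?y4 z / Zt\<^sup>2)
      + real m * (th\<^sup>2 / 2) * (\<bar>?y2 z - Zt\<bar> + (?R z)\<^sup>2)" for z
  have pointwise: "cmod (chi t B z - of_real ((1 - t\<^sup>2 * b / (2 * real m)) ^ m)) \<le> bound z" for z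
  proof -
    define psi where "psi = (\<integral>s. iexp (th * dev s z) \<partial>UC)"
    have "t * ((Uinc z s - Ufull N z) / B) = (\<Sum>j<m. th * dev (s j) z)" for s
      unfolding Uinc_eq by (simp add: th_def sum_distrib_left sum_divide_distrib)
    then have "chi t B z = (\<integral>s. iexp (\<Sum>j<m. th * dev (s j) z) \<partial>MS)"
      by (simp only: chi_def)
    then have chi: "chi t B z = psi ^ m" using draws_iexp[of "\<lambda>s. th * dev s z"] by (simp only: psi_def)
    define w where "w = 1 - th\<^sup>2 * Zt / 2"
    have w: "1 - t\<^sup>2 * b / (2 * real m) = w" by (simp add: w_def thZ)
    have um: "f \<in> borel_measurable UC" for f :: "nat set \<Rightarrow> real" by (simp add: measurable_UC)
    have "cmod psi \<le> (\<integral>s. 1 \<partial>UC)"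
      unfolding psi_def by (intro norm_integral_le UC_integrable) simp
    then have psi1: "cmod psi \<le> 1" by (simp add: UC.prob_space)
    have w1: "cmod (of_real w) \<le> 1"
      using small Zt mult_nonneg_nonneg[of "t\<^sup>2" b] b0 m0 unfolding w[symmetric]
      by (simp only: norm_of_real) (simp add: abs_le_iff)
    have "cmod (psi - (1 - th\<^sup>2 * UC.expectation (\<lambda>s. (dev s z)\<^sup>2) / 2)) \<le> \<bar>th\<bar> ^ 3 / 6 * UC.expectation (\<lambda>s. \<bar>dev s z\<bar> ^ 3)"
      unfolding psi_def
      by (rule UC.iexp_approx_cubic) (simp_all add: um UC_integrable UC_integral avg_dev)
    then have p1: "cmod (psi - of_real (1 - th\<^sup>2 * ?d2 z / 2)) \<le> \<bar>th\<bar> ^ 3 / 6 * avg (\<lambda>s. \<bar>dev s z\<bar> ^ 3)"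
      by (simp add: UC_integral)
    have "cmod (of_real (1 - th\<^sup>2 * ?d2 z / 2) - of_real w) = \<bar>(1 - th\<^sup>2 * ?d2 z / 2) - w\<bar>"
      by (simp only: of_real_diff[symmetric] norm_of_real)
    also have "\<dots> = th\<^sup>2 / 2 * \<bar>?d2 z - Zt\<bar>"
    proof -
      have "(1 - th\<^sup>2 * ?d2 z / 2) - w = - (th\<^sup>2 / 2 * (?d2 z - Zt))"
        by (simp add: w_def field_simps)
      then show ?thesis by (simp only: abs_minus abs_mult) simp
    qed
    finally have p2: "cmod (of_real (1 - th\<^sup>2 * ?d2 z / 2) - of_real w) = th\<^sup>2 / 2 * \<bar>?d2 z - Zt\<bar>" .
    have p12: "cmod (psi - of_real w) \<le> \<bar>th\<bar> ^ 3 / 6 * avg (\<lambda>s. \<bar>dev s z\<bar> ^ 3) + th\<^sup>2 / 2 * \<bar>?d2 z - Zt\<bar>"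
      using norm_triangle_ineq[of "psi - of_real (1 - th\<^sup>2 * ?d2 z / 2)" "of_real (1 - th\<^sup>2 * ?d2 z / 2) - of_real w"] p1 p2
      by simp
    have "avg (\<lambda>s. \<bar>dev s z\<bar> ^ 3) \<le> avg (\<lambda>s. (sqrt Zt) ^ 3 * ((dev s z)\<^sup>2 / Zt + (dev s z) ^ 4 / Zt\<^sup>2))"
      by (intro avg_mono abs_cube_le Zt)
    also have "\<dots> = (sqrt Zt) ^ 3 * (?d2 z / Zt + avg (\<lambda>s. (dev s z) ^ 4) / Zt\<^sup>2)"
      by (simp only: divide_inverse mult.commute[of _ "inverse _"] avg_cmult avg_add)
    also have "\<dots> \<le> (sqrt Zt) ^ 3 * (?d2 z / Zt + 16 * ?y4 z / Zt\<^sup>2)"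
      using avg_dev_fourth_le[of z] Zt by (intro mult_left_mono add_left_mono divide_right_mono) auto
    finally have p3: "avg (\<lambda>s. \<bar>dev s z\<bar> ^ 3) \<le> (sqrt Zt) ^ 3 * (?d2 z / Zt + 16 * ?y4 z / Zt\<^sup>2)" .
    \<comment> \<open>The conditional variance is the mean square about \<open>mu\<close> minus a
      squared bias; the first part concentrates, the second has mean \<open>vfull N\<close>.\<close>
    have "?d2 z = ?y2 z - (avg (\<lambda>s. H s z - mu))\<^sup>2"
      unfolding dev_eq by (rule avg_centred_square)
    also have "avg (\<lambda>s. H s z - mu) = ?R z" by (simp add: avg_diff avg_const Ufull_eq_avg)
    finally have d2: "?d2 z = ?y2 z - (?R z)\<^sup>2" .
    have p4: "\<bar>?d2 z - Zt\<bar> \<le> \<bar>?y2 z - Zt\<bar> + (?R z)\<^sup>2"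
      unfolding d2 using zero_le_power2[of "?R z"] by linarith
    have "cmod (chi t B z - of_real ((1 - t\<^sup>2 * b / (2 * real m)) ^ m)) = cmod (psi ^ m - (of_real w) ^ m)"
      unfolding w chi by simp
    also have "\<dots> \<le> real m * cmod (psi - of_real w)" by (rule norm_power_diff[OF psi1 w1])
    also have "\<dots> \<le> real m * (\<bar>th\<bar> ^ 3 / 6 * ((sqrt Zt) ^ 3 * (?d2 z / Zt + 16 * ?y4 z / Zt\<^sup>2))
        + th\<^sup>2 / 2 * (\<bar>?y2 z - Zt\<bar> + (?R z)\<^sup>2))"
      by (intro mult_left_mono order_trans[OF p12] add_mono p3 p4) auto
    also have "\<dots> = bound z" by (simp add: bound_def C3_def algebra_simps)
    finally show ?thesis .
  qed
  have i_d2: "integrable MZ ?d2" "(\<integral>z. ?d2 z \<partial>MZ) = Zt - vfull N"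
    using avg_dev_sq_mean by (auto simp: Zt_def)
  have i_y4: "integrable MZ ?y4" "(\<integral>z. ?y4 z \<partial>MZ) = q4"
    using integral_avg[of "\<lambda>x. (x - mu) ^ 4"] kernel_square(2)[OF h4]
    by (simp_all add: q4_def kernel_cmoment_def mu_def)
  have i_y2: "integrable MZ (\<lambda>z. \<bar>?y2 z - Zt\<bar>)" "(\<integral>z. \<bar>?y2 z - Zt\<bar> \<partial>MZ) \<le> sqrt (real k / real N * q4)"
    using avg_square_concentration[OF h4] by (auto simp: Zt_def q4_def)
  note i_R = Ufull_centred_sq
  have bi: "integrable MZ bound"
    unfolding bound_def[abs_def]
    by (intro Bochner_Integration.integrable_add integrable_mult_right Bochner_Integration.integrable_divide_zero i_d2 i_y4 i_y2 i_R)
  have "(\<integral>z. cmod (chi t B z - of_real ((1 - t\<^sup>2 * b / (2 * real m)) ^ m)) \<partial>MZ) \<le> (\<integral>z. bound z \<partial>MZ)"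
    by (intro integral_mono bi pointwise integrable_norm Bochner_Integration.integrable_diff chi_integrable) simp
  also have "\<dots> = C3 * ((Zt - vfull N) / Zt + 16 * q4 / Zt\<^sup>2)
      + real m * (th\<^sup>2 / 2) * ((\<integral>z. \<bar>?y2 z - Zt\<bar> \<partial>MZ) + vfull N)"
    unfolding bound_def using i_d2 i_y4 i_y2(1) i_R by simp
  also have "\<dots> \<le> C3 * (1 + 16 * \<kappa>) + real m * (th\<^sup>2 / 2) * (Zt * sqrt (\<kappa> * (real k / real N)) + real k / real N * Zt)"
  proof (intro add_mono mult_left_mono)
    have v0: "0 \<le> vfull N" unfolding i_R(2)[symmetric] by simp
    show "(Zt - vfull N) / Zt \<le> 1" using v0 Zt by (simp add: field_simps)
    show "16 * q4 / Zt\<^sup>2 \<le> 16 * \<kappa>" using kap Zt by (simp add: q4_def Zt_def field_simps)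
    show "0 \<le> C3" using Zt by (simp add: C3_def)
    show "vfull N \<le> real k / real N * Zt" unfolding Zt_def by (rule vfull_bounds(4)[OF kN])
    have "sqrt (real k / real N * q4) \<le> sqrt (Zt\<^sup>2 * (\<kappa> * (real k / real N)))"
    proof (rule real_sqrt_le_mono)
      have "real k / real N * q4 \<le> real k / real N * (\<kappa> * Zt\<^sup>2)"
        using kap by (intro mult_left_mono) (auto simp: q4_def Zt_def)
      then show "real k / real N * q4 \<le> Zt\<^sup>2 * (\<kappa> * (real k / real N))" by (simp add: mult_ac)
    qed
    also have "\<dots> = Zt * sqrt (\<kappa> * (real k / real N))"
      using Zt by (simp only: real_sqrt_mult real_sqrt_abs)
    finally show "(\<integral>z. \<bar>?y2 z - Zt\<bar> \<partial>MZ) \<le> Zt * sqrt (\<kappa> * (real k / real N))" using i_y2(2) by simp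
  qed simp
  also have "\<dots> = (\<bar>t\<bar> * sqrt b) ^ 3 * (1 + 16 * \<kappa>) / (6 * sqrt (real m))
      + real m * (th\<^sup>2 * Zt) / 2 * (sqrt (\<kappa> * (real k / real N)) + real k / real N)"
    by (simp add: C3 algebra_simps)
  also have "real m * (th\<^sup>2 * Zt) = t\<^sup>2 * b" using m0 by (simp add: thZ)
  finally show ?thesis .
qed

lemma hajek_char:
  assumes B: "0 < B"
  shows "(\<integral>z. iexp (t * (hajek N z / B)) \<partial>MZ) = (\<integral>x. iexp (t * real k / (real N * B) * phi x) \<partial>D) ^ N"
proof -
  let ?s = "t * real k / (real N * B)"
  have ind: "MZ.indep_vars (\<lambda>_. borel) (\<lambda>i z. phi (z i)) {..<N}"
    by (rule MZ.indep_vars_compose2[OF MZ.indep_vars_subset[OF indep_coords]]) auto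
  have "(\<integral>z. iexp (t * (hajek N z / B)) \<partial>MZ) = char (distr MZ borel (\<lambda>z. \<Sum>i<N. phi (z i))) ?s"
    by (simp add: char_def integral_distr hajek_def mult_ac)
  also have "\<dots> = (\<Prod>i<N. char (distr MZ borel (\<lambda>z. phi (z i))) ?s)"
    by (rule MZ.char_distr_sum[OF ind])
  also have "\<dots> = (\<Prod>i<N. \<integral>x. iexp (?s * phi x) \<partial>D)"
  proof (intro prod.cong refl)
    fix i
    have "char (distr MZ borel (\<lambda>z. phi (z i))) ?s = (\<integral>z. iexp (?s * phi (z i)) \<partial>MZ)"
      by (simp add: char_def integral_distr)
    also have "\<dots> = (\<integral>x. iexp (?s * phi x) \<partial>distr MZ D (\<lambda>z. z i))"
      by (subst integral_distr) auto
    finally show "char (distr MZ borel (\<lambda>z. phi (z i))) ?s = (\<integral>x. iexp (?s * phi x) \<partial>D)"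
      by (simp add: distr_coord)
  qed
  finally show ?thesis by simp
qed

text \<open>Serves the regime in which the projection is negligible at scale \<open>B\<close>, where
  its second moment settles the limit.\<close>

lemma hajek_near_1:
  assumes B: "0 < B"
  shows "cmod ((\<integral>z. iexp (t * (hajek N z / B)) \<partial>MZ) - 1) \<le> \<bar>t\<bar> / B * sqrt hajek_var"
proof -
  have sq: "integrable MZ (\<lambda>z. (t * (hajek N z / B) - 0)\<^sup>2)"
    using hajek_sq[of N] by (simp add: power_mult_distrib power_divide)
  have "(\<integral>z. (t * (hajek N z / B) - 0)\<^sup>2 \<partial>MZ) = (t / B)\<^sup>2 * (\<integral>z. (hajek N z)\<^sup>2 \<partial>MZ)"
    by (simp add: power_mult_distrib power_divide)
  also have "\<dots> = (t / B)\<^sup>2 * hajek_var"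
    unfolding hajek_sq_mean[OF N_pos] zeta_1_eq ..
  finally have eq: "(\<integral>z. (t * (hajek N z / B) - 0)\<^sup>2 \<partial>MZ) = (t / B)\<^sup>2 * hajek_var" .
  have "cmod ((\<integral>z. iexp (t * (hajek N z / B)) \<partial>MZ) - (\<integral>z. iexp 0 \<partial>MZ)) \<le>
     sqrt (\<integral>z. (t * (hajek N z / B) - 0)\<^sup>2 \<partial>MZ)"
    using norm_integral_iexp_diff_le[OF MZ.prob_space_axioms _ _ sq] by simp
  also have "\<dots> = \<bar>t\<bar> / B * sqrt hajek_var"
    unfolding eq using B by (simp only: real_sqrt_mult[of "(t / B)\<^sup>2"] real_sqrt_abs) (simp add: abs_divide)
  finally show ?thesis by (simp add: MZ.prob_space)
qed

text \<open>Lindeberg's truncation in nonasymptotic form. The scale \<open>B\<close> need not be the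
  standard deviation of the projection, hence the ratio p, which stays below 1 in the limit of the
  mixed regime. The bound \<open>small\<close> keeps the comparison factor in [-1, 1], so that N-th
  powers differ by at most N times the distance of the bases.\<close>

lemma hajek_lindeberg:
  assumes B: "0 < B" and z_pos: "0 < zeta D k h 1" and eps: "0 < \<epsilon>"
  defines "p \<equiv> hajek_var / B\<^sup>2"
    and "L \<equiv> (\<integral>x. (first_proj D k h x / sqrt (zeta D k h 1))\<^sup>2 *
       indicator {y. \<bar>first_proj D k h y / sqrt (zeta D k h 1)\<bar> > \<epsilon> * sqrt (real N)} x \<partial>D)"
  assumes small: "t\<^sup>2 * p / (2 * real N) \<le> 2"
  shows "cmod ((\<integral>z. iexp (t * (hajek N z / B)) \<partial>MZ) - of_real ((1 - t\<^sup>2 * p / (2 * real N)) ^ N))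
     \<le> t\<^sup>2 * p * (L + \<bar>t\<bar> * sqrt p * \<epsilon> / 6)"
proof -
  define Zt where "Zt = zeta D k h 1"
  define s where "s = t * real k / (real N * B)"
  have Zt: "0 < Zt" using z_pos by (simp add: Zt_def)
  have N0: "0 < real N" using N_pos by simp
  have sZ: "s\<^sup>2 * Zt = t\<^sup>2 * p / real N"
    using B N0 by (simp add: s_def p_def Zt_def field_simps power2_eq_square)
  have p0: "0 \<le> p" using z_pos by (simp add: p_def)
  define psi where "psi = (\<integral>x. iexp (s * phi x) \<partial>D)"
  define w where "w = 1 - s\<^sup>2 * Zt / 2"
  have w: "1 - t\<^sup>2 * p / (2 * real N) = w" by (simp add: w_def sZ)
  let ?A = "{y. \<bar>phi y / sqrt Zt\<bar> > \<epsilon> * sqrt (real N)}"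
  have L: "L = (\<integral>x. (phi x / sqrt Zt)\<^sup>2 * indicator ?A x \<partial>D)"
    by (simp add: L_def phi_def[abs_def] Zt_def)
  have var: "(\<integral>x. (phi x)\<^sup>2 \<partial>D) = Zt"
    using phi_sq by (simp only: Zt_def zeta_1_eq)
  have psi_char: "psi = char (distr D borel phi) s"
    by (simp add: psi_def char_def integral_distr)
  have psi1: "cmod psi \<le> 1"
  proof -
    have "cmod psi \<le> (\<integral>x. 1 \<partial>D)"
      unfolding psi_def by (intro norm_integral_le D.integrable_iexp) auto
    then show ?thesis by (simp add: D.prob_space)
  qed
  have w1: "cmod (of_real w) \<le> 1"
    using small mult_nonneg_nonneg[of "t\<^sup>2" p] p0 N0 unfolding w[symmetric]
    by (simp only: norm_of_real) (simp add: abs_le_iff)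
  have trunc_int: "integrable D (\<lambda>x. (phi x / sqrt Zt)\<^sup>2 * indicator ?A x)"
  proof (rule Bochner_Integration.integrable_bound)
    show "integrable D (\<lambda>x. (phi x)\<^sup>2 / Zt)" using phi_sq_integrable by simp
    show "(\<lambda>x. (phi x / sqrt Zt)\<^sup>2 * indicator ?A x) \<in> borel_measurable D" by measurable
    show "AE x in D. norm ((phi x / sqrt Zt)\<^sup>2 * indicator ?A x) \<le> norm ((phi x)\<^sup>2 / Zt)"
      using Zt by (auto simp: power_divide indicator_def)
  qed
  \<comment> \<open>Beyond the truncation level the quadratic half of the minimum is used; below it
    one factor \<open>\<bar>phi x\<bar>\<close> of the cube is at most
    \<open>\<epsilon> * sqrt (real N) * sqrt Zt\<close>.\<close>
  let ?bd = "\<lambda>x. 6 * Zt * ((phi x / sqrt Zt)\<^sup>2 * indicator ?A x) + (\<bar>s\<bar> * (\<epsilon> * sqrt (real N) * sqrt Zt)) * (phi x)\<^sup>2"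
  have bd_int: "integrable D ?bd"
    by (intro Bochner_Integration.integrable_add integrable_mult_right trunc_int phi_sq_integrable)
  have "cmod (psi - (1 - s\<^sup>2 * Zt / 2)) \<le> (s\<^sup>2 / 6) * (\<integral>x. min (6 * (phi x)\<^sup>2) (\<bar>s\<bar> * \<bar>phi x\<bar> ^ 3) \<partial>D)"
    unfolding psi_char
    by (rule D.char_approx3'[OF phi_measurable phi_integrable phi_sq_integrable phi_mean _ refl])
       (simp add: phi_mean var)
  also have "\<dots> \<le> (s\<^sup>2 / 6) * (\<integral>x. ?bd x \<partial>D)"
  proof (rule mult_left_mono)
    have "min (6 * (phi x)\<^sup>2) (\<bar>s\<bar> * \<bar>phi x\<bar> ^ 3) \<le> ?bd x" for x
    proof (cases "x \<in> ?A")
      case True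
      have "6 * Zt * (phi x / sqrt Zt)\<^sup>2 = 6 * (phi x)\<^sup>2" using Zt by (simp add: power_divide)
      moreover have "0 \<le> (\<bar>s\<bar> * (\<epsilon> * sqrt (real N) * sqrt Zt)) * (phi x)\<^sup>2"
        using eps Zt by (intro mult_nonneg_nonneg) auto
      ultimately show ?thesis using True by simp
    next
      case False
      then have "\<bar>phi x\<bar> \<le> \<epsilon> * sqrt (real N) * sqrt Zt"
        using Zt by (simp add: field_simps not_less)
      then have "\<bar>s\<bar> * (\<bar>phi x\<bar> * (phi x)\<^sup>2) \<le> \<bar>s\<bar> * ((\<epsilon> * sqrt (real N) * sqrt Zt) * (phi x)\<^sup>2)"
        by (intro mult_left_mono mult_right_mono) auto
      moreover have "\<bar>phi x\<bar> ^ 3 = \<bar>phi x\<bar> * (phi x)\<^sup>2" by (simp add: power3_eq_cube power2_eq_square)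
      ultimately show ?thesis using False by (simp add: mult_ac min_le_iff_disj)
    qed
    moreover have "integrable D (\<lambda>x. min (6 * (phi x)\<^sup>2) (\<bar>s\<bar> * \<bar>phi x\<bar> ^ 3))"
    proof (rule Bochner_Integration.integrable_bound)
      show "integrable D (\<lambda>x. 6 * (phi x)\<^sup>2)" using phi_sq_integrable by simp
      show "AE x in D. norm (min (6 * (phi x)\<^sup>2) (\<bar>s\<bar> * \<bar>phi x\<bar> ^ 3)) \<le> norm (6 * (phi x)\<^sup>2)"
        by (auto simp: min_def)
    qed measurable
    ultimately show "(\<integral>x. min (6 * (phi x)\<^sup>2) (\<bar>s\<bar> * \<bar>phi x\<bar> ^ 3) \<partial>D) \<le> (\<integral>x. ?bd x \<partial>D)"
      by (rule integral_mono[OF _ bd_int, rotated])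
  qed simp
  also have "(\<integral>x. ?bd x \<partial>D) = 6 * Zt * L + \<bar>s\<bar> * (\<epsilon> * sqrt (real N) * sqrt Zt) * Zt"
    using trunc_int phi_sq_integrable
    by (simp only: Bochner_Integration.integral_add integrable_mult_right integral_mult_right_zero L var)
  finally have psi_w: "cmod (psi - of_real w) \<le> (s\<^sup>2 / 6) * (6 * Zt * L + \<bar>s\<bar> * (\<epsilon> * sqrt (real N) * sqrt Zt) * Zt)"
    by (simp add: w_def)
  have abs_s: "\<bar>s\<bar> * (sqrt (real N) * sqrt Zt) = \<bar>t\<bar> * sqrt p"
  proof -
    have "\<bar>s\<bar> * (sqrt (real N) * sqrt Zt) = sqrt (real N * (s\<^sup>2 * Zt))"
      by (simp add: real_sqrt_mult)
    also have "\<dots> = \<bar>t\<bar> * sqrt p" unfolding sZ using N0 by (simp add: real_sqrt_mult)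
    finally show ?thesis .
  qed
  have "cmod ((\<integral>z. iexp (t * (hajek N z / B)) \<partial>MZ) - of_real ((1 - t\<^sup>2 * p / (2 * real N)) ^ N)) = cmod (psi ^ N - (of_real w) ^ N)"
    unfolding w hajek_char[OF B] psi_def s_def by simp
  also have "\<dots> \<le> real N * cmod (psi - of_real w)" by (rule norm_power_diff[OF psi1 w1])
  also have "\<dots> \<le> real N * ((s\<^sup>2 / 6) * (6 * Zt * L + \<bar>s\<bar> * (\<epsilon> * sqrt (real N) * sqrt Zt) * Zt))"
    by (intro mult_left_mono psi_w) simp
  also have "\<dots> = real N * (s\<^sup>2 * Zt) * (L + (\<bar>s\<bar> * (sqrt (real N) * sqrt Zt)) * \<epsilon> / 6)"
    by (simp add: algebra_simps)
  also have "\<dots> = t\<^sup>2 * p * (L + \<bar>t\<bar> * sqrt p * \<epsilon> / 6)"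
    unfolding abs_s sZ using N0 by simp
  finally show ?thesis .
qed

end

section \<open>Transport to a given probability space\<close>

locale incomplete_sample = incomplete D k h N m + P: prob_space P
  for D :: "'z measure" and k h N m and P :: "'w measure" +
  fixes Z :: "nat \<Rightarrow> 'w \<Rightarrow> 'z" and S :: "nat \<Rightarrow> 'w \<Rightarrow> nat set"
  assumes Z_indep: "P.indep_vars (\<lambda>_. D) Z UNIV"
    and Z_law: "\<And>i. distr P D (Z i) = D"
    and S_indep: "P.indep_vars (\<lambda>_. count_space (k_subsets N k)) S {..<m}"
    and S_law: "\<And>j. j < m \<Longrightarrow>
      distr P (count_space (k_subsets N k)) (S j) = uniform_count_measure (k_subsets N k)"
    and SZ_indep: "P.indep_set
        (sets (vimage_algebra (space P) (\<lambda>\<omega> i. Z i \<omega>) (Pi\<^sub>M UNIV (\<lambda>_. D))))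
        (sets (vimage_algebra (space P) (\<lambda>\<omega>. \<lambda>j\<in>{..<m}. S j \<omega>)
                (Pi\<^sub>M {..<m} (\<lambda>_. count_space (k_subsets N k)))))"
begin

definition sample :: "'w \<Rightarrow> (nat \<Rightarrow> 'z) \<times> (nat \<Rightarrow> nat set)" where
  "sample \<omega> = (\<lambda>i. Z i \<omega>, \<lambda>j\<in>{..<m}. S j \<omega>)"

text \<open>Independence of the data sequence and the draws makes their joint law a product, which
  is compared with the reference model on measurable rectangles.\<close>

lemma distr_sample: "distr P Q sample = Q" and sample_measurable: "sample \<in> measurable P Q"
proof -
  let ?K = "count_space (k_subsets N k)"
  let ?T = "Pi\<^sub>M {..<m} (\<lambda>_. ?K)"
  let ?Zs = "\<lambda>\<omega> i. Z i \<omega>" and ?Ss = "\<lambda>\<omega>. \<lambda>j\<in>{..<m}. S j \<omega>"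
  have Zm: "Z i \<in> measurable P D" for i
    using Z_indep by (simp add: P.indep_vars_def)
  have Sm: "S j \<in> measurable P ?K" if "j \<in> {..<m}" for j
    using S_indep that by (simp add: P.indep_vars_def)
  have Zsm: "?Zs \<in> measurable P MZ"
    using measurable_restrict[of UNIV Z P "\<lambda>_. D"] Zm by (simp add: MZ_def restrict_UNIV)
  have Ssm: "?Ss \<in> measurable P ?T" by (intro measurable_restrict Sm)
  have Zlaw: "distr P MZ ?Zs = MZ"
    using P.indep_vars_iff_distr_eq_PiM'[of UNIV Z "\<lambda>_. D"] Z_indep Zm
    by (simp add: Z_law MZ_def restrict_UNIV)
  have "distr P ?T ?Ss = Pi\<^sub>M {..<m} (\<lambda>j. distr P ?K (S j))"
    using P.indep_vars_iff_distr_eq_PiM'[of "{..<m}" S "\<lambda>_. ?K"] S_indep Sm m_gt_0 by auto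
  also have "\<dots> = MS" unfolding MS_def UC_def by (intro PiM_cong) (auto simp: S_law)
  finally have Slaw: "distr P ?T ?Ss = MS" .
  \<comment> \<open>The factors of \<open>MS\<close> are uniform counting measures, while the draws
    map into \<open>count_space\<close>; both carry the same sigma-algebra.\<close>
  have sets_T: "sets MS = sets ?T"
    unfolding MS_def by (intro sets_PiM_cong refl sets_UC)
  have sets_eq: "sets Q = sets (MZ \<Otimes>\<^sub>M ?T)"
    unfolding Q_def by (intro sets_pair_measure_cong refl sets_T)
  have pm: "(\<lambda>\<omega>. (?Zs \<omega>, ?Ss \<omega>)) \<in> measurable P (MZ \<Otimes>\<^sub>M ?T)" using Zsm Ssm by measurable
  have eq: "MZ \<Otimes>\<^sub>M MS = distr P (MZ \<Otimes>\<^sub>M ?T) (\<lambda>\<omega>. (?Zs \<omega>, ?Ss \<omega>))"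
  proof (rule pair_measure_eqI)
    show "sigma_finite_measure MZ" "sigma_finite_measure MS" by unfold_locales
    show "sets (MZ \<Otimes>\<^sub>M MS) = sets (distr P (MZ \<Otimes>\<^sub>M ?T) (\<lambda>\<omega>. (?Zs \<omega>, ?Ss \<omega>)))"
      using sets_eq by (simp add: Q_def)
    fix A B assume A: "A \<in> sets MZ" and B: "B \<in> sets MS"
    then have B': "B \<in> sets ?T" by (simp add: sets_T)
    have "emeasure (distr P (MZ \<Otimes>\<^sub>M ?T) (\<lambda>\<omega>. (?Zs \<omega>, ?Ss \<omega>))) (A \<times> B) =
        emeasure P ((?Zs -` A \<inter> space P) \<inter> (?Ss -` B \<inter> space P))"
      using A B' by (subst emeasure_distr[OF pm]) (auto intro!: arg_cong2[where f=emeasure])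
    also have "\<dots> = ennreal (P.prob (?Zs -` A \<inter> space P) * P.prob (?Ss -` B \<inter> space P))"
      using A B' unfolding P.emeasure_eq_measure MZ_def
      by (intro arg_cong[where f=ennreal] P.indep_setD[OF SZ_indep] in_vimage_algebra)
    also have "\<dots> = emeasure P (?Zs -` A \<inter> space P) * emeasure P (?Ss -` B \<inter> space P)"
      by (simp add: P.emeasure_eq_measure ennreal_mult)
    also have "\<dots> = emeasure MZ A * emeasure MS B"
      using emeasure_distr[OF Zsm A] emeasure_distr[OF Ssm B'] by (simp add: Zlaw Slaw)
    finally show "emeasure MZ A * emeasure MS B =
      emeasure (distr P (MZ \<Otimes>\<^sub>M ?T) (\<lambda>\<omega>. (?Zs \<omega>, ?Ss \<omega>))) (A \<times> B)" by simp
  qed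
  have "distr P Q sample = distr P (MZ \<Otimes>\<^sub>M ?T) (\<lambda>\<omega>. (?Zs \<omega>, ?Ss \<omega>))"
    by (intro distr_cong refl sets_eq) (simp add: sample_def)
  then show "distr P Q sample = Q" using eq by (simp add: Q_def)
  show "sample \<in> measurable P Q"
    unfolding measurable_cong_sets[OF refl sets_eq] sample_def[abs_def] by (rule pm)
qed

definition UP :: "'w \<Rightarrow> real" where "UP = incomplete_U k m h Z S"

lemma UP_eq: "UP \<omega> = Uinc (fst (sample \<omega>)) (snd (sample \<omega>))"
  by (simp add: UP_def incomplete_U_def Uinc_def sample_def H_def)

lemma UP_measurable [measurable]: "UP \<in> borel_measurable P"
  unfolding UP_eq[abs_def] by (rule measurable_compose[OF sample_measurable Uinc_measurable])

lemma integral_sample: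
  fixes f :: "_ \<Rightarrow> 'c::{banach,second_countable_topology}"
  assumes "f \<in> borel_measurable Q"
  shows "(\<integral>\<omega>. f (sample \<omega>) \<partial>P) = (\<integral>p. f p \<partial>Q)"
  using integral_distr[OF sample_measurable assms] by (simp add: distr_sample)

lemma UP_variance: "P.variance UP = vfull N + (zeta D k h k - vfull N) / real m"
proof -
  have mean: "P.expectation UP = mu"
    using integral_sample[OF Uinc_measurable] by (simp add: UP_eq[abs_def] Uinc_mean)
  have "P.variance UP = (\<integral>\<omega>. (Uinc (fst (sample \<omega>)) (snd (sample \<omega>)) - mu)\<^sup>2 \<partial>P)"
    unfolding mean by (simp add: UP_eq)
  also have "\<dots> = (\<integral>p. (Uinc (fst p) (snd p) - mu)\<^sup>2 \<partial>Q)"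
    by (rule integral_sample) measurable
  finally show ?thesis by (simp add: Uinc_variance)
qed

definition cf :: "real \<Rightarrow> real \<Rightarrow> complex" where
  "cf B t = char (distr P borel (\<lambda>\<omega>. (UP \<omega> - mu) / B)) t"

lemma cf_eq: "cf B t = (\<integral>p. iexp (t * ((Uinc (fst p) (snd p) - mu) / B)) \<partial>Q)"
proof -
  have "cf B t = (\<integral>\<omega>. iexp (t * ((UP \<omega> - mu) / B)) \<partial>P)"
    by (simp add: cf_def char_def integral_distr)
  also have "\<dots> = (\<integral>\<omega>. (\<lambda>p. iexp (t * ((Uinc (fst p) (snd p) - mu) / B))) (sample \<omega>) \<partial>P)"
    by (simp add: UP_eq)
  also have "\<dots> = (\<integral>p. iexp (t * ((Uinc (fst p) (snd p) - mu) / B)) \<partial>Q)"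
    by (rule integral_sample) measurable
  finally show ?thesis .
qed

end

subsection \<open>Limits\<close>

text \<open>Taking logarithms, |ln (1 - y) + y| <= 2 y^2 for small y. The exponent is a general
  sequence because it is N for the projection and \<open>m N\<close> for the draws.\<close>

lemma tendsto_one_minus_power:
  fixes x :: "nat \<Rightarrow> real" and r :: "nat \<Rightarrow> nat"
  assumes x: "x \<longlonglongrightarrow> l" and r: "filterlim r at_top sequentially"
  shows "(\<lambda>n. (1 - x n / real (r n)) ^ r n) \<longlonglongrightarrow> exp (- l)"
proof -
  have r': "filterlim (\<lambda>n. real (r n)) at_top sequentially"
    by (rule filterlim_compose[OF filterlim_real_sequentially r])
  have y: "(\<lambda>n. x n / real (r n)) \<longlonglongrightarrow> 0"
    by (rule real_tendsto_divide_at_top[OF x r'])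
  have small: "\<forall>\<^sub>F n in sequentially. \<bar>x n / real (r n)\<bar> < 1 / 2"
    using tendstoD[OF y, of "1 / 2"] by simp
  have pos: "\<forall>\<^sub>F n in sequentially. 0 < r n"
    using filterlim_at_top[THEN iffD1, OF r, rule_format, of 1] by eventually_elim simp
  have lim: "(\<lambda>n. real (r n) * ln (1 - x n / real (r n)) + x n) \<longlonglongrightarrow> 0"
  proof (rule Lim_null_comparison)
    show "\<forall>\<^sub>F n in sequentially. norm (real (r n) * ln (1 - x n / real (r n)) + x n) \<le> 2 * ((x n)\<^sup>2 / real (r n))"
      using small pos
    proof eventually_elim
      case (elim n)
      let ?y = "x n / real (r n)"
      have "\<bar>ln (1 + - ?y) - - ?y\<bar> \<le> 2 * (- ?y)\<^sup>2"
        using elim(1) by (intro abs_ln_one_plus_x_minus_x_bound) (simp only: abs_minus less_imp_le)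
      then have "real (r n) * \<bar>ln (1 - ?y) + ?y\<bar> \<le> real (r n) * (2 * ?y\<^sup>2)"
        by (intro mult_left_mono) auto
      moreover have "real (r n) * ln (1 - ?y) + x n = real (r n) * (ln (1 - ?y) + ?y)"
        using elim(2) by (simp add: distrib_left)
      moreover have "real (r n) * (2 * ?y\<^sup>2) = 2 * ((x n)\<^sup>2 / real (r n))"
        using elim(2) by (simp add: power2_eq_square)
      ultimately show ?case by (simp only: real_norm_def abs_mult abs_of_nat)
    qed
    have "(\<lambda>n. (x n)\<^sup>2 / real (r n)) \<longlonglongrightarrow> 0"
      by (rule real_tendsto_divide_at_top[OF tendsto_power[OF x] r'])
    then show "(\<lambda>n. 2 * ((x n)\<^sup>2 / real (r n))) \<longlonglongrightarrow> 0"
      using tendsto_mult_right_zero by blast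
  qed
  have "(\<lambda>n. real (r n) * ln (1 - x n / real (r n))) \<longlonglongrightarrow> - l"
    using tendsto_diff[OF lim x] by simp
  then have "(\<lambda>n. exp (real (r n) * ln (1 - x n / real (r n)))) \<longlonglongrightarrow> exp (- l)"
    by (rule tendsto_exp)
  moreover have "\<forall>\<^sub>F n in sequentially. exp (real (r n) * ln (1 - x n / real (r n))) = (1 - x n / real (r n)) ^ r n"
    using small
  proof eventually_elim
    case (elim n)
    then have "0 < 1 - x n / real (r n)" by linarith
    then show ?case by (simp add: exp_of_nat_mult)
  qed
  ultimately show ?thesis by (rule Lim_transform_eventually)
qed

lemma sqrt_divide_power2: "0 < B \<Longrightarrow> sqrt (x / B\<^sup>2) = sqrt x / B"
  by (simp add: real_sqrt_divide)

section \<open>Sequences of statistics and the common limit theorem\<close>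

text \<open>Indices start at N = 2, the first value that admits 0 < k N < N.\<close>

locale ustat_sequence = P: prob_space P for P :: "'w measure" +
  fixes D :: "'z measure"
    and Z :: "nat \<Rightarrow> 'w \<Rightarrow> 'z" and S :: "nat \<Rightarrow> nat \<Rightarrow> 'w \<Rightarrow> nat set"
    and k m :: "nat \<Rightarrow> nat" and h :: "nat \<Rightarrow> (nat \<Rightarrow> 'z) \<Rightarrow> real"
  assumes sample: "\<And>N. N \<ge> 2 \<Longrightarrow> incomplete_sample D (k N) (h N) N (m N) P Z (S N)"
    and k_less: "\<And>N. N \<ge> 2 \<Longrightarrow> k N < N"
begin

definition U :: "nat \<Rightarrow> 'w \<Rightarrow> real" where "U N = incomplete_U (k N) (m N) (h N) Z (S N)"
definition \<mu> :: "nat \<Rightarrow> real" where "\<mu> N = kernel_mean D (k N) (h N)"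
definition \<zeta>1 :: "nat \<Rightarrow> real" where "\<zeta>1 N = zeta D (k N) (h N) 1"
definition \<zeta>k :: "nat \<Rightarrow> real" where "\<zeta>k N = zeta D (k N) (h N) (k N)"
definition vf :: "nat \<Rightarrow> real" where
  "vf N = overlap_avg N (k N) (kernel.ov D (k N) (h N)) - kernel.ov D (k N) (h N) 0"
text \<open>The variance of the Hajek projection. Below, \<open>draw N\<close> is the resampling
  variance up to the factor 1 - vf / \<zeta>k, and \<open>hc\<close> is the characteristic function
  of the projection over \<open>B\<close>.\<close>

definition lin :: "nat \<Rightarrow> real" where "lin N = (real (k N))\<^sup>2 / real N * \<zeta>1 N"
definition draw :: "nat \<Rightarrow> real" where "draw N = \<zeta>k N / real (m N)"
definition hc :: "nat \<Rightarrow> real \<Rightarrow> real \<Rightarrow> complex" where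
  "hc N B t = (\<integral>z. iexp (t * (kernel.hajek D (k N) (h N) N z / B)) \<partial>kernel.MZ D)"

abbreviation lind_tail :: "nat \<Rightarrow> real \<Rightarrow> real" where
  "lind_tail N \<epsilon> \<equiv> \<integral>x. (first_proj D (k N) (h N) x / sqrt (zeta D (k N) (h N) 1))\<^sup>2 *
     indicator {y. \<bar>first_proj D (k N) (h N) y / sqrt (zeta D (k N) (h N) 1)\<bar> > \<epsilon> * sqrt (real N)} x \<partial>D"
abbreviation cm4 :: "nat \<Rightarrow> real" where "cm4 N \<equiv> kernel_cmoment D (k N) (h N) 4"
abbreviation cm_ratio :: "nat \<Rightarrow> real" where
  "cm_ratio \<equiv> \<lambda>N. cm4 N / (kernel_cmoment D (k N) (h N) 2)\<^sup>2"
abbreviation h4_integrable :: bool where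
  "h4_integrable \<equiv> \<forall>N\<ge>2. integrable (arg_law D (k N)) (\<lambda>z. (h N z) ^ 4)"
abbreviation std :: "(nat \<Rightarrow> real) \<Rightarrow> nat \<Rightarrow> real measure" where
  "std B \<equiv> \<lambda>N. distr P borel (\<lambda>\<omega>. (U N \<omega> - \<mu> N) / B N)"

lemma seq_facts:
  assumes N: "N \<ge> 2"
  shows "0 < k N" "0 < m N" "0 \<le> \<zeta>1 N" "real (k N) * \<zeta>1 N \<le> \<zeta>k N" "lin N \<le> vf N"
    "vf N \<le> real (k N) / real N * \<zeta>k N" "vf N \<le> lin N + (real (k N) / real N)\<^sup>2 * \<zeta>k N"
    "\<zeta>k N / real (N choose k N) \<le> vf N"
    "P.variance (U N) = vf N + (\<zeta>k N - vf N) / real (m N)"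
    "U N \<in> borel_measurable P"
proof -
  interpret incomplete_sample D "k N" "h N" N "m N" P Z "S N" by (rule sample[OF N])
  show "0 < k N" by (rule k_pos)
  show "0 < m N" by (rule m_gt_0)
  show "0 \<le> \<zeta>1 N" "real (k N) * \<zeta>1 N \<le> \<zeta>k N" "lin N \<le> vf N"
    "vf N \<le> real (k N) / real N * \<zeta>k N" "vf N \<le> lin N + (real (k N) / real N)\<^sup>2 * \<zeta>k N"
    "\<zeta>k N / real (N choose k N) \<le> vf N"
    using vfull_bounds[OF kN] unfolding \<zeta>1_def \<zeta>k_def lin_def vf_def by auto
  have U: "U N = UP" by (simp add: U_def UP_def)
  show "P.variance (U N) = vf N + (\<zeta>k N - vf N) / real (m N)"
    unfolding U UP_variance by (simp add: vf_def \<zeta>k_def)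
  show "U N \<in> borel_measurable P" unfolding U by (rule UP_measurable)
qed

lemma hc_near_1:
  assumes N: "N \<ge> 2" and B: "0 < B"
  shows "cmod (hc N B t - 1) \<le> \<bar>t\<bar> * sqrt (lin N / B\<^sup>2)"
proof -
  interpret incomplete_sample D "k N" "h N" N "m N" P Z "S N" by (rule sample[OF N])
  show ?thesis using hajek_near_1[OF B, of t]
    unfolding hc_def sqrt_divide_power2[OF B] lin_def \<zeta>1_def by simp
qed

lemma hc_lindeberg:
  assumes N: "N \<ge> 2" and B: "0 < B" and z_pos: "0 < \<zeta>1 N" and eps: "0 < \<epsilon>"
    and small: "t\<^sup>2 * (lin N / B\<^sup>2) / (2 * real N) \<le> 2"
  shows "cmod (hc N B t - of_real ((1 - t\<^sup>2 * (lin N / B\<^sup>2) / (2 * real N)) ^ N))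
     \<le> t\<^sup>2 * (lin N / B\<^sup>2) * (lind_tail N \<epsilon> + \<bar>t\<bar> * sqrt (lin N / B\<^sup>2) * \<epsilon> / 6)"
proof -
  interpret incomplete_sample D "k N" "h N" N "m N" P Z "S N" by (rule sample[OF N])
  show ?thesis using hajek_lindeberg[OF B z_pos[unfolded \<zeta>1_def] eps, of t] small
    unfolding hc_def lin_def \<zeta>1_def by blast
qed

text \<open>The choice \<gamma> = 1 in \<open>char_decomposition\<close>; \<open>cf_fourth\<close>
  takes for \<gamma> the power that approximates a Gaussian factor.\<close>

lemma cf_plain:
  assumes N: "N \<ge> 2" and B: "0 < B"
  shows "cmod (char (distr P borel (\<lambda>\<omega>. (U N \<omega> - \<mu> N) / B)) t - hc N B t)
    \<le> \<bar>t\<bar> * sqrt ((vf N - lin N) / B\<^sup>2) + \<bar>t\<bar> * sqrt (draw N / B\<^sup>2)"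
proof -
  interpret incomplete_sample D "k N" "h N" N "m N" P Z "S N" by (rule sample[OF N])
  have "cf B t = char (distr P borel (\<lambda>\<omega>. (U N \<omega> - \<mu> N) / B)) t"
    by (simp add: cf_def UP_def U_def \<mu>_def mu_def)
  then show ?thesis using char_decomposition[OF B, of t 1] chi_near_1[OF B, of t]
    unfolding sqrt_divide_power2[OF B] cf_eq hc_def lin_def \<zeta>1_def \<zeta>k_def vf_def draw_def by simp
qed

lemma cf_fourth:
  assumes N: "N \<ge> 2" and B: "0 < B" and h4: "integrable (arg_law D (k N)) (\<lambda>z. (h N z) ^ 4)"
    and z_pos: "0 < \<zeta>k N" and kap: "cm4 N \<le> \<kappa> * (\<zeta>k N)\<^sup>2"
    and small: "t\<^sup>2 * (draw N / B\<^sup>2) / (2 * real (m N)) \<le> 2"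
  shows "cmod (char (distr P borel (\<lambda>\<omega>. (U N \<omega> - \<mu> N) / B)) t
      - of_real ((1 - t\<^sup>2 * (draw N / B\<^sup>2) / (2 * real (m N))) ^ m N) * hc N B t)
    \<le> \<bar>t\<bar> * sqrt ((vf N - lin N) / B\<^sup>2) +
      ((\<bar>t\<bar> * sqrt (draw N / B\<^sup>2)) ^ 3 * (1 + 16 * \<kappa>) / (6 * sqrt (real (m N)))
      + t\<^sup>2 * (draw N / B\<^sup>2) / 2 * (sqrt (\<kappa> * (real (k N) / real N)) + real (k N) / real N))"
proof -
  interpret incomplete_sample D "k N" "h N" N "m N" P Z "S N" by (rule sample[OF N])
  have 1: "cf B t = char (distr P borel (\<lambda>\<omega>. (U N \<omega> - \<mu> N) / B)) t"
    by (simp add: cf_def UP_def U_def \<mu>_def mu_def)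
  have 2: "\<bar>t\<bar> / B * sqrt (vfull N - (real (k N))\<^sup>2 / real N * zeta D (k N) (h N) 1) =
      \<bar>t\<bar> * sqrt ((vf N - lin N) / B\<^sup>2)"
    unfolding sqrt_divide_power2[OF B] lin_def \<zeta>1_def vf_def by simp
  have 3: "zeta D (k N) (h N) (k N) / (real (m N) * B\<^sup>2) = draw N / B\<^sup>2"
    by (simp add: draw_def \<zeta>k_def)
  show ?thesis
    using char_decomposition[OF B, of t "of_real ((1 - t\<^sup>2 * (draw N / B\<^sup>2) / (2 * real (m N))) ^ m N)"]
      chi_near_power[OF B h4 z_pos[unfolded \<zeta>k_def] kap[unfolded \<zeta>k_def], of t] small
    unfolding 1[symmetric] cf_eq 2 3 hc_def by linarith
qed

text \<open>For p = 0 the projection vanishes in L2 at scale \<open>B\<close>. Otherwise it is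
  compared with a power whose limit is the Gaussian factor of variance p; the truncation parameter
  is fixed before the limit and leaves an error proportional to it.\<close>

lemma hc_tendsto:
  assumes B: "\<And>N. N \<ge> 2 \<Longrightarrow> 0 < B N"
    and p: "(\<lambda>N. lin N / (B N)\<^sup>2) \<longlonglongrightarrow> p"
    and cases: "p = 0 \<or> (lindeberg D k h \<and> (\<forall>N\<ge>2. 0 < \<zeta>1 N))"
  shows "(\<lambda>N. hc N (B N) t) \<longlonglongrightarrow> of_real (exp (- (t\<^sup>2 * p / 2)))"
  using cases
proof
  assume p0: "p = 0"
  have "(\<lambda>N. hc N (B N) t - 1) \<longlonglongrightarrow> 0"
  proof (rule Lim_null_comparison)
    show "\<forall>\<^sub>F N in sequentially. norm (hc N (B N) t - 1) \<le> \<bar>t\<bar> * sqrt (lin N / (B N)\<^sup>2)"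
      using eventually_ge_at_top[of 2] by eventually_elim (rule hc_near_1[OF _ B])
    have "(\<lambda>N. \<bar>t\<bar> * sqrt (lin N / (B N)\<^sup>2)) \<longlonglongrightarrow> \<bar>t\<bar> * sqrt 0"
      using p unfolding p0 by (intro tendsto_intros)
    then show "(\<lambda>N. \<bar>t\<bar> * sqrt (lin N / (B N)\<^sup>2)) \<longlonglongrightarrow> 0" by simp
  qed
  then show ?thesis by (simp add: p0 LIM_zero_iff)
next
  assume L: "lindeberg D k h \<and> (\<forall>N\<ge>2. 0 < \<zeta>1 N)"
  let ?p = "\<lambda>N. lin N / (B N)\<^sup>2"
  let ?w = "\<lambda>N. (1 - t\<^sup>2 * ?p N / (2 * real N)) ^ N"
  have w: "?w \<longlonglongrightarrow> exp (- (t\<^sup>2 * p / 2))"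
  proof -
    have "(\<lambda>N. (1 - (t\<^sup>2 * ?p N / 2) / real N) ^ N) \<longlonglongrightarrow> exp (- (t\<^sup>2 * p / 2))"
      by (intro tendsto_one_minus_power tendsto_intros p filterlim_ident) simp
    then show ?thesis by (simp add: mult_ac)
  qed
  have small: "\<forall>\<^sub>F N in sequentially. t\<^sup>2 * ?p N / (2 * real N) \<le> 2"
  proof -
    have "(\<lambda>N. (t\<^sup>2 * ?p N / 2) / real N) \<longlonglongrightarrow> 0"
      by (rule real_tendsto_divide_at_top[where c="t\<^sup>2 * p / 2", OF _ filterlim_real_sequentially]) (intro tendsto_intros p, simp)
    then have "\<forall>\<^sub>F N in sequentially. (t\<^sup>2 * ?p N / 2) / real N < 2" by (rule order_tendstoD) simp
    then show ?thesis by eventually_elim (simp add: mult_ac)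
  qed
  have "(\<lambda>N. hc N (B N) t - of_real (?w N)) \<longlonglongrightarrow> 0"
  proof (rule tendstoI)
    fix e :: real assume e: "0 < e"
    define M where "M = t\<^sup>2 * \<bar>p\<bar> * (\<bar>t\<bar> * sqrt \<bar>p\<bar>)"
    \<comment> \<open>In the limit the error bound is M \<epsilon> / 6; dividing e by 1 + M instead
      of M covers M = 0.\<close>
    define \<epsilon> where "\<epsilon> = e / (1 + M)"
    have M: "0 \<le> M" by (simp add: M_def)
    have eps: "0 < \<epsilon>" using e M by (simp add: \<epsilon>_def)
    have p_nn: "0 \<le> p"
    proof (rule tendsto_lowerbound[OF p])
      show "\<forall>\<^sub>F N in sequentially. 0 \<le> ?p N"
        using eventually_ge_at_top[of 2]
      proof eventually_elim
        case (elim N)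
        then show ?case using seq_facts(3)[OF elim] by (simp add: lin_def)
      qed
    qed simp
    have "(\<lambda>N. lind_tail N \<epsilon>) \<longlonglongrightarrow> 0" using L eps unfolding lindeberg_def by blast
    then have "(\<lambda>N. t\<^sup>2 * ?p N * (lind_tail N \<epsilon> + \<bar>t\<bar> * sqrt (?p N) * \<epsilon> / 6)) \<longlonglongrightarrow> t\<^sup>2 * p * (0 + \<bar>t\<bar> * sqrt p * \<epsilon> / 6)"
      by (intro tendsto_intros p) simp_all
    moreover have "t\<^sup>2 * p * (0 + \<bar>t\<bar> * sqrt p * \<epsilon> / 6) < e"
    proof -
      have "t\<^sup>2 * p * (0 + \<bar>t\<bar> * sqrt p * \<epsilon> / 6) = M * \<epsilon> / 6" using p_nn by (simp add: M_def)
      also have "\<dots> < e"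
      proof -
        have "(1 + M) * \<epsilon> = e" using M by (simp add: \<epsilon>_def)
        then have "M * \<epsilon> < e" using eps by (simp add: algebra_simps)
        then show ?thesis using e mult_nonneg_nonneg[OF M less_imp_le[OF eps]] by simp
      qed
      finally show ?thesis .
    qed
    ultimately have "\<forall>\<^sub>F N in sequentially. t\<^sup>2 * ?p N * (lind_tail N \<epsilon> + \<bar>t\<bar> * sqrt (?p N) * \<epsilon> / 6) < e"
      by (rule order_tendstoD(2))
    then show "\<forall>\<^sub>F N in sequentially. dist (hc N (B N) t - of_real (?w N)) 0 < e"
      using small eventually_ge_at_top[of 2]
    proof eventually_elim
      case (elim N)
      then show ?case
        using hc_lindeberg[OF elim(3) B[OF elim(3)] _ eps elim(2)] L by simp
    qed
  qed
  moreover have "(\<lambda>N. complex_of_real (?w N)) \<longlonglongrightarrow> of_real (exp (- (t\<^sup>2 * p / 2)))"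
    by (intro tendsto_of_real w)
  ultimately show ?thesis by (rule Lim_transform[rotated])
qed

context
  fixes B :: "nat \<Rightarrow> real" and p q \<kappa> :: real
  assumes B: "\<And>N. N \<ge> 2 \<Longrightarrow> 0 < B N"
    and p: "(\<lambda>N. lin N / (B N)\<^sup>2) \<longlonglongrightarrow> p"
    and q: "(\<lambda>N. draw N / (B N)\<^sup>2) \<longlonglongrightarrow> q" and pq: "p + q = 1"
    and err: "(\<lambda>N. (vf N - lin N) / (B N)\<^sup>2) \<longlonglongrightarrow> 0"
    and p_cases: "p = 0 \<or> (lindeberg D k h \<and> (\<forall>N\<ge>2. 0 < \<zeta>1 N))"
    and q_cases: "q = 0 \<or> (filterlim m at_top sequentially \<and> (\<lambda>N. real (k N) / real N) \<longlonglongrightarrow> 0 \<and>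
       h4_integrable \<and> (\<forall>N\<ge>2. 0 < \<zeta>k N) \<and>
       (\<forall>\<^sub>F N in sequentially. cm4 N \<le> \<kappa> * (\<zeta>k N)\<^sup>2))"
begin

text \<open>The regimes are (p, q) = (1, 0), (0, 1) and (1 / c, (1 / \<alpha>) / c) with c = 1 + 1 /
  \<alpha>. The draws contribute exp (- t^2 q / 2) through \<gamma>, the projection exp (- t^2 p /
  2), and p + q = 1 makes the product the standard normal characteristic function.\<close>

lemma cf_tendsto: "(\<lambda>N. char (std B N) t) \<longlonglongrightarrow> of_real (exp (- (t\<^sup>2 / 2)))"
proof -
  let ?c = "\<lambda>N. char (std B N) t"
  let ?q = "\<lambda>N. draw N / (B N)\<^sup>2"
  note hc = hc_tendsto[OF B p p_cases, of t]
  have err': "(\<lambda>N. \<bar>t\<bar> * sqrt ((vf N - lin N) / (B N)\<^sup>2)) \<longlonglongrightarrow> 0"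
    using tendsto_mult[OF tendsto_const tendsto_real_sqrt[OF err], of "\<bar>t\<bar>"] by simp
  \<comment> \<open>For q = 0 the constant 1 serves as \<gamma>. The other alternative takes the
    m-th power, whose error terms vanish since \<open>m\<close> tends to infinity and k / N to
    0.\<close>
  have "\<exists>\<gamma>. \<gamma> \<longlonglongrightarrow> exp (- (t\<^sup>2 * q / 2)) \<and> (\<lambda>N. ?c N - of_real (\<gamma> N) * hc N (B N) t) \<longlonglongrightarrow> 0"
    using q_cases
  proof
    assume q0: "q = 0"
    have "(\<lambda>N. ?c N - of_real 1 * hc N (B N) t) \<longlonglongrightarrow> 0"
    proof (rule Lim_null_comparison)
      show "\<forall>\<^sub>F N in sequentially. norm (?c N - of_real 1 * hc N (B N) t) \<le>
          \<bar>t\<bar> * sqrt ((vf N - lin N) / (B N)\<^sup>2) + \<bar>t\<bar> * sqrt (?q N)"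
        using eventually_ge_at_top[of 2]
      proof eventually_elim
        case (elim N)
        then show ?case using cf_plain[OF elim B[OF elim], of t] by simp
      qed
      have "(\<lambda>N. \<bar>t\<bar> * sqrt (?q N)) \<longlonglongrightarrow> \<bar>t\<bar> * sqrt 0"
        using q unfolding q0 by (intro tendsto_intros)
      then show "(\<lambda>N. \<bar>t\<bar> * sqrt ((vf N - lin N) / (B N)\<^sup>2) + \<bar>t\<bar> * sqrt (?q N)) \<longlonglongrightarrow> 0"
        using tendsto_add[OF err', of "\<lambda>N. \<bar>t\<bar> * sqrt (?q N)" 0] by simp
    qed
    then show ?thesis using q0 by (intro exI[of _ "\<lambda>_. 1"]) simp
  next
    assume A: "filterlim m at_top sequentially \<and> (\<lambda>N. real (k N) / real N) \<longlonglongrightarrow> 0 \<and>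
       h4_integrable \<and> (\<forall>N\<ge>2. 0 < \<zeta>k N) \<and>
       (\<forall>\<^sub>F N in sequentially. cm4 N \<le> \<kappa> * (\<zeta>k N)\<^sup>2)"
    have m: "filterlim m at_top sequentially" using A by blast
    have m': "filterlim (\<lambda>N. real (m N)) at_top sequentially"
      by (rule filterlim_compose[OF filterlim_real_sequentially m])
    have kN: "(\<lambda>N. real (k N) / real N) \<longlonglongrightarrow> 0" using A by blast
    let ?w = "\<lambda>N. (1 - t\<^sup>2 * ?q N / (2 * real (m N))) ^ m N"
    have w: "?w \<longlonglongrightarrow> exp (- (t\<^sup>2 * q / 2))"
    proof -
      have "(\<lambda>N. (1 - (t\<^sup>2 * ?q N / 2) / real (m N)) ^ m N) \<longlonglongrightarrow> exp (- (t\<^sup>2 * q / 2))"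
        by (intro tendsto_one_minus_power tendsto_intros q m) simp
      then show ?thesis by (simp add: mult_ac)
    qed
    have small: "\<forall>\<^sub>F N in sequentially. t\<^sup>2 * ?q N / (2 * real (m N)) \<le> 2"
    proof -
      have "(\<lambda>N. (t\<^sup>2 * ?q N / 2) / real (m N)) \<longlonglongrightarrow> 0"
        by (rule real_tendsto_divide_at_top[where c="t\<^sup>2 * q / 2", OF _ m']) (intro tendsto_intros q, simp)
      then have "\<forall>\<^sub>F N in sequentially. (t\<^sup>2 * ?q N / 2) / real (m N) < 2" by (rule order_tendstoD) simp
      then show ?thesis by eventually_elim (simp add: mult_ac)
    qed
    have 1: "(\<lambda>N. (\<bar>t\<bar> * sqrt (?q N)) ^ 3 * (1 + 16 * \<kappa>) / (6 * sqrt (real (m N)))) \<longlonglongrightarrow> 0"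
    proof (rule real_tendsto_divide_at_top)
      show "(\<lambda>N. (\<bar>t\<bar> * sqrt (?q N)) ^ 3 * (1 + 16 * \<kappa>)) \<longlonglongrightarrow> (\<bar>t\<bar> * sqrt q) ^ 3 * (1 + 16 * \<kappa>)"
        by (intro tendsto_intros q)
      show "filterlim (\<lambda>N. 6 * sqrt (real (m N))) at_top sequentially"
        by (rule filterlim_tendsto_pos_mult_at_top[OF tendsto_const _ filterlim_compose[OF sqrt_at_top m']]) simp
    qed
    have 2: "(\<lambda>N. t\<^sup>2 * ?q N / 2 * (sqrt (\<kappa> * (real (k N) / real N)) + real (k N) / real N)) \<longlonglongrightarrow>
        t\<^sup>2 * q / 2 * (sqrt (\<kappa> * 0) + 0)"
      by (intro tendsto_intros q kN) simp
    have "(\<lambda>N. ?c N - of_real (?w N) * hc N (B N) t) \<longlonglongrightarrow> 0"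
    proof (rule Lim_null_comparison)
      show "\<forall>\<^sub>F N in sequentially. norm (?c N - of_real (?w N) * hc N (B N) t) \<le>
          \<bar>t\<bar> * sqrt ((vf N - lin N) / (B N)\<^sup>2) +
          ((\<bar>t\<bar> * sqrt (?q N)) ^ 3 * (1 + 16 * \<kappa>) / (6 * sqrt (real (m N)))
           + t\<^sup>2 * ?q N / 2 * (sqrt (\<kappa> * (real (k N) / real N)) + real (k N) / real N))"
        using eventually_ge_at_top[of 2] small A[THEN conjunct2, THEN conjunct2, THEN conjunct2, THEN conjunct2]
      proof eventually_elim
        case (elim N)
        have "integrable (arg_law D (k N)) (\<lambda>z. (h N z) ^ 4)" "0 < \<zeta>k N" using A elim(1) by auto
        from cf_fourth[OF elim(1) B[OF elim(1)] this elim(3,2)] show ?case .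
      qed
      show "(\<lambda>N. \<bar>t\<bar> * sqrt ((vf N - lin N) / (B N)\<^sup>2) +
          ((\<bar>t\<bar> * sqrt (?q N)) ^ 3 * (1 + 16 * \<kappa>) / (6 * sqrt (real (m N)))
           + t\<^sup>2 * ?q N / 2 * (sqrt (\<kappa> * (real (k N) / real N)) + real (k N) / real N))) \<longlonglongrightarrow> 0"
        using tendsto_add[OF err' tendsto_add[OF 1 2]] by simp
    qed
    then show ?thesis using w by blast
  qed
  then obtain \<gamma> where \<gamma>: "\<gamma> \<longlonglongrightarrow> exp (- (t\<^sup>2 * q / 2))"
      "(\<lambda>N. ?c N - of_real (\<gamma> N) * hc N (B N) t) \<longlonglongrightarrow> 0" by blast
  have "(\<lambda>N. of_real (\<gamma> N) * hc N (B N) t) \<longlonglongrightarrow>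
      complex_of_real (exp (- (t\<^sup>2 * q / 2))) * of_real (exp (- (t\<^sup>2 * p / 2)))"
    by (intro tendsto_mult tendsto_of_real \<gamma>(1) hc)
  also have "complex_of_real (exp (- (t\<^sup>2 * q / 2))) * of_real (exp (- (t\<^sup>2 * p / 2))) = of_real (exp (- (t\<^sup>2 / 2)))"
  proof -
    have "- (t\<^sup>2 * q / 2) + - (t\<^sup>2 * p / 2) = - (t\<^sup>2 * (p + q) / 2)" by (simp add: algebra_simps)
    then have "exp (- (t\<^sup>2 * q / 2)) * exp (- (t\<^sup>2 * p / 2)) = exp (- (t\<^sup>2 / 2))"
      unfolding exp_add[symmetric] pq by simp
    then show ?thesis by (simp only: of_real_mult[symmetric])
  qed
  finally show ?thesis by (rule Lim_transform[OF _ \<gamma>(2)])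
qed

lemma clt: "weak_conv_m (std B) std_normal_distribution"
proof -
  let ?M = "std B"
  \<comment> \<open>Levy's theorem wants a distribution at every index, and measurability of
    \<open>U N\<close> is known from N = 2 on; the shift is undone at the end.\<close>
  have "weak_conv_m (\<lambda>N. ?M (N + 2)) std_normal_distribution"
  proof (rule levy_continuity)
    show "real_distribution (?M (N + 2))" for N
      using seq_facts(10)[of "N + 2"] by (intro P.real_distribution_distr) auto
    show "real_distribution std_normal_distribution" by (rule real_dist_normal_dist)
    fix t :: real
    have "(\<lambda>N. char (?M N) t) \<longlonglongrightarrow> of_real (exp (- (t\<^sup>2 / 2)))"
      by (rule cf_tendsto)
    then have "(\<lambda>N. char (?M (N + 2)) t) \<longlonglongrightarrow> of_real (exp (- (t\<^sup>2 / 2)))"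
      by (rule LIMSEQ_ignore_initial_segment)
    then show "(\<lambda>N. char (?M (N + 2)) t) \<longlonglongrightarrow> char std_normal_distribution t"
      by (simp add: char_std_normal_distribution)
  qed
  then show ?thesis
    unfolding weak_conv_m_def weak_conv_def
    by (auto intro: LIMSEQ_offset[where k=2])
qed

end

end

section \<open>Variance expansions and the three regimes\<close>

context ustat_sequence begin

definition a :: "nat \<Rightarrow> real" where
  "a N = (real (k N) / real N) * (\<zeta>k N / (real (k N) * \<zeta>1 N))"
text \<open>The ratio \<open>draw N / lin N\<close> of resampling to projection variance, as shown
  in \<open>positive_facts\<close>; its limit selects the regime.\<close>

definition \<rho> :: "nat \<Rightarrow> real" where
  "\<rho> N = a N * (real N)\<^sup>2 / ((real (k N))\<^sup>2 * real (m N))"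
definition V :: "nat \<Rightarrow> real" where "V N = P.variance (U N)"
definition C :: "nat \<Rightarrow> real" where "C N = real (N choose k N)"

text \<open>Both summands of Pascal's rule are positive since 0 < k < N. The bound keeps 1 - 1 / C
  at least 1/2, so that \<open>variance_expansion\<close> can divide by it.\<close>

lemma C_ge_2:
  assumes N: "N \<ge> 2"
  shows "2 \<le> C N"
proof -
  have k: "0 < k N" "k N < N" using seq_facts(1)[OF N] k_less[OF N] by auto
  obtain n i where n: "N = Suc n" "k N = Suc i"
    using k N by (metis not0_implies_Suc not_less_zero)
  have "0 < n choose i" "0 < n choose Suc i"
    using k n by (simp_all add: zero_less_binomial)
  moreover have "Suc n choose Suc i = (n choose i) + (n choose Suc i)" by (rule binomial_Suc_Suc)
  ultimately have "2 \<le> Suc n choose Suc i" by linarith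
  then have "2 \<le> N choose k N" using n by metis
  then show ?thesis unfolding C_def by linarith
qed

lemma variance_eq: "N \<ge> 2 \<Longrightarrow> V N = vf N + (\<zeta>k N - vf N) / real (m N)"
  using seq_facts(9) by (simp add: V_def)

lemma \<zeta>k_nonneg: "N \<ge> 2 \<Longrightarrow> 0 \<le> \<zeta>k N"
  using seq_facts(3,4)[of N] by (meson mult_nonneg_nonneg of_nat_0_le_iff order_trans)

lemma vf_nonneg: "N \<ge> 2 \<Longrightarrow> 0 \<le> vf N"
  using seq_facts(8)[of N] \<zeta>k_nonneg[of N] by (meson divide_nonneg_nonneg of_nat_0_le_iff order_trans)

text \<open>The first term bounds vf with room to spare; the lower bound \<zeta>k / C for vf turns
  the exact resampling variance into the second.\<close>

lemma variance_upper:
  assumes N: "N \<ge> 2"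
  shows "V N \<le> (real (k N) / real N) * \<zeta>k N * (1 + real (k N) / real N)
                   + (1 / real (m N)) * \<zeta>k N * (1 - 1 / C N)"
proof -
  have "(\<zeta>k N - vf N) / real (m N) \<le> (\<zeta>k N - \<zeta>k N / C N) / real (m N)"
    using seq_facts(8)[OF N] by (intro divide_right_mono) (auto simp: C_def)
  also have "\<dots> = (1 / real (m N)) * \<zeta>k N * (1 - 1 / C N)" by (simp add: algebra_simps)
  finally have 1: "(\<zeta>k N - vf N) / real (m N) \<le> (1 / real (m N)) * \<zeta>k N * (1 - 1 / C N)" .
  have "0 \<le> (real (k N) / real N) * \<zeta>k N * (real (k N) / real N)"
    using \<zeta>k_nonneg[OF N] by simp
  then have "(real (k N) / real N) * \<zeta>k N \<le> (real (k N) / real N) * \<zeta>k N * (1 + real (k N) / real N)"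
    by (simp add: distrib_left)
  then show ?thesis using 1 seq_facts(6)[OF N] unfolding variance_eq[OF N] by linarith
qed

text \<open>The inequality k \<zeta>1 <= \<zeta>k drives the comparisons with \<open>a\<close>. It
  gives k / N <= a; and as \<rho> is \<zeta>k / (k \<zeta>1) times N / (k m), it gives N / (k m) <=
  \<rho>. Multiplied, these yield 1 / m <= \<rho> a, so \<open>a\<close> tending to 0 with bounded
  \<rho> forces m to infinity.\<close>

lemma positive_facts:
  assumes N: "N \<ge> 2" and z: "\<zeta>1 N \<noteq> 0"
  shows "0 < \<zeta>1 N" "0 < \<zeta>k N" "0 < lin N" "0 < draw N" "0 < a N" "real (k N) / real N \<le> a N"
    "vf N - lin N \<le> a N * lin N" "\<rho> N = draw N / lin N" "1 / real (m N) \<le> \<rho> N * a N" "0 < \<rho> N"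
proof -
  show z1: "0 < \<zeta>1 N" using z seq_facts(3)[OF N] by simp
  have k: "0 < real (k N)" and m: "0 < real (m N)" and N0: "0 < real N"
    using seq_facts(1,2)[OF N] N by auto
  have "0 < real (k N) * \<zeta>1 N" using k z1 by simp
  then show zk: "0 < \<zeta>k N" using seq_facts(4)[OF N] by linarith
  show lin: "0 < lin N" using k N0 z1 by (simp add: lin_def)
  show draw: "0 < draw N" using zk m by (simp add: draw_def)
  have a: "a N = \<zeta>k N / (real N * \<zeta>1 N)" using k by (simp add: a_def)
  show apos: "0 < a N" using zk z1 N0 by (simp add: a)
  have "real (k N) / real N = real (k N) * \<zeta>1 N / (real N * \<zeta>1 N)" using z1 by simp
  also have "\<dots> \<le> a N" unfolding a using seq_facts(4)[OF N] z1 N0 by (intro divide_right_mono) auto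
  finally show ka: "real (k N) / real N \<le> a N" .
  have "(real (k N) / real N)\<^sup>2 * \<zeta>k N = a N * lin N"
    using z1 N0 by (simp add: a lin_def power2_eq_square)
  then show "vf N - lin N \<le> a N * lin N" using seq_facts(7)[OF N] by linarith
  show rho: "\<rho> N = draw N / lin N"
    using z1 N0 k m by (simp add: \<rho>_def a lin_def draw_def field_simps power2_eq_square)
  then show rpos: "0 < \<rho> N" using draw lin by simp
  have "\<rho> N = (\<zeta>k N / (real (k N) * \<zeta>1 N)) * (real N / (real (k N) * real (m N)))"
    using z1 N0 k m unfolding rho by (simp add: lin_def draw_def field_simps power2_eq_square)
  moreover have "1 \<le> \<zeta>k N / (real (k N) * \<zeta>1 N)" using seq_facts(4)[OF N] k z1 by simp
  ultimately have "real N / (real (k N) * real (m N)) \<le> \<rho> N"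
    using k m N0 mult_right_mono[of 1 "\<zeta>k N / (real (k N) * \<zeta>1 N)" "real N / (real (k N) * real (m N))"] by simp
  then have "real N / (real (k N) * real (m N)) * (real (k N) / real N) \<le> \<rho> N * a N"
    using ka k N0 rpos by (intro mult_mono) auto
  then show "1 / real (m N) \<le> \<rho> N * a N" using k N0 by simp
qed

context
  assumes z1_ne: "\<And>N. N \<ge> 2 \<Longrightarrow> \<zeta>1 N \<noteq> 0"
begin

lemmas pos = positive_facts[OF _ z1_ne]

text \<open>Writing \<zeta>k - vf as \<zeta>k (1 - 1 / C) (1 - d) defines d. It is nonnegative
  because vf >= \<zeta>k / C, and at most 2 k / N <= 2 a because vf <= (k / N) \<zeta>k and 1 - 1 /
  C >= 1/2.\<close>

lemma variance_expansion:
  "\<exists>r\<in>O(a). \<exists>d\<in>O(a). \<forall>N\<ge>2. 0 \<le> d N \<and>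
      V N = ((real (k N))\<^sup>2 / real N) * \<zeta>1 N * (1 + r N)
          + (1 / real (m N)) * \<zeta>k N * (1 - 1 / C N) * (1 - d N)"
proof -
  define r where "r N = vf N / lin N - 1" for N
  define d where "d N = (vf N - \<zeta>k N / C N) / (\<zeta>k N * (1 - 1 / C N))" for N
  have "r \<in> O(a)"
  proof (rule bigoI[where c=1])
    show "\<forall>\<^sub>F N in sequentially. norm (r N) \<le> 1 * norm (a N)"
      using eventually_ge_at_top[of 2]
    proof eventually_elim
      case (elim N)
      have "r N = (vf N - lin N) / lin N" using pos(3)[OF elim elim] by (simp add: r_def diff_divide_distrib)
      then have "0 \<le> r N" "r N \<le> a N"
        using pos(3,7)[OF elim elim] seq_facts(5)[OF elim] by (simp_all add: pos_divide_le_eq)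
      then show ?case by simp
    qed
  qed
  moreover have C1: "1 / 2 \<le> 1 - 1 / C N" if "N \<ge> 2" for N
    using C_ge_2[OF that] by (simp add: field_simps)
  have d_nn: "0 \<le> d N" if "N \<ge> 2" for N
    using seq_facts(8)[OF that] pos(2)[OF that that] C1[OF that] unfolding d_def C_def
    by (intro divide_nonneg_nonneg mult_nonneg_nonneg) auto
  have "d \<in> O(a)"
  proof (rule bigoI[where c=2])
    show "\<forall>\<^sub>F N in sequentially. norm (d N) \<le> 2 * norm (a N)"
      using eventually_ge_at_top[of 2]
    proof eventually_elim
      case (elim N)
      have zk: "0 < \<zeta>k N" and C: "2 \<le> C N" using pos(2)[OF elim elim] C_ge_2[OF elim] by auto
      have "d N \<le> vf N / (\<zeta>k N * (1 / 2))"
        unfolding d_def using C1[OF elim] zk C vf_nonneg[OF elim]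
        by (intro frac_le mult_left_mono) auto
      also have "\<dots> = 2 * (vf N / \<zeta>k N)" by simp
      also have "vf N / \<zeta>k N \<le> real (k N) / real N"
        using seq_facts(6)[OF elim] zk by (simp add: pos_divide_le_eq)
      also have "real (k N) / real N \<le> a N" by (rule pos(6)[OF elim elim])
      finally show ?case using d_nn[OF elim] pos(5)[OF elim elim] by simp
    qed
  qed
  moreover have "0 \<le> d N \<and> V N = ((real (k N))\<^sup>2 / real N) * \<zeta>1 N * (1 + r N)
          + (1 / real (m N)) * \<zeta>k N * (1 - 1 / C N) * (1 - d N)" if N: "N \<ge> 2" for N
  proof -
    let ?x = "\<zeta>k N * (1 - 1 / C N)"
    have x: "0 < ?x" using pos(2)[OF N N] C1[OF N] by (intro mult_pos_pos) auto
    have cancel: "y * (w / y) = w" if "0 < y" for y w :: real using that by simp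
    have "?x * d N = vf N - \<zeta>k N / C N" unfolding d_def by (rule cancel[OF x])
    then have "?x * (1 - d N) = ?x - (vf N - \<zeta>k N / C N)" by (simp only: right_diff_distrib mult_1_right)
    also have "\<dots> = \<zeta>k N - vf N" by (simp add: algebra_simps)
    finally have 1: "?x * (1 - d N) = \<zeta>k N - vf N" .
    have "lin N * (1 + r N) = vf N" using pos(3)[OF N N] by (simp add: r_def)
    then have 2: "((real (k N))\<^sup>2 / real N) * \<zeta>1 N * (1 + r N) = vf N" by (simp add: lin_def)
    have 3: "(1 / real (m N)) * \<zeta>k N * (1 - 1 / C N) * (1 - d N) = (1 / real (m N)) * (\<zeta>k N - vf N)"
      unfolding 1[symmetric] by (simp only: mult.assoc)
    show ?thesis using d_nn[OF N] unfolding 2 3 variance_eq[OF N] by simp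
  qed
  ultimately show ?thesis by blast
qed

text \<open>The discrepancy (vf - \<zeta>k / C) / m is absorbed into the first term, where its size
  relative to \<open>lin\<close> is at most (1 + a) / m. The condition on 1 / m has substance: for
  an additive kernel with m = 1, k tending to infinity and k / N to 0, the variance is \<zeta>k, so
  r = N / (k C) - 1 tends to -1 while a = k / N tends to 0.\<close>

lemma variance_expansion':
  assumes m: "(\<lambda>N. 1 / real (m N)) \<in> O(a)"
  shows "\<exists>r\<in>O(a). \<forall>N\<ge>2. V N = ((real (k N))\<^sup>2 / real N) * \<zeta>1 N * (1 + r N)
                  + (1 / real (m N)) * \<zeta>k N * (1 - 1 / C N)"
proof -
  define r where "r N = (V N - (1 / real (m N)) * \<zeta>k N * (1 - 1 / C N)) / lin N - 1" for N
  have "(\<lambda>N. 2 * a N + 1 / real (m N)) \<in> O(a)"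
    using m by (intro sum_in_bigo) auto
  moreover have "r \<in> O(\<lambda>N. 2 * a N + 1 / real (m N))"
  proof (rule bigoI[where c=1])
    show "\<forall>\<^sub>F N in sequentially. norm (r N) \<le> 1 * norm (2 * a N + 1 / real (m N))"
      using eventually_ge_at_top[of 2]
    proof eventually_elim
      case (elim N)
      have lin: "0 < lin N" and m: "0 < real (m N)" and apos: "0 < a N"
        using pos(3,5)[OF elim elim] seq_facts(2)[OF elim] by auto
      \<comment> \<open>Relative to \<open>lin\<close>, x is the excess of the complete U-statistic
        and y the discrepancy before division by m.\<close>
      define x where "x = (vf N - lin N) / lin N"
      define y where "y = (vf N - \<zeta>k N / C N) / lin N"
      have "r N = x - y / real (m N)"
        using lin m unfolding r_def x_def y_def variance_eq[OF elim] by (simp add: field_simps)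
      moreover have "0 \<le> x" "x \<le> a N"
        using lin pos(7)[OF elim elim] seq_facts(5)[OF elim] by (auto simp: x_def pos_divide_le_eq)
      moreover have "0 \<le> y" using seq_facts(8)[OF elim] lin by (simp add: y_def C_def)
      moreover have "y \<le> 1 + a N"
      proof -
        have "0 \<le> \<zeta>k N / C N" using \<zeta>k_nonneg[OF elim] by (simp add: C_def)
        then have "vf N - \<zeta>k N / C N \<le> (1 + a N) * lin N"
          using pos(7)[OF elim elim] by (simp add: distrib_right)
        then show ?thesis using lin by (simp add: y_def pos_divide_le_eq)
      qed
      moreover have "1 \<le> real (m N)" using seq_facts(2)[OF elim] by linarith
      ultimately have "0 \<le> y / real (m N)" "y / real (m N) \<le> 1 / real (m N) + a N"
      proof -
        have "y / real (m N) \<le> (1 + a N) / real (m N)"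
          using \<open>y \<le> 1 + a N\<close> by (intro divide_right_mono) auto
        also have "\<dots> = 1 / real (m N) + a N / real (m N)" by (simp add: add_divide_distrib)
        also have "a N / real (m N) \<le> a N / 1"
          using \<open>1 \<le> real (m N)\<close> apos by (intro divide_left_mono) auto
        finally show "y / real (m N) \<le> 1 / real (m N) + a N" by simp
        show "0 \<le> y / real (m N)" using \<open>0 \<le> y\<close> by simp
      qed
      then show ?case using \<open>r N = x - y / real (m N)\<close> \<open>0 \<le> x\<close> \<open>x \<le> a N\<close> apos m by simp
    qed
  qed
  ultimately have "r \<in> O(a)" by (rule landau_o.big_trans[rotated])
  moreover have "V N = ((real (k N))\<^sup>2 / real N) * \<zeta>1 N * (1 + r N)
                  + (1 / real (m N)) * \<zeta>k N * (1 - 1 / C N)" if N: "N \<ge> 2" for N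
  proof -
    have "lin N * (1 + r N) = V N - (1 / real (m N)) * \<zeta>k N * (1 - 1 / C N)"
      using pos(3)[OF N N] by (simp add: r_def)
    then show ?thesis by (simp add: lin_def)
  qed
  ultimately show ?thesis by blast
qed

context
  assumes a_0: "a \<longlonglongrightarrow> 0"
begin

lemma err_lin: "(\<lambda>N. (vf N - lin N) / lin N) \<longlonglongrightarrow> 0"
proof (rule Lim_null_comparison[OF _ a_0])
  show "\<forall>\<^sub>F N in sequentially. norm ((vf N - lin N) / lin N) \<le> a N"
    using eventually_ge_at_top[of 2]
  proof eventually_elim
    case (elim N)
    then show ?case using pos(3,7)[OF elim elim] seq_facts(5)[OF elim] by (simp add: pos_divide_le_eq)
  qed
qed

lemma k_over_N: "(\<lambda>N. real (k N) / real N) \<longlonglongrightarrow> 0"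
proof (rule Lim_null_comparison[OF _ a_0])
  show "\<forall>\<^sub>F N in sequentially. norm (real (k N) / real N) \<le> a N"
    using eventually_ge_at_top[of 2] by eventually_elim (simp add: pos(6))
qed

text \<open>The variance is vf (1 - 1 / m) + draw exactly, and 1 / m tends to 0 by itself, being at
  most \<rho> a.\<close>

lemma V_over_lin:
  assumes \<rho>: "\<rho> \<longlonglongrightarrow> l"
  shows "(\<lambda>N. V N / lin N) \<longlonglongrightarrow> 1 + l"
proof -
  have m0: "(\<lambda>N. 1 / real (m N)) \<longlonglongrightarrow> 0"
  proof (rule Lim_null_comparison)
    show "\<forall>\<^sub>F N in sequentially. norm (1 / real (m N)) \<le> \<rho> N * a N"
      using eventually_ge_at_top[of 2] by eventually_elim (simp add: pos(9))
    show "(\<lambda>N. \<rho> N * a N) \<longlonglongrightarrow> 0" using tendsto_mult[OF \<rho> a_0] by simp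
  qed
  let ?g = "\<lambda>N. (1 + (vf N - lin N) / lin N) * (1 - 1 / real (m N)) + \<rho> N"
  have "?g \<longlonglongrightarrow> (1 + 0) * (1 - 0) + l"
    by (intro tendsto_intros err_lin m0 \<rho>)
  moreover have "\<forall>\<^sub>F N in sequentially. ?g N = V N / lin N"
    using eventually_ge_at_top[of 2]
  proof eventually_elim
    case (elim N)
    have "0 < lin N" "0 < real (m N)" using pos(3)[OF elim elim] seq_facts(2)[OF elim] by auto
    then show ?case unfolding variance_eq[OF elim] pos(8)[OF elim elim]
      by (simp add: draw_def field_simps)
  qed
  ultimately show ?thesis by (simp cong: filterlim_cong add: filterlim_cong)
qed

lemma relative_error_smallo:
  assumes "(\<lambda>N. V N / f N) \<longlonglongrightarrow> 1" and "\<And>N. N \<ge> 2 \<Longrightarrow> f N \<noteq> 0"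
  shows "\<exists>e\<in>o(\<lambda>_. 1). \<forall>N\<ge>2. V N = (1 + e N) * f N"
proof
  have "(\<lambda>N. V N / f N - 1) \<longlonglongrightarrow> 0" using assms(1) by (rule LIM_zero)
  then show "(\<lambda>N. V N / f N - 1) \<in> o(\<lambda>_. 1 :: real)" by (intro smalloI_tendsto) auto
  show "\<forall>N\<ge>2. V N = (1 + (V N / f N - 1)) * f N" using assms(2) by simp
qed

lemma eventually_eq_const:
  assumes "\<And>N. N \<ge> 2 \<Longrightarrow> f N = (c::real)"
  shows "f \<longlonglongrightarrow> c"
proof -
  have "\<forall>\<^sub>F N in sequentially. f N = c"
    using eventually_ge_at_top[of 2] by eventually_elim (rule assms)
  then show ?thesis by (rule tendsto_eventually)
qed

lemma tendsto_cong_ge_2: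
  assumes "f \<longlonglongrightarrow> (c::real)" "\<And>N. N \<ge> 2 \<Longrightarrow> f N = g N"
  shows "g \<longlonglongrightarrow> c"
proof -
  have "\<forall>\<^sub>F N in sequentially. f N = g N"
    using eventually_ge_at_top[of 2] by eventually_elim (rule assms(2))
  then show ?thesis using assms(1) by (rule Lim_transform_eventually[rotated])
qed

text \<open>The second central moment is \<zeta>k, so bounded kurtosis becomes a single constant
  \<kappa>.\<close>

lemma cmoment_bound:
  assumes "cm_ratio \<in> O(\<lambda>_. 1)"
  obtains \<kappa> where "\<forall>\<^sub>F N in sequentially. cm4 N \<le> \<kappa> * (\<zeta>k N)\<^sup>2"
proof -
  obtain c where c: "\<forall>\<^sub>F N in sequentially.
      norm (cm4 N / (kernel_cmoment D (k N) (h N) 2)\<^sup>2) \<le> c * norm (1::real)"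
    using assms by (auto elim: landau_o.bigE)
  have "\<forall>\<^sub>F N in sequentially. cm4 N \<le> c * (\<zeta>k N)\<^sup>2"
    using c eventually_ge_at_top[of 2]
  proof eventually_elim
    case (elim N)
    interpret incomplete_sample D "k N" "h N" N "m N" P Z "S N" by (rule sample[OF elim(2)])
    have 2: "kernel_cmoment D (k N) (h N) 2 = \<zeta>k N" unfolding \<zeta>k_def by (rule cmoment_2)
    have "cm4 N / (\<zeta>k N)\<^sup>2 \<le> c"
      using elim(1) abs_ge_self[of "cm4 N / (\<zeta>k N)\<^sup>2"]
      unfolding 2 by (simp del: abs_divide)
    then show ?case using pos(2)[OF elim(2) elim(2)] by (simp add: pos_divide_le_eq)
  qed
  then show ?thesis by (rule that)
qed

lemma case_linear:
  assumes \<rho>: "\<rho> \<longlonglongrightarrow> 0"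
  shows "\<exists>e\<in>o(\<lambda>_. 1). \<forall>N\<ge>2. V N = (1 + e N) * lin N"
    and "lindeberg D k h \<Longrightarrow>
      weak_conv_m (std (\<lambda>N. sqrt (lin N))) std_normal_distribution"
proof -
  have lin: "0 < lin N" if "N \<ge> 2" for N by (rule pos(3)[OF that that])
  have "(\<lambda>N. V N / lin N) \<longlonglongrightarrow> 1" using V_over_lin[OF \<rho>] by simp
  then show "\<exists>e\<in>o(\<lambda>_. 1). \<forall>N\<ge>2. V N = (1 + e N) * lin N"
    by (rule relative_error_smallo) (use lin in force)
  assume L: "lindeberg D k h"
  show "weak_conv_m (std (\<lambda>N. sqrt (lin N))) std_normal_distribution"
  \<comment> \<open>With q = 0 the first alternative of \<open>q_cases\<close> applies; \<kappa>
    occurs only in the second, and 0 is a placeholder.\<close>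
  proof (rule clt[where p=1 and q=0 and \<kappa>=0])
    show "0 < sqrt (lin N)" if "N \<ge> 2" for N using lin[OF that] by simp
    show "(\<lambda>N. lin N / (sqrt (lin N))\<^sup>2) \<longlonglongrightarrow> 1"
    proof (rule eventually_eq_const)
      fix N :: nat assume "N \<ge> 2"
      from lin[OF this] show "lin N / (sqrt (lin N))\<^sup>2 = 1" by simp
    qed
    show "(\<lambda>N. draw N / (sqrt (lin N))\<^sup>2) \<longlonglongrightarrow> 0"
    proof (rule tendsto_cong_ge_2[OF \<rho>])
      fix N :: nat assume N: "N \<ge> 2"
      from lin[OF N] show "\<rho> N = draw N / (sqrt (lin N))\<^sup>2" by (simp add: pos(8)[OF N N])
    qed
    show "(\<lambda>N. (vf N - lin N) / (sqrt (lin N))\<^sup>2) \<longlonglongrightarrow> 0"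
    proof (rule tendsto_cong_ge_2[OF err_lin])
      fix N :: nat assume N: "N \<ge> 2"
      from lin[OF N] show "(vf N - lin N) / lin N = (vf N - lin N) / (sqrt (lin N))\<^sup>2" by simp
    qed
  qed (use L pos(1) in auto)
qed

lemma case_draws:
  assumes \<rho>: "filterlim \<rho> at_top sequentially"
  shows "\<exists>e\<in>o(\<lambda>_. 1). \<forall>N\<ge>2. V N = (1 + e N) * draw N"
    and "filterlim m at_top sequentially \<Longrightarrow>
      h4_integrable \<Longrightarrow>
      cm_ratio \<in> O(\<lambda>_. 1) \<Longrightarrow>
      weak_conv_m (std (\<lambda>N. sqrt (draw N))) std_normal_distribution"
proof -
  have draw: "0 < draw N" and lin: "0 < lin N" if "N \<ge> 2" for N using pos(3,4)[OF that that] by auto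
  have lin_draw: "(\<lambda>N. lin N / draw N) \<longlonglongrightarrow> 0"
  proof (rule tendsto_cong_ge_2[OF tendsto_inverse_0_at_top[OF \<rho>]])
    fix N :: nat assume N: "N \<ge> 2"
    show "inverse (\<rho> N) = lin N / draw N" by (simp add: pos(8)[OF N N])
  qed
  have err: "(\<lambda>N. (vf N - lin N) / draw N) \<longlonglongrightarrow> 0"
  proof (rule tendsto_cong_ge_2)
    show "(\<lambda>N. (vf N - lin N) / lin N * (lin N / draw N)) \<longlonglongrightarrow> 0"
      using tendsto_mult[OF err_lin lin_draw] by simp
    fix N :: nat assume "N \<ge> 2"
    from lin[OF this] show "(vf N - lin N) / lin N * (lin N / draw N) = (vf N - lin N) / draw N" by simp
  qed
  have "(\<lambda>N. V N / draw N - 1) \<longlonglongrightarrow> 0"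
  proof (rule Lim_null_comparison)
    show "(\<lambda>N. (vf N - lin N) / draw N + lin N / draw N) \<longlonglongrightarrow> 0"
      using tendsto_add[OF err lin_draw] by simp
    show "\<forall>\<^sub>F N in sequentially. norm (V N / draw N - 1) \<le> (vf N - lin N) / draw N + lin N / draw N"
      using eventually_ge_at_top[of 2]
    proof eventually_elim
      case (elim N)
      have m: "1 \<le> real (m N)" using seq_facts(2)[OF elim] by linarith
      have "V N / draw N - 1 = (V N - draw N) / draw N" using draw[OF elim] by (simp add: diff_divide_distrib)
      \<comment> \<open>This difference lies between 0 and vf, so the limit follows from vf / draw
        tending to 0.\<close>
      also have "V N - draw N = vf N * (1 - 1 / real (m N))"
        unfolding variance_eq[OF elim] draw_def by (simp add: algebra_simps diff_divide_distrib)
      finally have eq: "V N / draw N - 1 = vf N * (1 - 1 / real (m N)) / draw N" .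
      have "vf N * (1 - 1 / real (m N)) \<le> vf N * 1"
        using vf_nonneg[OF elim] m by (intro mult_left_mono) auto
      then have "V N / draw N - 1 \<le> vf N / draw N"
        unfolding eq using draw[OF elim] by (intro divide_right_mono) auto
      moreover have "0 \<le> V N / draw N - 1"
        unfolding eq using draw[OF elim] vf_nonneg[OF elim] m
        by (intro divide_nonneg_nonneg mult_nonneg_nonneg) auto
      ultimately show ?case by (simp add: diff_divide_distrib)
    qed
  qed
  then have "(\<lambda>N. V N / draw N) \<longlonglongrightarrow> 1" by (rule LIM_zero_cancel)
  then show "\<exists>e\<in>o(\<lambda>_. 1). \<forall>N\<ge>2. V N = (1 + e N) * draw N"
    by (rule relative_error_smallo) (use draw in force)
  assume m: "filterlim m at_top sequentially"
    and h4: "h4_integrable"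
    and cm: "cm_ratio \<in> O(\<lambda>_. 1)"
  obtain \<kappa> where \<kappa>: "\<forall>\<^sub>F N in sequentially. cm4 N \<le> \<kappa> * (\<zeta>k N)\<^sup>2"
    using cmoment_bound[OF cm] .
  have B2: "(sqrt (draw N))\<^sup>2 = draw N" if "N \<ge> 2" for N using draw[OF that] by simp
  show "weak_conv_m (std (\<lambda>N. sqrt (draw N))) std_normal_distribution"
  proof (rule clt[where p=0 and q=1 and \<kappa>=\<kappa>])
    show "0 < sqrt (draw N)" if "N \<ge> 2" for N using draw[OF that] by simp
    show "(\<lambda>N. draw N / (sqrt (draw N))\<^sup>2) \<longlonglongrightarrow> 1"
    proof (rule eventually_eq_const)
      fix N :: nat assume "N \<ge> 2"
      from draw[OF this] show "draw N / (sqrt (draw N))\<^sup>2 = 1" by simp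
    qed
    show "(\<lambda>N. lin N / (sqrt (draw N))\<^sup>2) \<longlonglongrightarrow> 0"
      by (rule tendsto_cong_ge_2[OF lin_draw]) (simp only: B2)
    show "(\<lambda>N. (vf N - lin N) / (sqrt (draw N))\<^sup>2) \<longlonglongrightarrow> 0"
      by (rule tendsto_cong_ge_2[OF err]) (simp only: B2)
  qed (use m h4 \<kappa> k_over_N pos(2) in auto)
qed

lemma case_mixed:
  assumes \<alpha>: "0 < \<alpha>" and \<rho>: "\<rho> \<longlonglongrightarrow> 1 / \<alpha>"
  shows "\<exists>e\<in>o(\<lambda>_. 1). \<forall>N\<ge>2. V N = (1 + e N) * ((1 + 1 / \<alpha>) * lin N)"
    and "lindeberg D k h \<Longrightarrow> filterlim m at_top sequentially \<Longrightarrow>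
      h4_integrable \<Longrightarrow>
      cm_ratio \<in> O(\<lambda>_. 1) \<Longrightarrow>
      weak_conv_m (std (\<lambda>N. sqrt ((1 + 1 / \<alpha>) * lin N))) std_normal_distribution"
proof -
  let ?c = "1 + 1 / \<alpha>"
  have c: "0 < ?c" using \<alpha> by (simp add: add_pos_pos)
  have lin: "0 < lin N" if "N \<ge> 2" for N by (rule pos(3)[OF that that])
  have clin: "0 < ?c * lin N" if "N \<ge> 2" for N using c lin[OF that] by (rule mult_pos_pos)
  have scale: "(\<lambda>N. x N / (?c * lin N)) \<longlonglongrightarrow> l / ?c" if "(\<lambda>N. x N / lin N) \<longlonglongrightarrow> l" for x l
  proof -
    have "(\<lambda>N. x N / lin N / ?c) \<longlonglongrightarrow> l / ?c" using that c by (intro tendsto_intros) auto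
    then show ?thesis by (simp add: mult.commute)
  qed
  have "(\<lambda>N. V N / (?c * lin N)) \<longlonglongrightarrow> 1"
    using scale[OF V_over_lin[OF \<rho>]] c by simp
  then show "\<exists>e\<in>o(\<lambda>_. 1). \<forall>N\<ge>2. V N = (1 + e N) * (?c * lin N)"
    by (rule relative_error_smallo) (use clin in force)
  assume L: "lindeberg D k h" and m: "filterlim m at_top sequentially"
    and h4: "h4_integrable"
    and cm: "cm_ratio \<in> O(\<lambda>_. 1)"
  obtain \<kappa> where \<kappa>: "\<forall>\<^sub>F N in sequentially. cm4 N \<le> \<kappa> * (\<zeta>k N)\<^sup>2"
    using cmoment_bound[OF cm] .
  have B2: "(sqrt (?c * lin N))\<^sup>2 = ?c * lin N" if "N \<ge> 2" for N
    using less_imp_le[OF clin[OF that]] by (rule real_sqrt_pow2)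
  show "weak_conv_m (std (\<lambda>N. sqrt (?c * lin N))) std_normal_distribution"
  \<comment> \<open>Of the normalising variance (1 + 1 / \<alpha>) lin, the part lin belongs to the
    projection and, in the limit, lin / \<alpha> to the draws.\<close>
  proof (rule clt[where p="1 / ?c" and q="(1 / \<alpha>) / ?c" and \<kappa>=\<kappa>])
    show "0 < sqrt (?c * lin N)" if "N \<ge> 2" for N using clin[OF that] by (simp only: real_sqrt_gt_0_iff)
    have "(\<lambda>N. lin N / lin N) \<longlonglongrightarrow> 1"
    proof (rule eventually_eq_const)
      fix N :: nat assume "N \<ge> 2"
      from lin[OF this] show "lin N / lin N = 1" by simp
    qed
    from scale[OF this] show "(\<lambda>N. lin N / (sqrt (?c * lin N))\<^sup>2) \<longlonglongrightarrow> 1 / ?c"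
      by (rule tendsto_cong_ge_2) (simp only: B2)
    have "(\<lambda>N. draw N / lin N) \<longlonglongrightarrow> 1 / \<alpha>"
      by (rule tendsto_cong_ge_2[OF \<rho>]) (simp add: pos(8))
    from scale[OF this] show "(\<lambda>N. draw N / (sqrt (?c * lin N))\<^sup>2) \<longlonglongrightarrow> (1 / \<alpha>) / ?c"
      by (rule tendsto_cong_ge_2) (simp only: B2)
    show "1 / ?c + (1 / \<alpha>) / ?c = 1" using c by (simp only: add_divide_distrib[symmetric]) simp
    have "(\<lambda>N. (vf N - lin N) / (?c * lin N)) \<longlonglongrightarrow> 0" using scale[OF err_lin] by simp
    then show "(\<lambda>N. (vf N - lin N) / (sqrt (?c * lin N))\<^sup>2) \<longlonglongrightarrow> 0"
      by (rule tendsto_cong_ge_2) (simp only: B2)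
  qed (use L m h4 \<kappa> k_over_N pos(1,2) in auto)
qed

end

end

end

section \<open>Assembly of the statement\<close>

theorem lemma1:
  fixes P :: "'w measure" and D :: "'z measure"
    and Z :: "nat \<Rightarrow> 'w \<Rightarrow> 'z" and S :: "nat \<Rightarrow> nat \<Rightarrow> 'w \<Rightarrow> nat set"
    and k m :: "nat \<Rightarrow> nat" and h :: "nat \<Rightarrow> (nat \<Rightarrow> 'z) \<Rightarrow> real"
    and U :: "nat \<Rightarrow> 'w \<Rightarrow> real" and \<mu> \<zeta>1 \<zeta>k C a V \<rho> :: "nat \<Rightarrow> real"
  assumes P: "prob_space P"
    and Z_indep: "prob_space.indep_vars P (\<lambda>_. D) Z UNIV"
    and Z_law: "\<And>i. distr P D (Z i) = D"
    and k: "\<And>N. N \<ge> 2 \<Longrightarrow> 0 < k N \<and> k N < N"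
    and k_lim: "filterlim k at_top sequentially"
    and m: "\<And>N. N \<ge> 2 \<Longrightarrow> 0 < m N"
    and S_indep: "\<And>N. N \<ge> 2 \<Longrightarrow>
      prob_space.indep_vars P (\<lambda>_. count_space (k_subsets N (k N))) (S N) {..<m N}"
    and S_law: "\<And>N j. N \<ge> 2 \<Longrightarrow> j < m N \<Longrightarrow>
      distr P (count_space (k_subsets N (k N))) (S N j) =
        uniform_count_measure (k_subsets N (k N))"
    and SZ_indep: "\<And>N. N \<ge> 2 \<Longrightarrow>
      prob_space.indep_set P
        (sets (vimage_algebra (space P) (\<lambda>\<omega> i. Z i \<omega>) (Pi\<^sub>M UNIV (\<lambda>_. D))))
        (sets (vimage_algebra (space P) (\<lambda>\<omega>. \<lambda>j\<in>{..<m N}. S N j \<omega>)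
                (Pi\<^sub>M {..<m N} (\<lambda>_. count_space (k_subsets N (k N))))))"
    and h_meas: "\<And>N. N \<ge> 2 \<Longrightarrow> h N \<in> borel_measurable (arg_law D (k N))"
    and h_sym: "\<And>N. N \<ge> 2 \<Longrightarrow> symmetric_kernel D (k N) (h N)"
    and h_sq: "\<And>N. N \<ge> 2 \<Longrightarrow> integrable (arg_law D (k N)) (\<lambda>z. (h N z)\<^sup>2)"
  defines "U \<equiv> \<lambda>N. incomplete_U (k N) (m N) (h N) Z (S N)"
    and "\<mu> \<equiv> \<lambda>N. kernel_mean D (k N) (h N)"
    and "\<zeta>1 \<equiv> \<lambda>N. zeta D (k N) (h N) 1"
    and "\<zeta>k \<equiv> \<lambda>N. zeta D (k N) (h N) (k N)"
    and "C \<equiv> \<lambda>N. real (N choose k N)"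
    and "a \<equiv> \<lambda>N. (real (k N) / real N) * (\<zeta>k N / (real (k N) * \<zeta>1 N))"
    and "V \<equiv> \<lambda>N. prob_space.variance P (U N)"
    and "\<rho> \<equiv> \<lambda>N. a N * (real N)\<^sup>2 / ((real (k N))\<^sup>2 * real (m N))"
  shows
    "(\<forall>N\<ge>2. V N \<le> (real (k N) / real N) * \<zeta>k N * (1 + real (k N) / real N)
                   + (1 / real (m N)) * \<zeta>k N * (1 - 1 / C N)) \<and>
     ((\<forall>N\<ge>2. \<zeta>1 N \<noteq> 0) \<longrightarrow>
       (\<exists>r\<in>O(a). \<exists>d\<in>O(a). \<forall>N\<ge>2. 0 \<le> d N \<and>
          V N = ((real (k N))\<^sup>2 / real N) * \<zeta>1 N * (1 + r N)
                + (1 / real (m N)) * \<zeta>k N * (1 - 1 / C N) * (1 - d N)) \<and>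
       ((\<lambda>N. 1 / real (m N)) \<in> O(a) \<longrightarrow>
         (\<exists>r\<in>O(a). \<forall>N\<ge>2.
            V N = ((real (k N))\<^sup>2 / real N) * \<zeta>1 N * (1 + r N)
                  + (1 / real (m N)) * \<zeta>k N * (1 - 1 / C N))) \<and>
       (a \<longlonglongrightarrow> 0 \<longrightarrow>
         (\<rho> \<longlonglongrightarrow> 0 \<longrightarrow>
           (\<exists>e\<in>o(\<lambda>_. 1). \<forall>N\<ge>2. V N = (1 + e N) * ((real (k N))\<^sup>2 * \<zeta>1 N / real N)) \<and>
           (lindeberg D k h \<longrightarrow>
             weak_conv_m
               (\<lambda>N. distr P borel (\<lambda>\<omega>. (U N \<omega> - \<mu> N) / sqrt ((real (k N))\<^sup>2 * \<zeta>1 N / real N)))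
               std_normal_distribution)) \<and>
         (filterlim \<rho> at_top sequentially \<longrightarrow>
           (\<exists>e\<in>o(\<lambda>_. 1). \<forall>N\<ge>2. V N = (1 + e N) * (\<zeta>k N / real (m N))) \<and>
           (filterlim m at_top sequentially \<longrightarrow>
            (\<forall>N\<ge>2. integrable (arg_law D (k N)) (\<lambda>z. (h N z) ^ 4)) \<longrightarrow>
            (\<lambda>N. kernel_cmoment D (k N) (h N) 4 / (kernel_cmoment D (k N) (h N) 2)\<^sup>2) \<in> O(\<lambda>_. 1) \<longrightarrow>
             weak_conv_m
               (\<lambda>N. distr P borel (\<lambda>\<omega>. (U N \<omega> - \<mu> N) / sqrt (\<zeta>k N / real (m N))))
               std_normal_distribution)) \<and>
         (\<forall>\<alpha>>0. \<rho> \<longlonglongrightarrow> 1 / \<alpha> \<longrightarrow>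
           (\<exists>e\<in>o(\<lambda>_. 1). \<forall>N\<ge>2.
              V N = (1 + e N) * ((1 + 1 / \<alpha>) * (real (k N))\<^sup>2 * \<zeta>1 N / real N)) \<and>
           (lindeberg D k h \<longrightarrow>
            filterlim m at_top sequentially \<longrightarrow>
            (\<forall>N\<ge>2. integrable (arg_law D (k N)) (\<lambda>z. (h N z) ^ 4)) \<longrightarrow>
            (\<lambda>N. kernel_cmoment D (k N) (h N) 4 / (kernel_cmoment D (k N) (h N) 2)\<^sup>2) \<in> O(\<lambda>_. 1) \<longrightarrow>
             weak_conv_m
               (\<lambda>N. distr P borel
                  (\<lambda>\<omega>. (U N \<omega> - \<mu> N) / sqrt ((1 + 1 / \<alpha>) * (real (k N))\<^sup>2 * \<zeta>1 N / real N)))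
               std_normal_distribution))))"
proof -
  \<comment> \<open>As the law of \<open>Z 0\<close>, \<open>D\<close> is a probability
    measure.\<close>
  have D: "prob_space D"
  proof -
    interpret prob_space P by (rule P)
    have "Z 0 \<in> measurable P D" using Z_indep by (simp add: indep_vars_def)
    from prob_space_distr[OF this] show ?thesis by (simp add: Z_law)
  qed
  interpret Q: ustat_sequence P D Z S k m h
  proof (rule ustat_sequence.intro[OF P], rule ustat_sequence_axioms.intro)
    fix N :: nat assume N: "N \<ge> 2"
    show "k N < N" using k[OF N] by simp
    show "incomplete_sample D (k N) (h N) N (m N) P Z (S N)"
      using D k[OF N] m[OF N] h_meas[OF N] h_sym[OF N] h_sq[OF N] P Z_indep Z_law
        S_indep[OF N] S_law[OF N] SZ_indep[OF N]
      by (intro incomplete_sample.intro incomplete.intro kernel.intro incomplete_axioms.intro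
          incomplete_sample_axioms.intro) auto
  qed
  have eqs: "U = Q.U" "\<mu> = Q.\<mu>" "\<zeta>1 = Q.\<zeta>1" "\<zeta>k = Q.\<zeta>k" "C = Q.C" "a = Q.a" "V = Q.V" "\<rho> = Q.\<rho>"
    unfolding U_def \<mu>_def \<zeta>1_def \<zeta>k_def C_def a_def V_def \<rho>_def
      Q.U_def[abs_def] Q.\<mu>_def[abs_def] Q.\<zeta>1_def[abs_def] Q.\<zeta>k_def[abs_def] Q.C_def[abs_def]
      Q.a_def[abs_def] Q.V_def[abs_def] Q.\<rho>_def[abs_def] by (rule refl)+
  \<comment> \<open>The statement spells out the normalising variances; these equations fold them
    into \<open>lin\<close> and \<open>draw\<close>.\<close>
  have lin: "(real (k N))\<^sup>2 * Q.\<zeta>1 N / real N = Q.lin N" for N by (simp add: Q.lin_def)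
  have lin': "x * (real (k N))\<^sup>2 * Q.\<zeta>1 N / real N = x * Q.lin N" for N x by (simp add: Q.lin_def)
  have draw: "Q.\<zeta>k N / real (m N) = Q.draw N" for N by (simp add: Q.draw_def)
  show ?thesis
    unfolding eqs lin lin' draw
apply (intro conjI impI allI)
  subgoal by (rule Q.variance_upper)
  subgoal premises prems
    using prems by (intro Q.variance_expansion) auto
  subgoal premises prems
    using prems by (intro Q.variance_expansion') auto
  subgoal premises prems
    using prems by (intro Q.case_linear(1)) auto
  subgoal premises prems
    using prems by (intro Q.case_linear(2)) auto
  subgoal premises prems
    using prems by (intro Q.case_draws(1)) auto
  subgoal premises prems
    using prems by (intro Q.case_draws(2)) auto
  subgoal premises prems
    using prems by (intro Q.case_mixed(1)) auto
  subgoal premises prems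
    using prems by (intro Q.case_mixed(2)) auto
  done
qed

end
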